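(* Let $n,m,l\in\mathbb{N}$, let $\Phi:\mathbb{M}_n\to\mathbb{M}_l$ and $\Psi:\mathbb{M}_m\to\mathbb{M}_l$ be strictly positive linear maps, let $0\le p,q\le1$ with $(p,q)\ne(0,0)$, and let $f$ be a non-decreasing (resp., non-increasing) function on $(0,\infty)$. If either $x\mapsto f(x^{1+p})$ or $x\mapsto f(x^{1+q})$ is concave (resp., convex) on $(0,\infty)$, then the functions $$(A,B)\in\mathbb{P}_n\times\mathbb{P}_m\longmapsto\mathrm{Tr}\, f\bigl(\Phi(A^p)^{1/2}\Psi(B^q)\Phi(A^p)^{1/2}\bigr)$$ and $$(A,B)\in\mathbb{P}_n\times\mathbb{P}_m\longmapsto\mathrm{Tr}\, f\bigl((\Phi(A^{-p})^{1/2}\Psi(B^{-q})\Phi(A^{-p})^{1/2})^{-1}\bigr)$$ are jointly concave (resp., jointly convex).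
   Context: $\mathbb{M}_n$: $n\times n$ complex matrices; $\mathbb{P}_n$: positive definite ones; $\mathrm{Tr}$: usual trace. A linear map is strictly positive if it maps positive definite matrices to positive definite matrices. *)

theory Defs
  imports "HOL-Analysis.Analysis"
begin

text \<open>Complex n x n matrices are rendered as \<open>complex^'n^'n\<close> for a finite index type \<open>'n\<close>
  (the dimension n = CARD('n) is arbitrary but fixed).\<close>

definition cadj :: "complex^'n^'m \<Rightarrow> complex^'m^'n" where
  "cadj A = (\<chi> i j. cnj (A $ j $ i))"

definition hermitian_mat :: "complex^'n^'n \<Rightarrow> bool" where
  "hermitian_mat A \<longleftrightarrow> cadj A = A"

definition unitary_mat :: "complex^'n^'n \<Rightarrow> bool" where
  "unitary_mat U \<longleftrightarrow> cadj U ** U = mat 1"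

definition posdef :: "complex^'n^'n \<Rightarrow> bool" where
  "posdef A \<longleftrightarrow> hermitian_mat A \<and>
     (\<forall>x::complex^'n. x \<noteq> 0 \<longrightarrow> Re (\<Sum>i\<in>UNIV. cnj (x $ i) * (A *v x) $ i) > 0)"

definition diag_mat :: "('n \<Rightarrow> complex) \<Rightarrow> complex^'n^'n" where
  "diag_mat d = (\<chi> i j. if i = j then d i else 0)"

text \<open>Functional calculus for Hermitian matrices: if A = U diag(d) U* with U unitary and
  d real, then f(A) = U diag(f \<circ> d) U*. (This is independent of the choice of U, d.)\<close>
definition matfun :: "(real \<Rightarrow> real) \<Rightarrow> complex^'n^'n \<Rightarrow> complex^'n^'n" where
  "matfun f A = (let (U, d) = (SOME (U, d). unitary_mat U \<and>
        A = U ** diag_mat (\<lambda>i. complex_of_real (d i)) ** cadj U)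
     in U ** diag_mat (\<lambda>i. complex_of_real (f (d i))) ** cadj U)"

definition cscale :: "complex \<Rightarrow> complex^'n^'m \<Rightarrow> complex^'n^'m" where
  "cscale c A = (\<chi> i j. c * A $ i $ j)"

definition clinear_map :: "(complex^'n^'n \<Rightarrow> complex^'l^'l) \<Rightarrow> bool" where
  "clinear_map \<Phi> \<longleftrightarrow> (\<forall>A B. \<Phi> (A + B) = \<Phi> A + \<Phi> B) \<and> (\<forall>c A. \<Phi> (cscale c A) = cscale c (\<Phi> A))"

definition strictly_positive :: "(complex^'n^'n \<Rightarrow> complex^'l^'l) \<Rightarrow> bool" where
  "strictly_positive \<Phi> \<longleftrightarrow> (\<forall>A. posdef A \<longrightarrow> posdef (\<Phi> A))"

definition jointly_concave :: "(complex^'n^'n \<Rightarrow> complex^'m^'m \<Rightarrow> real) \<Rightarrow> bool" where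
  "jointly_concave F \<longleftrightarrow> (\<forall>A1 A2 B1 B2 t. posdef A1 \<and> posdef A2 \<and> posdef B1 \<and> posdef B2 \<and>
      0 \<le> t \<and> t \<le> 1 \<longrightarrow>
      t * F A1 B1 + (1 - t) * F A2 B2 \<le> F (t *\<^sub>R A1 + (1 - t) *\<^sub>R A2) (t *\<^sub>R B1 + (1 - t) *\<^sub>R B2))"

definition jointly_convex :: "(complex^'n^'n \<Rightarrow> complex^'m^'m \<Rightarrow> real) \<Rightarrow> bool" where
  "jointly_convex F \<longleftrightarrow> (\<forall>A1 A2 B1 B2 t. posdef A1 \<and> posdef A2 \<and> posdef B1 \<and> posdef B2 \<and>
      0 \<le> t \<and> t \<le> 1 \<longrightarrow>
      F (t *\<^sub>R A1 + (1 - t) *\<^sub>R A2) (t *\<^sub>R B1 + (1 - t) *\<^sub>R B2) \<le> t * F A1 B1 + (1 - t) * F A2 B2)"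

end

theory Submission
  imports Defs "HOL-Complex_Analysis.Conformal_Mappings"
begin

text \<open>
  Write \<open>X = \<Phi>(A\<^sup>p)\<close>, \<open>Y = \<Psi>(B\<^sup>q)\<close>, \<open>h(x) = f(x\<^bsup>1+p\<^esup>)\<close> and let \<open>v\<close> be the increasing list of
  eigenvalues of \<open>M = (X\<^bsup>1/2\<^esup> Y X\<^bsup>1/2\<^esup>)\<^bsup>1/(1+p)\<^esup>\<close>. Since \<open>h\<close> is concave and non-decreasing, it suffices
  that for every \<open>k\<close> the sum of the \<open>k\<close> smallest entries of \<open>v\<close> is jointly concave.

  For \<open>k\<close> equal to the dimension, a congruence makes \<open>X = M\<^sup>p\<close> and \<open>Y = M\<close> at the convex combination.
  At the end points \<open>2 Tr M\<^sub>j \<le> Tr Y\<^sub>j + Tr X\<^sub>j M\<^sub>j\<^bsup>1-p\<^esup>\<close> by AM-GM in a pair of eigenbases. Averaging and using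
  Lieb's concavity of \<open>(A, Z) \<mapsto> Tr \<Phi>(A\<^sup>p) Z\<^bsup>1-p\<^esup>\<close> gives, with \<open>N\<close> the average of the \<open>M\<^sub>j\<close>,
  \<open>2 Tr N \<le> Tr M + Tr M\<^sup>p N\<^bsup>1-p\<^esup> \<le> (1 + p) Tr M + (1 - p) Tr N\<close>, i.e. \<open>Tr N \<le> Tr M\<close>. For general \<open>k\<close>
  the congruence is modified so as to shrink the large eigenvalues of \<open>M\<close> by a factor \<open>\<epsilon>\<close>, and an
  interlacing argument recovers the \<open>k\<close> smallest eigenvalues of \<open>M\<^sub>j\<close>.

  Lieb's theorem is needed for maps that are merely positive. It follows from the three lines
  theorem: on the edges of the strip one of the two factors is unitary, and after diagonalising it
  only positivity of \<open>\<Phi>\<close> on rank one matrices is used.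

  The second function reduces to the first, because \<open>\<Phi>(A\<^bsup>-p\<^esup>)\<^bsup>-1\<^esup>\<close> is the minimum of
  \<open>W\<^bsup>-1\<^esup> \<Phi>(K A\<^sup>p K) W\<^bsup>-1\<^esup>\<close> over \<open>K > 0\<close>, with \<open>W = \<Phi>(K)\<close>, attained at \<open>K = A\<^bsup>-p\<^esup>\<close>.
\<close>

section \<open>The complex inner product and the spectral theorem\<close>

definition cip :: "complex^'n \<Rightarrow> complex^'n \<Rightarrow> complex" where
  "cip x y = (\<Sum>i\<in>UNIV. cnj (x $ i) * y $ i)"

lemma cip_add_left: "cip (x + y) z = cip x z + cip y z"
  and cip_add_right: "cip z (x + y) = cip z x + cip z y"
  and cip_diff_left: "cip (x - y) z = cip x z - cip y z"
  and cip_diff_right: "cip z (x - y) = cip z x - cip z y"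
  and cip_zero_left [simp]: "cip 0 z = 0"
  and cip_zero_right [simp]: "cip z 0 = 0"
  by (simp_all add: cip_def algebra_simps sum.distrib sum_subtractf)

lemma cip_smult_left: "cip (c *s x) y = cnj c * cip x y"
  and cip_smult_right: "cip x (c *s y) = c * cip x y"
  and cip_scaleR_left: "cip (r *\<^sub>R x) y = of_real r * cip x y"
  and cip_scaleR_right: "cip x (r *\<^sub>R y) = of_real r * cip x y"
  by (simp_all add: cip_def sum_distrib_left mult_ac, simp_all add: scaleR_conv_of_real mult_ac)

lemmas cip_simps = cip_add_left cip_add_right cip_diff_left cip_diff_right
  cip_smult_left cip_smult_right cip_scaleR_left cip_scaleR_right

lemma cip_sum_right: "cip x (\<Sum>i\<in>S. f i) = (\<Sum>i\<in>S. cip x (f i))"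
  by (induction S rule: infinite_finite_induct) (auto simp: cip_simps)

lemma cnj_cip: "cnj (cip x y) = cip y x"
  by (simp add: cip_def mult.commute)

lemma Re_cip: "Re (cip x y) = x \<bullet> y"
  by (simp add: cip_def inner_vec_def inner_complex_def)

lemma Re_cip_commute: "Re (cip x y) = Re (cip y x)"
  by (simp add: Re_cip inner_commute)

lemma cip_self: "cip x x = of_real ((norm x)\<^sup>2)"
proof (rule complex_eqI)
  show "Im (cip x x) = Im (of_real ((norm x)\<^sup>2))"
    by (metis Im_complex_of_real cnj.sel(2) cnj_cip neg_equal_zero)
qed (simp add: Re_cip power2_norm_eq_inner)

lemma cip_self_eq_0 [simp]: "cip x x = 0 \<longleftrightarrow> x = 0"
  by (simp add: cip_self)

section \<open>Adjoints, Hermitian and positive semidefinite matrices\<close>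

lemma cip_cadj: "cip x (A *v y) = cip (cadj A *v x) y"
proof -
  have "cip x (A *v y) = (\<Sum>i\<in>UNIV. \<Sum>j\<in>UNIV. cnj (x $ i) * (A $ i $ j * y $ j))"
    by (simp add: cip_def matrix_vector_mult_def sum_distrib_left)
  also have "\<dots> = (\<Sum>j\<in>UNIV. \<Sum>i\<in>UNIV. cnj (x $ i) * (A $ i $ j * y $ j))"
    by (rule sum.swap)
  also have "\<dots> = cip (cadj A *v x) y"
    by (simp add: cip_def matrix_vector_mult_def cadj_def sum_distrib_right sum_distrib_left
        mult_ac)
  finally show ?thesis .
qed

lemma cadj_cadj [simp]: "cadj (cadj A) = A"
  by (simp add: cadj_def vec_eq_iff)

lemma cip_cadj': "cip (A *v x) y = cip x (cadj A *v y)"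
  by (simp add: cip_cadj)

lemma cadj_mult: "cadj (A ** B) = cadj B ** cadj A"
  by (simp add: cadj_def vec_eq_iff matrix_matrix_mult_def mult.commute)

lemma cadj_add: "cadj (A + B) = cadj A + cadj B"
  and cadj_diff: "cadj (A - B) = cadj A - cadj B"
  and cadj_scaleR: "cadj (r *\<^sub>R A) = r *\<^sub>R cadj A"
  and cadj_cscale: "cadj (cscale c A) = cscale (cnj c) (cadj A)"
  and cadj_0 [simp]: "cadj 0 = 0"
  by (simp_all add: cadj_def cscale_def vec_eq_iff)

lemma cadj_mat_1 [simp]: "cadj (mat 1) = mat 1"
  by (auto simp: cadj_def mat_def vec_eq_iff)

lemma hermitian_cip: "hermitian_mat A \<Longrightarrow> cip (A *v x) y = cip x (A *v y)"
  by (simp add: cip_cadj hermitian_mat_def)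

lemma hermitian_Im_cip: "hermitian_mat A \<Longrightarrow> Im (cip x (A *v x)) = 0"
  by (metis Reals_cnj_iff complex_is_Real_iff cnj_cip hermitian_cip)

lemma posdef_iff: "posdef A \<longleftrightarrow> hermitian_mat A \<and> (\<forall>x. x \<noteq> 0 \<longrightarrow> Re (cip x (A *v x)) > 0)"
  by (simp add: posdef_def cip_def)

definition psd :: "complex^'n^'n \<Rightarrow> bool" where
  "psd A \<longleftrightarrow> hermitian_mat A \<and> (\<forall>x. Re (cip x (A *v x)) \<ge> 0)"

lemma posdef_imp_psd: "posdef A \<Longrightarrow> psd A"
  unfolding posdef_iff psd_def by (metis cip_zero_left less_imp_le order_refl zero_complex.sel(1))

section \<open>Eigenvectors of commuting Hermitian matrices\<close>

lemma matrix_vector_scaleR: "A *v (r *\<^sub>R x) = r *\<^sub>R (A *v x)" for A :: "complex^'n^'m"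
  by (rule linear_scale[OF matrix_vector_mul_linear])

text \<open>Complex orthogonality to s is real orthogonality to s and to its multiple by the
  imaginary unit. So there are at most \<open>2 * card S\<close> real conditions, fewer than the
  real dimension of the space.\<close>

lemma exists_orthogonal_vector:
  fixes S :: "(complex^'n) set"
  assumes "finite S" "card S < CARD('n)"
  obtains v where "v \<noteq> 0" "\<And>s. s \<in> S \<Longrightarrow> cip s v = 0"
proof -
  let ?S = "S \<union> (\<lambda>s. \<i> *s s) ` S"
  have "dim ?S \<le> card ?S"
    using assms by (intro dim_le_card') auto
  also have "\<dots> \<le> card S + card S"
    by (meson add_left_mono assms(1) card_Un_le card_image_le order_trans)
  also have "\<dots> < DIM(complex^'n)"
    using assms(2) by simp
  finally obtain v where v: "v \<noteq> 0" "\<And>y. y \<in> span ?S \<Longrightarrow> orthogonal v y"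
    using orthogonal_to_subspace_exists by blast
  have "cip s v = 0" if "s \<in> S" for s
  proof -
    have "orthogonal v s" "orthogonal v (\<i> *s s)"
      using that by (auto intro!: v(2) span_base)
    hence "Re (cip s v) = 0" "Re (cip (\<i> *s s) v) = 0"
      by (simp_all add: Re_cip orthogonal_def inner_commute)
    thus ?thesis
      by (simp add: cip_smult_left complex_eq_iff)
  qed
  with v(1) that show thesis by blast
qed

text \<open>The Rayleigh quotient attains its minimum d on the compact unit sphere of V. The
  residual \<open>w = A x - d x\<close> lies in V by invariance, and perturbing the minimiser along
  w shows that w vanishes.\<close>

lemma rayleigh_minimum:
  fixes A :: "complex^'n^'n"
  assumes herm: "hermitian_mat A" and V: "subspace V" "V \<noteq> {0}"
    and inv: "\<And>x. x \<in> V \<Longrightarrow> A *v x \<in> V"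
  obtains x d where "x \<in> V" "norm x = 1" "A *v x = d *\<^sub>R x"
    "\<And>y. y \<in> V \<Longrightarrow> d * (norm y)\<^sup>2 \<le> Re (cip y (A *v y))"
proof -
  define q where "q = (\<lambda>x. x \<bullet> (A *v x))"
  have q: "q x = Re (cip x (A *v x))" for x
    by (simp add: q_def Re_cip)
  have "compact (sphere 0 1 \<inter> V)"
    using V(1) by (intro compact_Int_closed closed_subspace) auto
  moreover obtain v where v: "v \<in> V" "v \<noteq> 0"
    using V subspace_0 by blast
  hence "(1 / norm v) *\<^sub>R v \<in> sphere 0 1 \<inter> V"
    using V(1) by (auto simp: subspace_scale)
  hence "sphere 0 1 \<inter> V \<noteq> {}" by blast
  moreover have "continuous_on (sphere 0 1 \<inter> V) q"
    unfolding q_def by (intro continuous_intros linear_continuous_on matrix_vector_mul_bounded_linear)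
  ultimately obtain x where x: "x \<in> sphere 0 1 \<inter> V" "\<And>y. y \<in> sphere 0 1 \<inter> V \<Longrightarrow> q x \<le> q y"
    using continuous_attains_inf by metis
  define d where "d = q x"
  have scale: "q (r *\<^sub>R y) = r\<^sup>2 * q y" for r y
    by (simp add: q_def matrix_vector_scaleR power2_eq_square)
  have min: "d * (norm y)\<^sup>2 \<le> q y" if "y \<in> V" for y
  proof (cases "y = 0")
    case False
    have "d \<le> q ((1 / norm y) *\<^sub>R y)"
      unfolding d_def using False that V(1) by (intro x(2)) (auto simp: subspace_scale)
    thus ?thesis
      using False by (simp add: scale power_divide field_simps)
  qed (simp add: q_def)
  define w where "w = A *v x - d *\<^sub>R x"
  have xV: "x \<in> V" and nx: "norm x = 1" using x(1) by auto
  have wV: "w \<in> V"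
    unfolding w_def using V(1) inv xV by (simp add: subspace_diff subspace_scale)
  define g where "g = q w - d * (norm w)\<^sup>2"
  have sym: "w \<bullet> (A *v x) = x \<bullet> (A *v w)"
    by (metis Re_cip Re_cip_commute herm hermitian_cip)
  \<comment> \<open>Minimality at \<open>x + e w\<close>: the terms of order zero cancel, and the
    linear coefficient is \<open>2 (w \<bullet> w)\<close> because
    \<open>w \<bullet> A x = w \<bullet> w + d (w \<bullet> x)\<close>.\<close>
  have ineq: "0 \<le> 2 * e * (w \<bullet> w) + e\<^sup>2 * g" for e :: real
  proof -
    have "d * (norm (x + e *\<^sub>R w))\<^sup>2 \<le> q (x + e *\<^sub>R w)"
      using V(1) xV wV by (intro min) (simp add: subspace_add subspace_scale)
    moreover have "(norm (x + e *\<^sub>R w))\<^sup>2 = 1 + 2 * e * (w \<bullet> x) + e\<^sup>2 * (norm w)\<^sup>2"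
    proof -
      have "x \<bullet> x = 1" using nx by (simp add: norm_eq_1)
      thus ?thesis
        by (simp only: power2_norm_eq_inner inner_add_left inner_add_right inner_commute[of x w]
            inner_scaleR_left inner_scaleR_right) (simp add: power2_eq_square algebra_simps)
    qed
    moreover have "q (x + e *\<^sub>R w) = d + 2 * e * (w \<bullet> (A *v x)) + e\<^sup>2 * q w"
      unfolding d_def q_def
      by (simp add: matrix_vector_right_distrib matrix_vector_scaleR inner_add algebra_simps
          sym power2_eq_square)
    moreover have "w \<bullet> (A *v x) = w \<bullet> w + d * (w \<bullet> x)"
      unfolding w_def by (simp add: inner_diff_right)
    hence "e * (w \<bullet> (A *v x)) = e * (w \<bullet> w) + d * (e * (w \<bullet> x))"
      by (simp add: distrib_left)
    ultimately show ?thesis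
      unfolding g_def by (simp add: algebra_simps)
  qed
  have "w \<bullet> w = 0"
  proof (rule ccontr)
    assume "w \<bullet> w \<noteq> 0"
    hence pos: "w \<bullet> w > 0" by simp
    \<comment> \<open>A negative step so short that
      \<open>\<bar>e * g\<bar> \<le> w \<bullet> w\<close>; the linear term in \<open>ineq\<close>
      then dominates the quadratic one.\<close>
    define e where "e = - (w \<bullet> w) / (\<bar>g\<bar> + 1)"
    have "e < 0" using pos unfolding e_def by (simp add: divide_pos_pos)
    moreover have "2 * (w \<bullet> w) + e * g > 0"
    proof -
      have "\<bar>e * g\<bar> \<le> w \<bullet> w"
        unfolding e_def using pos by (simp add: abs_mult field_simps)
      thus ?thesis using pos by linarith
    qed
    ultimately have "e * (2 * (w \<bullet> w) + e * g) < 0"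
      by (simp add: mult_neg_pos)
    moreover have "e * (2 * (w \<bullet> w) + e * g) = 2 * e * (w \<bullet> w) + e\<^sup>2 * g"
      by (simp add: algebra_simps power2_eq_square)
    ultimately show False using ineq[of e] by linarith
  qed
  hence "A *v x = d *\<^sub>R x" by (simp add: w_def)
  thus thesis using that xV nx min q by metis
qed

text \<open>Induction on k. The form of A is minimised on the orthogonal complement of the earlier
  vectors, and the next vector is an eigenvector of B inside the resulting eigenspace of A, which B
  preserves by commutation. The Rayleigh bound on each complement is carried along because it forces
  the eigenvalues of A to increase.\<close>

lemma commuting_hermitian_eigenvectors:
  fixes A B :: "complex^'n^'n"
  assumes A: "hermitian_mat A" and B: "hermitian_mat B" and comm: "A ** B = B ** A"
    and "k \<le> CARD('n)"
  shows "\<exists>v a b. (\<forall>i<k. \<forall>j<k. cip (v i) (v j) = (if i = j then 1 else 0)) \<and>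
    (\<forall>i<k. A *v v i = a i *\<^sub>R v i \<and> B *v v i = b i *\<^sub>R v i) \<and>
    (\<forall>i<k. \<forall>j\<le>i. a j \<le> (a i :: real)) \<and>
    (\<forall>i<k. \<forall>y. (\<forall>j<k. cip (v j) y = 0) \<longrightarrow> a i * (norm y)\<^sup>2 \<le> Re (cip y (A *v y)))"
  using \<open>k \<le> CARD('n)\<close>
proof (induction k)
  case 0
  show ?case by simp
next
  case (Suc k)
  then have "k \<le> CARD('n)" by simp
  from Suc.IH[OF this] obtain v a b where
    H: "\<forall>i<k. \<forall>j<k. cip (v i) (v j) = (if i = j then 1 else 0)"
    "\<forall>i<k. A *v v i = a i *\<^sub>R v i \<and> B *v v i = b i *\<^sub>R v i"
    "\<forall>i<k. \<forall>j\<le>i. a j \<le> (a i :: real)"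
    "\<forall>i<k. \<forall>y. (\<forall>j<k. cip (v j) y = 0) \<longrightarrow> a i * (norm y)\<^sup>2 \<le> Re (cip y (A *v y))"
    by (elim exE conjE) (rule that)
  have on: "cip (v i) (v j) = (if i = j then 1 else 0)" if "i < k" "j < k" for i j
    using H(1) that by blast
  have eig: "A *v v i = a i *\<^sub>R v i" "B *v v i = b i *\<^sub>R v i" if "i < k" for i
    using H(2) that by blast+
  have mono: "a j \<le> a i" if "i < k" "j \<le> i" for i j
    using H(3) that by blast
  have ray: "a i * (norm y)\<^sup>2 \<le> Re (cip y (A *v y))" if "i < k" "\<forall>j<k. cip (v j) y = 0" for i y
    using H(4) that by blast
  define V where "V = {y. \<forall>j<k. cip (v j) y = 0}"
  have subV: "subspace V"
    by (auto simp: subspace_def V_def cip_simps)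
  have "card (v ` {..<k}) < CARD('n)"
    using Suc.prems card_image_le[of "{..<k}" v] by simp
  then obtain y0 where "y0 \<noteq> 0" "\<And>s. s \<in> v ` {..<k} \<Longrightarrow> cip s y0 = 0"
    using exists_orthogonal_vector[of "v ` {..<k}"] by auto
  hence V0: "V \<noteq> {0}" by (auto simp: V_def)
  have invA: "A *v x \<in> V" if "x \<in> V" for x
    using that eig(1) by (simp add: V_def hermitian_cip[OF A, symmetric] cip_simps)
  have invB: "B *v x \<in> V" if "x \<in> V" for x
    using that eig(2) by (simp add: V_def hermitian_cip[OF B, symmetric] cip_simps)
  obtain x d where x: "x \<in> V" "norm x = 1" "A *v x = d *\<^sub>R x"
    and d: "\<And>y. y \<in> V \<Longrightarrow> d * (norm y)\<^sup>2 \<le> Re (cip y (A *v y))"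
    using rayleigh_minimum[OF A subV V0 invA] by metis
  define W where "W = V \<inter> {y. A *v y = d *\<^sub>R y}"
  have subW: "subspace W"
    using subV unfolding W_def subspace_def
    by (simp add: matrix_vector_right_distrib matrix_vector_scaleR scaleR_right_distrib)
  have "x \<in> W" "x \<noteq> 0" using x by (auto simp: W_def)
  hence W0: "W \<noteq> {0}" by blast
  have invW: "B *v y \<in> W" if "y \<in> W" for y
  proof -
    have "A *v (B *v y) = B *v (A *v y)" by (simp add: matrix_vector_mul_assoc comm)
    thus ?thesis using that invB[of y] by (simp add: W_def matrix_vector_scaleR)
  qed
  obtain z e where z: "z \<in> W" "norm z = 1" "B *v z = e *\<^sub>R z"
    using rayleigh_minimum[OF B subW W0 invW] by metis
  have zV: "z \<in> V" and Az: "A *v z = d *\<^sub>R z" using z(1) by (auto simp: W_def)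
  \<comment> \<open>The earlier Rayleigh bounds are tested at z, which lies in every earlier
    complement.\<close>
  have ad: "a i \<le> d" if "i < k" for i
    using ray[OF that, of z] zV by (simp add: Az z(2) V_def cip_simps cip_self)
  have vz: "cip (v j) z = 0" "cip z (v j) = 0" if "j < k" for j
  proof -
    show "cip (v j) z = 0" using zV that by (simp add: V_def)
    thus "cip z (v j) = 0" using cnj_cip[of "v j" z] by simp
  qed
  have zz: "cip z z = 1" using z(2) by (simp add: cip_self)
  show ?case
  proof (rule exI[of _ "v(k := z)"], rule exI[of _ "a(k := d)"], rule exI[of _ "b(k := e)"],
      intro conjI)
    show "\<forall>i<Suc k. \<forall>j<Suc k. cip ((v(k := z)) i) ((v(k := z)) j) = (if i = j then 1 else 0)"
      using H(1) vz zz by (simp add: less_Suc_eq)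
    show "\<forall>i<Suc k. A *v (v(k := z)) i = (a(k := d)) i *\<^sub>R (v(k := z)) i \<and>
        B *v (v(k := z)) i = (b(k := e)) i *\<^sub>R (v(k := z)) i"
      using H(2) Az z(3) by (simp add: less_Suc_eq)
    show "\<forall>i<Suc k. \<forall>j\<le>i. (a(k := d)) j \<le> (a(k := d)) i"
    proof (intro allI impI)
      fix i j assume "i < Suc k" "j \<le> i"
      thus "(a(k := d)) j \<le> (a(k := d)) i"
        using mono[of i j] ad[of j] by (cases "i = k"; cases "j = k") auto
    qed
    show "\<forall>i<Suc k. \<forall>y. (\<forall>j<Suc k. cip ((v(k := z)) j) y = 0) \<longrightarrow>
        (a(k := d)) i * (norm y)\<^sup>2 \<le> Re (cip y (A *v y))"
    proof (intro allI impI)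
      fix i y assume i: "i < Suc k" and y: "\<forall>j<Suc k. cip ((v(k := z)) j) y = 0"
      have "\<forall>j<k. cip (v j) y = 0"
        using y by (metis fun_upd_other less_SucI nat_neq_iff)
      thus "(a(k := d)) i * (norm y)\<^sup>2 \<le> Re (cip y (A *v y))"
        using i ray[of i y] d[of y] by (cases "i = k") (auto simp: V_def)
    qed
  qed
qed

section \<open>Spectral decompositions and functional calculus\<close>

definition outer :: "complex^'n \<Rightarrow> complex^'n^'n" where
  "outer v = (\<chi> i j. v $ i * cnj (v $ j))"

definition sp :: "complex^'n^'n \<Rightarrow> ('n \<Rightarrow> complex) \<Rightarrow> complex^'n^'n" where
  "sp U d = U ** diag_mat d ** cadj U"

abbreviation rsp :: "complex^'n^'n \<Rightarrow> ('n \<Rightarrow> real) \<Rightarrow> complex^'n^'n" where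
  "rsp U d \<equiv> sp U (\<lambda>i. complex_of_real (d i))"

text \<open>An arbitrary enumeration of the index type, with respect to which the eigenvalues of a
  spectral decomposition are listed in increasing order.\<close>

definition idx :: "'n::finite \<Rightarrow> nat" where
  "idx = (SOME f. bij_betw f UNIV {..<CARD('n)})"

lemma bij_betw_idx: "bij_betw (idx :: 'n::finite \<Rightarrow> nat) UNIV {..<CARD('n)}"
proof -
  have "\<exists>f :: 'n \<Rightarrow> nat. bij_betw f UNIV {..<CARD('n)}"
    by (rule finite_same_card_bij) auto
  thus ?thesis unfolding idx_def by (rule someI_ex)
qed

lemma idx_less [simp]: "idx (i::'n::finite) < CARD('n)"
  using bij_betwE[OF bij_betw_idx] by auto

lemma idx_eq_iff [simp]: "idx i = idx j \<longleftrightarrow> i = j"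
  using bij_betw_idx by (metis bij_betw_def injD)

lemma unitary_right: "unitary_mat U \<Longrightarrow> U ** cadj U = mat 1"
  unfolding unitary_mat_def using matrix_left_right_inverse by blast

lemma unitary_mult: "unitary_mat U \<Longrightarrow> unitary_mat V \<Longrightarrow> unitary_mat (U ** V)"
proof -
  assume UV: "unitary_mat U" "unitary_mat V"
  have "cadj (U ** V) ** (U ** V) = cadj V ** (cadj U ** U) ** V"
    by (simp add: cadj_mult matrix_mul_assoc)
  thus "unitary_mat (U ** V)" using UV by (simp add: unitary_mat_def)
qed

lemma cip_column: "cip (column i U) (column j V) = (cadj U ** V) $ i $ j"
  by (simp add: cip_def column_def cadj_def matrix_matrix_mult_def)

lemma column_mult: "column j (A ** B) = A *v column j B"
  by (simp add: column_def matrix_matrix_mult_def matrix_vector_mult_def vec_eq_iff)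

lemma unitary_columns:
  "unitary_mat U \<longleftrightarrow> (\<forall>i j. cip (column i U) (column j U) = (if i = j then 1 else 0))"
  by (simp add: cip_column unitary_mat_def vec_eq_iff mat_def)

lemma mult_diag_mat: "(A ** diag_mat d) $ i $ j = A $ i $ j * d j"
  by (simp add: diag_mat_def matrix_matrix_mult_def if_distrib sum.delta cong: if_cong)

lemma diag_mat_mult_left: "(diag_mat d ** A) $ i $ j = d i * A $ i $ j"
  by (simp add: diag_mat_def matrix_matrix_mult_def if_distrib if_distribR sum.delta' cong: if_cong)

lemma diag_mat_mult: "diag_mat d ** diag_mat e = diag_mat (\<lambda>i. d i * e i)"
  by (simp add: vec_eq_iff mult_diag_mat) (simp add: diag_mat_def)

lemma cadj_diag_mat: "cadj (diag_mat d) = diag_mat (\<lambda>i. cnj (d i))"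
  by (auto simp: cadj_def diag_mat_def vec_eq_iff)

lemma sp_mult:
  assumes "unitary_mat U"
  shows "sp U d ** sp U e = sp U (\<lambda>i. d i * e i)"
proof -
  have "sp U d ** sp U e = U ** diag_mat d ** (cadj U ** U) ** diag_mat e ** cadj U"
    by (simp add: sp_def matrix_mul_assoc)
  also have "\<dots> = U ** (diag_mat d ** diag_mat e) ** cadj U"
    using assms by (simp add: unitary_mat_def matrix_mul_assoc)
  finally show ?thesis by (simp add: sp_def diag_mat_mult)
qed

lemma cadj_sp: "cadj (sp U d) = sp U (\<lambda>i. cnj (d i))"
  by (simp add: sp_def cadj_mult cadj_diag_mat matrix_mul_assoc)

lemma hermitian_rsp: "hermitian_mat (rsp U d)"
  by (simp add: hermitian_mat_def cadj_sp)

lemma sp_1: "unitary_mat (U :: complex^'a^'a) \<Longrightarrow> sp U (\<lambda>i. 1) = mat 1"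
proof -
  have "diag_mat (\<lambda>i. 1) = (mat 1 :: complex^'a^'a)" by (simp add: diag_mat_def mat_def)
  thus "unitary_mat U \<Longrightarrow> ?thesis" by (simp add: sp_def unitary_right)
qed

lemma trace_sp: 
  assumes "unitary_mat U"
  shows "trace (sp U d) = (\<Sum>i\<in>UNIV. d i)"
proof -
  have "trace (sp U d) = trace (cadj U ** (U ** diag_mat d))"
    unfolding sp_def by (rule trace_mul_sym)
  also have "\<dots> = trace (diag_mat d)"
    using assms by (simp add: matrix_mul_assoc unitary_mat_def)
  finally show ?thesis by (simp add: trace_def diag_mat_def)
qed

lemma sp_column: "unitary_mat U \<Longrightarrow> sp U d *v column i U = d i *s column i U"
proof -
  assume U: "unitary_mat U"
  have "sp U d *v column i U = column i (U ** diag_mat d ** (cadj U ** U))"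
    by (simp add: sp_def column_mult matrix_mul_assoc matrix_vector_mul_assoc)
  also have "\<dots> = column i (U ** diag_mat d)"
    using U by (simp add: unitary_mat_def)
  also have "\<dots> = d i *s column i U"
    by (simp add: column_def mult_diag_mat vec_eq_iff)
  finally show ?thesis .
qed

lemma sp_eqI:
  assumes U: "unitary_mat U" and eig: "\<And>i. A *v column i U = d i *s column i U"
  shows "A = sp U d"
proof -
  have "column i (A ** U) = column i (sp U d ** U)" for i
    by (simp add: column_mult eig sp_column[OF U])
  hence "A ** U = sp U d ** U"
    by (simp add: column_def vec_eq_iff)
  hence "A ** U ** cadj U = sp U d ** U ** cadj U" by simp
  thus ?thesis
    by (simp add: matrix_mul_assoc[symmetric] unitary_right[OF U])
qed

lemma matrix_add_rdistrib: "(A + B) ** C = A ** C + B ** C" for A :: "complex^'n^'m"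
  by (simp add: matrix_matrix_mult_def vec_eq_iff distrib_right sum.distrib)

lemma matrix_diff_ldistrib: "A ** (B - C) = A ** B - A ** C" for A :: "complex^'n^'m"
  by (simp add: matrix_matrix_mult_def vec_eq_iff right_diff_distrib sum_subtractf)

lemma matrix_diff_rdistrib: "(A - B) ** C = A ** C - B ** C" for A :: "complex^'n^'m"
  by (simp add: matrix_matrix_mult_def vec_eq_iff left_diff_distrib sum_subtractf)

lemma matrix_mult_sum_right: "A ** (\<Sum>i\<in>S. B i) = (\<Sum>i\<in>S. A ** B i)" for A :: "complex^'n^'m"
  by (induction S rule: infinite_finite_induct) (auto simp: matrix_add_ldistrib)

lemma matrix_mult_sum_left: "(\<Sum>i\<in>S. B i) ** A = (\<Sum>i\<in>S. B i ** A)" for A :: "complex^'n^'m"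
  by (induction S rule: infinite_finite_induct) (auto simp: matrix_add_rdistrib)

lemma cscale_nth: "cscale c A $ i $ j = c * A $ i $ j"
  by (simp add: cscale_def)

lemma cscale_add: "cscale c (A + B) = cscale c A + cscale c B"
  by (simp add: cscale_nth vec_eq_iff distrib_left)

lemma cscale_mult_left: "cscale c A ** B = cscale c (A ** B)"
  by (simp add: cscale_nth vec_eq_iff matrix_matrix_mult_def sum_distrib_left mult.assoc)

lemma cscale_mult_right: "A ** cscale c B = cscale c (A ** B)"
  by (simp add: cscale_nth vec_eq_iff matrix_matrix_mult_def sum_distrib_left mult.left_commute)

lemma cscale_cscale: "cscale c (cscale d A) = cscale (c * d) A"
  by (simp add: cscale_nth vec_eq_iff mult.assoc)

lemma cscale_of_real: "cscale (of_real r) A = r *\<^sub>R A"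
  unfolding vec_eq_iff cscale_nth by (simp add: scaleR_conv_of_real[where 'a=complex])

lemma trace_cscale: "trace (cscale c A) = c * trace A"
  by (simp add: cscale_nth trace_def sum_distrib_left)

lemma cscale_vector: "cscale c A *v x = c *s (A *v x)"
  by (simp add: cscale_nth vec_eq_iff matrix_vector_mult_def sum_distrib_left mult.assoc)

lemma trace_sum: "trace (\<Sum>i\<in>S. B i) = (\<Sum>i\<in>S. trace (B i))"
  unfolding trace_def sum_component by (rule sum.swap)

text \<open>The expansion into rank one terms lets a linear map be evaluated on each
  \<open>outer\<close> separately, where positivity applies.\<close>

lemma sp_eq_sum: "sp U d = (\<Sum>i\<in>UNIV. cscale (d i) (outer (column i U)))"
proof -
  have "(\<Sum>k\<in>UNIV. cscale (d k) (outer (column k U))) $ i $ j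
      = (\<Sum>k\<in>UNIV. d k * (U $ i $ k * cnj (U $ j $ k)))" for i j
    by (simp add: cscale_def outer_def column_def)
  moreover have "sp U d $ i $ j = (\<Sum>k\<in>UNIV. d k * (U $ i $ k * cnj (U $ j $ k)))" for i j
  proof -
    have "sp U d $ i $ j = (\<Sum>k\<in>UNIV. (U ** diag_mat d) $ i $ k * cadj U $ k $ j)"
      by (simp add: sp_def matrix_matrix_mult_def)
    thus ?thesis by (simp add: mult_diag_mat cadj_def mult_ac)
  qed
  ultimately show ?thesis by (simp add: vec_eq_iff)
qed

lemma outer_vector: "outer v *v x = cip v x *s v"
  by (simp add: outer_def cip_def matrix_vector_mult_def vec_eq_iff sum_distrib_left mult_ac)

lemma matrix_vector_mult_sum_left: "(\<Sum>i\<in>S. B i) *v x = (\<Sum>i\<in>S. B i *v x)"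
  for x :: "complex^'n"
  by (induction S rule: infinite_finite_induct) (auto simp: matrix_vector_mult_add_rdistrib)

lemma cip_sp:
  "cip x (sp U d *v y) = (\<Sum>i\<in>UNIV. d i * cip x (column i U) * cip (column i U) y)"
  by (simp add: sp_eq_sum matrix_vector_mult_sum_left cip_sum_right cscale_vector outer_vector
      cip_simps mult_ac)

lemma cip_sp_self:
  "cip x (sp U d *v x) = (\<Sum>i\<in>UNIV. d i * of_real ((cmod (cip (column i U) x))\<^sup>2))"
  unfolding cip_sp
proof (rule sum.cong[OF refl])
  fix i
  have "cip x (column i U) * cip (column i U) x = of_real ((cmod (cip (column i U) x))\<^sup>2)"
    unfolding complex_norm_square by (simp add: cnj_cip mult.commute)
  thus "d i * cip x (column i U) * cip (column i U) x =
      d i * of_real ((cmod (cip (column i U) x))\<^sup>2)"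
    by (simp add: mult.assoc)
qed

lemma Re_cip_rsp:
  "Re (cip x (rsp U d *v x)) = (\<Sum>i\<in>UNIV. d i * (cmod (cip (column i U) x))\<^sup>2)"
  by (simp add: cip_sp_self flip: of_real_power of_real_mult)

lemma norm_columns:
  assumes "unitary_mat U"
  shows "(norm x)\<^sup>2 = (\<Sum>i\<in>UNIV. (cmod (cip (column i U) x))\<^sup>2)"
proof -
  have "Re (cip x (rsp U (\<lambda>_. 1) *v x)) = (\<Sum>i\<in>UNIV. (cmod (cip (column i U) x))\<^sup>2)"
    unfolding Re_cip_rsp by simp
  thus ?thesis
    using sp_1[OF assms] by (simp add: cip_self)
qed

lemma posdef_rsp:
  assumes U: "unitary_mat U"
  shows "posdef (rsp U d) \<longleftrightarrow> (\<forall>i. d i > 0)"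
proof
  assume P: "posdef (rsp U d)"
  show "\<forall>i. d i > 0"
  proof
    fix i
    have c: "cip (column i U) (column i U) = 1" using U by (simp add: unitary_columns)
    hence "column i U \<noteq> 0" by auto
    hence "0 < Re (cip (column i U) (rsp U d *v column i U))"
      using P by (simp add: posdef_iff)
    thus "d i > 0" using c by (simp add: sp_column[OF U] cip_simps)
  qed
next
  assume d: "\<forall>i. d i > 0"
  show "posdef (rsp U d)"
    unfolding posdef_iff
  proof (intro conjI allI impI hermitian_rsp)
    fix x :: "complex^'a" assume "x \<noteq> 0"
    hence "0 < (norm x)\<^sup>2" by simp
    then obtain i where "(cmod (cip (column i U) x))\<^sup>2 \<noteq> 0"
      unfolding norm_columns[OF U] by (metis (mono_tags, lifting) less_irrefl sum.neutral)
    hence "0 < d i * (cmod (cip (column i U) x))\<^sup>2" using d by simp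
    thus "0 < Re (cip x (rsp U d *v x))"
      unfolding Re_cip_rsp using d by (intro sum_pos2[of _ i]) (auto simp: less_imp_le)
  qed
qed

text \<open>The orthonormal system of full length supplies the columns of U, placed along the
  enumeration \<open>idx\<close> so that the eigenvalues of A increase with it.\<close>

theorem commuting_hermitian_diagonalization:
  fixes A B :: "complex^'n^'n"
  assumes "hermitian_mat A" "hermitian_mat B" "A ** B = B ** A"
  obtains U a b where "unitary_mat U" "A = rsp U a" "B = rsp U b"
    "\<And>i j. idx i \<le> idx j \<Longrightarrow> a i \<le> a j"
proof -
  obtain v a b where H: "\<forall>i<CARD('n). \<forall>j<CARD('n). cip (v i) (v j) = (if i = j then 1 else 0)"
    "\<forall>i<CARD('n). A *v v i = a i *\<^sub>R v i \<and> B *v v i = b i *\<^sub>R v i"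
    "\<forall>i<CARD('n). \<forall>j\<le>i. a j \<le> (a i :: real)"
    using commuting_hermitian_eigenvectors[OF assms order_refl] by (elim exE conjE) (rule that)
  define U where "U = (\<chi> i j. (v (idx (j::'n))) $ i)"
  have col: "column j U = v (idx j)" for j
    by (simp add: column_def U_def vec_eq_iff)
  have U: "unitary_mat U"
    using H(1) by (simp add: unitary_columns col)
  have scale: "r *\<^sub>R x = complex_of_real r *s x" for r and x :: "complex^'n"
    unfolding vec_eq_iff by (simp add: scaleR_conv_of_real[where 'a=complex])
  show thesis
  proof (rule that[OF U])
    show "A = rsp U (\<lambda>i. a (idx i))" "B = rsp U (\<lambda>i. b (idx i))"
      using H(2) by (auto intro!: sp_eqI[OF U] simp: col scale)
    show "a (idx i) \<le> a (idx j)" if "idx i \<le> idx j" for i j :: 'n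
      using H(3) that by simp
  qed
qed

corollary hermitian_spectral:
  fixes A :: "complex^'n^'n"
  assumes "hermitian_mat A"
  obtains U d where "unitary_mat U" "A = rsp U d" "\<And>i j. idx i \<le> idx j \<Longrightarrow> d i \<le> d j"
  using commuting_hermitian_diagonalization[OF assms assms refl] by metis

corollary posdef_spectral:
  fixes A :: "complex^'n^'n"
  assumes "posdef A"
  obtains U d where "unitary_mat U" "A = rsp U d" "\<And>i. d i > 0"
    "\<And>i j. idx i \<le> idx j \<Longrightarrow> d i \<le> d j"
proof -
  obtain U d where "unitary_mat U" "A = rsp U d" "\<And>i j. idx i \<le> idx j \<Longrightarrow> d i \<le> d j"
    using hermitian_spectral[of A] assms posdef_iff by blast
  with posdef_rsp[of U d] assms that show thesis by blast
qed

text \<open>The real and imaginary parts A and B of T are Hermitian and commute because T commutes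
  with its adjoint. Joint diagonalisation of A and B diagonalises T, and unitarity puts the
  eigenvalues on the unit circle.\<close>

corollary unitary_spectral:
  fixes T :: "complex^'n^'n"
  assumes T: "unitary_mat T"
  obtains U \<tau> where "unitary_mat U" "T = sp U \<tau>" "\<And>i. cmod (\<tau> i) = 1"
proof -
  define A where "A = cscale (1/2) (T + cadj T)"
  define B where "B = cscale (- \<i>/2) (T - cadj T)"
  have comm: "T ** cadj T = cadj T ** T"
    using T by (simp add: unitary_mat_def unitary_right)
  have "hermitian_mat A" "hermitian_mat B"
    by (simp_all add: hermitian_mat_def A_def B_def cadj_cscale cadj_add cadj_diff)
       (simp_all add: cscale_def vec_eq_iff algebra_simps)
  moreover have "A ** B = B ** A"
  proof -
    have "(T + cadj T) ** (T - cadj T) = (T - cadj T) ** (T + cadj T)"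
      by (simp add: matrix_add_ldistrib matrix_add_rdistrib matrix_diff_ldistrib
          matrix_diff_rdistrib comm)
    thus ?thesis by (simp add: A_def B_def cscale_mult_left cscale_mult_right cscale_cscale mult_ac)
  qed
  ultimately obtain U a b where U: "unitary_mat U" and AB: "A = rsp U a" "B = rsp U b"
    using commuting_hermitian_diagonalization by metis
  define \<tau> where "\<tau> i = complex_of_real (a i) + \<i> * complex_of_real (b i)" for i
  have "T = A + cscale \<i> B"
    by (simp add: A_def B_def cscale_def vec_eq_iff field_simps)
  hence T_eq: "T = sp U \<tau>"
    unfolding AB sp_eq_sum \<tau>_def
    by (simp add: cscale_def vec_eq_iff sum_distrib_left sum.distrib[symmetric] algebra_simps)
  have "cmod (\<tau> i) = 1" for i
  proof -
    have "sp U (\<lambda>i. cnj (\<tau> i) * \<tau> i) *v column i U = mat 1 *v column i U"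
      using T unfolding unitary_mat_def T_eq cadj_sp sp_mult[OF U] by simp
    hence "(cnj (\<tau> i) * \<tau> i) *s column i U = column i U"
      by (simp add: sp_column[OF U])
    moreover have "cip (column i U) (column i U) = 1"
      using U by (simp add: unitary_columns)
    ultimately have "cnj (\<tau> i) * \<tau> i = 1"
      by (metis cip_smult_right mult.right_neutral)
    hence "of_real ((cmod (\<tau> i))\<^sup>2) = (1::complex)"
      by (metis complex_norm_square mult.commute)
    hence "(cmod (\<tau> i))\<^sup>2 = 1" using of_real_eq_1_iff by blast
    thus ?thesis by (simp add: power2_eq_1_iff) (metis norm_ge_zero neg_0_le_iff_le not_one_le_zero)
  qed
  with U T_eq that show thesis by blast
qed

text \<open>The matrix W of inner products of the two eigenbases intertwines the diagonals:
  \<open>d i * W_ij = W_ij * e j\<close>. So \<open>W_ij\<close> vanishes unless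
  \<open>d i = e j\<close>, and the intertwining survives when f is applied to both
  diagonals.\<close>

lemma rsp_unique:
  assumes U: "unitary_mat U" and V: "unitary_mat V" and eq: "rsp U d = rsp V e"
  shows "rsp U (\<lambda>i. f (d i)) = rsp V (\<lambda>i. f (e i))"
proof -
  define W where "W = cadj U ** V"
  have left: "cadj U ** rsp U g ** V = diag_mat (\<lambda>i. of_real (g i)) ** W" for g
  proof -
    have "cadj U ** rsp U g ** V = (cadj U ** U) ** diag_mat (\<lambda>i. of_real (g i)) ** W"
      by (simp add: sp_def W_def matrix_mul_assoc)
    thus ?thesis using U by (simp add: unitary_mat_def)
  qed
  have right: "cadj U ** rsp V g ** V = W ** diag_mat (\<lambda>i. of_real (g i))" for g
  proof -
    have "cadj U ** rsp V g ** V = W ** diag_mat (\<lambda>i. of_real (g i)) ** (cadj V ** V)"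
      by (simp add: sp_def W_def matrix_mul_assoc)
    thus ?thesis using V by (simp add: unitary_mat_def)
  qed
  have conj_back: "U ** (cadj U ** X ** V) ** cadj V = X" for X
  proof -
    have "U ** (cadj U ** X ** V) ** cadj V = (U ** cadj U) ** X ** (V ** cadj V)"
      by (simp add: matrix_mul_assoc)
    thus ?thesis by (simp add: unitary_right U V)
  qed
  have "d i = e j \<or> W $ i $ j = 0" for i j
  proof -
    have "(diag_mat (\<lambda>i. of_real (d i)) ** W) $ i $ j = (W ** diag_mat (\<lambda>i. of_real (e i))) $ i $ j"
      using left[of d] right[of e] eq by simp
    thus ?thesis by (auto simp: diag_mat_mult_left mult_diag_mat)
  qed
  hence "diag_mat (\<lambda>i. of_real (f (d i))) ** W = W ** diag_mat (\<lambda>i. of_real (f (e i)))"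
    by (simp add: vec_eq_iff diag_mat_mult_left mult_diag_mat) (metis mult.commute)
  hence "cadj U ** rsp U (\<lambda>i. f (d i)) ** V = cadj U ** rsp V (\<lambda>i. f (e i)) ** V"
    by (simp add: left right)
  thus ?thesis by (metis conj_back)
qed

text \<open>By uniqueness the decomposition picked by \<open>SOME\<close> can be exchanged for any
  other one, which makes \<open>matfun\<close> computable.\<close>

lemma matfun_rsp:
  assumes U: "unitary_mat U"
  shows "matfun f (rsp U d) = rsp U (\<lambda>i. f (d i))"
proof -
  let ?P = "\<lambda>(V, e). unitary_mat V \<and>
    rsp U d = V ** diag_mat (\<lambda>i. complex_of_real (e i)) ** cadj V"
  obtain V e where Ve: "(SOME x. ?P x) = (V, e)" by fastforce
  have "?P (U, d)" using U by (simp add: sp_def)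
  hence "?P (SOME x. ?P x)" by (rule someI)
  hence V: "unitary_mat V" and eq: "rsp U d = rsp V e"
    unfolding Ve by (simp_all add: sp_def)
  have "matfun f (rsp U d) = rsp V (\<lambda>i. f (e i))"
    using Ve by (simp add: matfun_def sp_def)
  also have "\<dots> = rsp U (\<lambda>i. f (d i))"
    by (rule rsp_unique[OF U V eq, symmetric])
  finally show ?thesis .
qed

text \<open>For unitary U and V these numbers form a doubly stochastic matrix. They are the weights
  with which scalar inequalities between eigenvalues pass to traces of products.\<close>

definition overlap :: "complex^'n^'n \<Rightarrow> complex^'n^'n \<Rightarrow> 'n \<Rightarrow> 'n \<Rightarrow> real" where
  "overlap U V i j = (cmod (cip (column i U) (column j V)))\<^sup>2"

lemma overlap_nonneg: "overlap U V i j \<ge> 0"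
  by (simp add: overlap_def)

lemma norm_column: "unitary_mat U \<Longrightarrow> norm (column i U) = 1"
proof -
  assume "unitary_mat U"
  hence "cip (column i U) (column i U) = 1" by (simp add: unitary_columns)
  hence "(column i U) \<bullet> (column i U) = 1" by (metis Re_cip one_complex.sel(1))
  thus "norm (column i U) = 1" by (simp add: norm_eq_1)
qed

lemma overlap_sum_left: "unitary_mat U \<Longrightarrow> unitary_mat V \<Longrightarrow> (\<Sum>i\<in>UNIV. overlap U V i j) = 1"
  unfolding overlap_def using norm_columns[of U "column j V"] norm_column[of V j] by simp

lemma overlap_sum_right: "unitary_mat U \<Longrightarrow> unitary_mat V \<Longrightarrow> (\<Sum>j\<in>UNIV. overlap U V i j) = 1"
proof -
  have "overlap U V i j = overlap V U j i" for j
    unfolding overlap_def by (metis cnj_cip complex_mod_cnj)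
  thus "unitary_mat U \<Longrightarrow> unitary_mat V \<Longrightarrow> ?thesis" using overlap_sum_left[of V U i] by simp
qed

lemma trace_mult_sp:
  "trace (sp U d ** sp V e) = (\<Sum>i\<in>UNIV. \<Sum>j\<in>UNIV. d i * e j * of_real (overlap U V i j))"
proof -
  define W where "W = cadj U ** V"
  have "trace (sp U d ** sp V e) = trace (cadj U ** V ** diag_mat e ** cadj V ** U ** diag_mat d)"
    using trace_mul_sym[of "U ** diag_mat d" "cadj U ** sp V e"]
      trace_mul_sym[of "U" "diag_mat d ** cadj U ** sp V e"]
      trace_mul_sym[of "diag_mat d" "cadj U ** sp V e ** U"]
    by (simp add: sp_def matrix_mul_assoc)
  also have "cadj U ** V ** diag_mat e ** cadj V ** U ** diag_mat d
      = (W ** diag_mat e) ** (cadj W ** diag_mat d)"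
    by (simp add: W_def cadj_mult matrix_mul_assoc)
  also have "trace \<dots> = (\<Sum>i\<in>UNIV. \<Sum>j\<in>UNIV. (W ** diag_mat e) $ i $ j * (cadj W ** diag_mat d) $ j $ i)"
    by (simp add: trace_def matrix_matrix_mult_def[of "W ** diag_mat e"])
  also have "\<dots> = (\<Sum>i\<in>UNIV. \<Sum>j\<in>UNIV. d i * e j * of_real (overlap U V i j))"
  proof (intro sum.cong refl)
    fix i j
    have "W $ i $ j * cnj (W $ i $ j) = of_real (overlap U V i j)"
      unfolding overlap_def cip_column W_def by (rule complex_norm_square[symmetric])
    thus "(W ** diag_mat e) $ i $ j * (cadj W ** diag_mat d) $ j $ i =
        d i * e j * of_real (overlap U V i j)"
      by (simp add: mult_diag_mat) (simp add: cadj_def mult_ac)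
  qed
  finally show ?thesis .
qed

section \<open>Positive maps and Lieb concavity\<close>

text \<open>This form of positivity applies to rank one matrices and persists under congruences by
  singular matrices; both occur below.\<close>

definition pos_map :: "(complex^'n^'n \<Rightarrow> complex^'l^'l) \<Rightarrow> bool" where
  "pos_map \<Phi> \<longleftrightarrow> clinear_map \<Phi> \<and> (\<forall>A. psd A \<longrightarrow> psd (\<Phi> A))"

lemma clinear_map_add: "clinear_map \<Phi> \<Longrightarrow> \<Phi> (A + B) = \<Phi> A + \<Phi> B"
  and clinear_map_cscale: "clinear_map \<Phi> \<Longrightarrow> \<Phi> (cscale c A) = cscale c (\<Phi> A)"
  by (auto simp: clinear_map_def)

lemma clinear_map_scaleR: "clinear_map \<Phi> \<Longrightarrow> \<Phi> (r *\<^sub>R A) = r *\<^sub>R \<Phi> A"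
  by (metis clinear_map_cscale cscale_of_real)

lemma clinear_map_0: "clinear_map \<Phi> \<Longrightarrow> \<Phi> 0 = 0"
  by (metis add_cancel_left_left clinear_map_add)

lemma clinear_map_sum: "clinear_map \<Phi> \<Longrightarrow> \<Phi> (\<Sum>i\<in>S. f i) = (\<Sum>i\<in>S. \<Phi> (f i))"
  by (induction S rule: infinite_finite_induct) (auto simp: clinear_map_0 clinear_map_add)

lemma pos_map_clinear: "pos_map \<Phi> \<Longrightarrow> clinear_map \<Phi>"
  and pos_map_psd: "pos_map \<Phi> \<Longrightarrow> psd A \<Longrightarrow> psd (\<Phi> A)"
  by (auto simp: pos_map_def)

lemma hermitian_mat_1: "hermitian_mat (mat 1)"
  by (simp add: hermitian_mat_def)

lemma hermitian_add: "hermitian_mat A \<Longrightarrow> hermitian_mat B \<Longrightarrow> hermitian_mat (A + B)"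
  and hermitian_diff: "hermitian_mat A \<Longrightarrow> hermitian_mat B \<Longrightarrow> hermitian_mat (A - B)"
  and hermitian_scaleR: "hermitian_mat A \<Longrightarrow> hermitian_mat (r *\<^sub>R A)"
  by (auto simp: hermitian_mat_def cadj_add cadj_diff cadj_scaleR)

lemma hermitian_congruence: "hermitian_mat A \<Longrightarrow> hermitian_mat (cadj G ** A ** G)"
  by (simp add: hermitian_mat_def cadj_mult matrix_mul_assoc)

lemma scaleR_matrix_vector: "(r *\<^sub>R A) *v x = r *\<^sub>R (A *v x)" for A :: "complex^'n^'m"
  by (simp add: matrix_vector_mult_def vec_eq_iff scaleR_sum_right)

lemma posdef_add_psd:
  assumes "posdef A" "psd B"
  shows "posdef (A + B)"
  using assms unfolding posdef_iff psd_def
  by (simp add: hermitian_add matrix_vector_mult_add_rdistrib cip_simps add_pos_nonneg)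

lemma posdef_scaleR: "posdef A \<Longrightarrow> r > 0 \<Longrightarrow> posdef (r *\<^sub>R A)"
  by (simp add: posdef_iff hermitian_scaleR scaleR_matrix_vector cip_simps)

lemma posdef_add: "posdef A \<Longrightarrow> posdef B \<Longrightarrow> posdef (A + B)"
  by (simp add: posdef_add_psd posdef_imp_psd)

lemma posdef_mat_1: "posdef (mat 1)"
  by (simp add: posdef_iff hermitian_mat_1 cip_self)

text \<open>Adding a small positive multiple of the identity makes a positive semidefinite matrix
  positive definite; the inequality for the quadratic form survives the limit.\<close>

lemma strictly_positive_imp_pos_map:
  fixes \<Phi> :: "complex^'n^'n \<Rightarrow> complex^'l^'l"
  assumes lin: "clinear_map \<Phi>" and pos: "strictly_positive \<Phi>"
  shows "pos_map \<Phi>"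
  unfolding pos_map_def
proof (intro conjI lin allI impI)
  fix A :: "complex^'n^'n" assume A: "psd A"
  define P where "P = \<Phi> (mat 1)"
  have eps: "posdef (\<Phi> A + r *\<^sub>R P)" if "r > 0" for r
  proof -
    have "posdef (r *\<^sub>R mat 1 + A)"
      using that A by (intro posdef_add_psd posdef_scaleR posdef_mat_1)
    hence "posdef (\<Phi> (r *\<^sub>R mat 1 + A))" using pos by (simp add: strictly_positive_def)
    thus ?thesis by (simp add: clinear_map_add[OF lin] clinear_map_scaleR[OF lin] P_def add.commute)
  qed
  have P: "posdef P" using pos by (simp add: strictly_positive_def P_def posdef_mat_1)
  have "hermitian_mat (\<Phi> A + 1 *\<^sub>R P - P)"
    using eps[of 1] P by (intro hermitian_diff) (auto simp: posdef_iff)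
  moreover have "Re (cip x (\<Phi> A *v x)) \<ge> 0" for x
  proof (rule field_le_epsilon)
    fix e :: real assume e: "e > 0"
    define c where "c = Re (cip x (P *v x))"
    have c: "c \<ge> 0" using posdef_imp_psd[OF P] by (simp add: psd_def c_def)
    define r where "r = e / (c + 1)"
    have r: "r > 0" using e c by (simp add: r_def)
    have "0 \<le> Re (cip x (\<Phi> A *v x)) + r * c"
      using posdef_imp_psd[OF eps[OF r]]
      by (simp add: psd_def matrix_vector_mult_add_rdistrib scaleR_matrix_vector cip_simps c_def)
    moreover have "r * c \<le> e" using e c by (simp add: r_def field_simps)
    ultimately show "0 \<le> Re (cip x (\<Phi> A *v x)) + e" by simp
  qed
  ultimately show "psd (\<Phi> A)" by (simp add: psd_def)
qed

section \<open>Cauchy-Schwarz bounds for positive maps\<close>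

lemma psd_cadj_mult: "psd (cadj L ** L)"
proof -
  have "cip x ((cadj L ** L) *v x) = cip (L *v x) (L *v x)" for x
    by (metis cip_cadj' matrix_vector_mul_assoc)
  thus ?thesis by (simp add: psd_def hermitian_mat_def cadj_mult cip_self)
qed

lemma psd_outer: "psd (outer v)"
proof -
  have "hermitian_mat (outer v)" by (simp add: hermitian_mat_def cadj_def outer_def vec_eq_iff)
  moreover have "cip x (outer v *v x) = of_real ((cmod (cip v x))\<^sup>2)" for x
    unfolding complex_norm_square by (simp add: outer_vector cip_simps cnj_cip)
  ultimately show ?thesis by (simp add: psd_def)
qed

lemma trace_mult_cadj_mult:
  "trace (P ** (cadj L ** L)) = (\<Sum>k\<in>UNIV. cip (column k (cadj L)) (P *v column k (cadj L)))"
proof -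
  have "trace (P ** (cadj L ** L)) = trace (cadj (cadj L) ** (P ** cadj L))"
    by (metis cadj_cadj matrix_mul_assoc trace_mul_sym)
  thus ?thesis by (simp add: trace_def cip_column column_mult[symmetric])
qed

lemma psd_trace_mult:
  assumes "psd P"
  shows "Re (trace (P ** (cadj L ** L))) \<ge> 0" "Im (trace (P ** (cadj L ** L))) = 0"
  using assms unfolding trace_mult_cadj_mult psd_def
  by (auto intro: sum_nonneg simp: hermitian_Im_cip)

lemma trace_mult_outer: "trace (M ** outer v) = cip v (M *v v)"
proof -
  have "trace (M ** outer v) = (\<Sum>i\<in>UNIV. \<Sum>k\<in>UNIV. M $ i $ k * (v $ k * cnj (v $ i)))"
    by (simp add: trace_def matrix_matrix_mult_def outer_def)
  thus ?thesis
    by (simp add: cip_def matrix_vector_mult_def sum_distrib_left mult_ac)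
qed

text \<open>The value of \<phi> at \<open>cadj (L + \<omega> R) ** (L + \<omega> R)\<close> is real
  and nonnegative for each phase \<omega>. Realness at the phases 1 and \<i> yields Hermitian
  symmetry; nonnegativity at the phase opposite to \<open>\<phi> (cadj L ** R)\<close> yields
  Cauchy-Schwarz in its arithmetic mean form.\<close>

lemma positive_functional_cauchy_schwarz:
  fixes \<phi> :: "complex^'n^'n \<Rightarrow> complex" and L R :: "complex^'n^'n"
  assumes add: "\<And>A B. \<phi> (A + B) = \<phi> A + \<phi> B" and scale: "\<And>c A. \<phi> (cscale c A) = c * \<phi> A"
    and pos: "\<And>L :: complex^'n^'n. Re (\<phi> (cadj L ** L)) \<ge> 0"
    and real: "\<And>L :: complex^'n^'n. Im (\<phi> (cadj L ** L)) = 0"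
  shows "cmod (\<phi> (cadj L ** R)) \<le> (Re (\<phi> (cadj L ** L)) + Re (\<phi> (cadj R ** R))) / 2"
proof -
  define a where "a = \<phi> (cadj L ** R)"
  define b where "b = \<phi> (cadj R ** L)"
  have expand: "\<phi> (cadj (L + cscale \<omega> R) ** (L + cscale \<omega> R)) =
      \<phi> (cadj L ** L) + \<phi> (cadj R ** R) + \<omega> * a + cnj \<omega> * b" if "cmod \<omega> = 1" for \<omega>
  proof -
    have "cnj \<omega> * \<omega> = 1"
      using that complex_norm_square[of \<omega>] by (simp add: mult.commute)
    hence "\<omega> * cnj \<omega> = 1" by (simp add: mult.commute)
    moreover have "cscale 1 X = X" for X :: "complex^'n^'n" by (simp add: cscale_def)
    ultimately have "cadj (L + cscale \<omega> R) ** (L + cscale \<omega> R) = cadj L ** L + cadj R ** R +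
        cscale \<omega> (cadj L ** R) + cscale (cnj \<omega>) (cadj R ** L)"
      using \<open>cnj \<omega> * \<omega> = 1\<close>
      by (simp add: cadj_add cadj_cscale matrix_add_ldistrib matrix_add_rdistrib cscale_mult_left
          cscale_mult_right cscale_add cscale_cscale)
    hence "\<phi> (cadj (L + cscale \<omega> R) ** (L + cscale \<omega> R)) = \<phi> (cadj L ** L + cadj R ** R +
        cscale \<omega> (cadj L ** R) + cscale (cnj \<omega>) (cadj R ** L))" by (rule arg_cong)
    thus ?thesis unfolding add scale a_def b_def .
  qed
  have "Im (a + b) = 0"
    using expand[of 1] real[of "L + cscale 1 R"] real[of L] real[of R] by simp
  moreover have "Im (\<i> * a - \<i> * b) = 0"
    using expand[of \<i>] real[of "L + cscale \<i> R"] real[of L] real[of R] by simp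
  ultimately have b: "b = cnj a" by (simp add: complex_eq_iff)
  show ?thesis
  proof (cases "a = 0")
    case True
    thus ?thesis using pos[of L] pos[of R] by (simp add: a_def)
  next
    case False
    define \<omega> where "\<omega> = - cnj a / of_real (cmod a)"
    have \<omega>: "cmod \<omega> = 1" using False by (simp add: \<omega>_def norm_divide)
    have "\<omega> * a = - of_real (cmod a)"
      using False complex_norm_square[of a] by (simp add: \<omega>_def field_simps power2_eq_square)
    moreover have "cnj \<omega> * b = cnj (\<omega> * a)" by (simp add: b)
    ultimately have "Re (\<omega> * a + cnj \<omega> * b) = - 2 * cmod a" by simp
    thus ?thesis
      using expand[OF \<omega>] pos[of "L + cscale \<omega> R"] by (simp add: a_def)
  qed
qed

text \<open>For each eigenvector u of T, sending Q to \<open>trace (\<Phi> (outer u) ** Q)\<close>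
  is a positive functional, to which Cauchy-Schwarz applies. The eigenvalues have modulus 1, and the
  functionals add up to the one given by \<open>\<Phi> (mat 1)\<close>. This serves the edge of the
  strip on which the argument of \<Phi> is unitary.\<close>

lemma pos_map_unitary_left_bound:
  fixes \<Phi> :: "complex^'n^'n \<Rightarrow> complex^'l^'l" and L R :: "complex^'l^'l"
  assumes \<Phi>: "pos_map \<Phi>" and T: "unitary_mat T"
  shows "cmod (trace (\<Phi> T ** (cadj L ** R))) \<le>
    (Re (trace (\<Phi> (mat 1) ** (cadj L ** L))) + Re (trace (\<Phi> (mat 1) ** (cadj R ** R)))) / 2"
proof -
  note lin = pos_map_clinear[OF \<Phi>]
  obtain U \<tau> where U: "unitary_mat U" and T: "T = sp U \<tau>" and \<tau>: "\<And>i. cmod (\<tau> i) = 1"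
    using unitary_spectral[OF T] by metis
  define \<phi> where "\<phi> i Q = trace (\<Phi> (outer (column i U)) ** Q)" for i Q
  have sum: "trace (\<Phi> (sp U d) ** Q) = (\<Sum>i\<in>UNIV. d i * \<phi> i Q)" for d Q
    by (simp add: sp_eq_sum clinear_map_sum[OF lin] clinear_map_cscale[OF lin] matrix_mult_sum_left
        trace_sum cscale_mult_left trace_cscale \<phi>_def)
  have one: "trace (\<Phi> (mat 1) ** Q) = (\<Sum>i\<in>UNIV. \<phi> i Q)" for Q
    using sum[of "\<lambda>_. 1" Q] by (simp add: sp_1[OF U])
  have cs: "cmod (\<phi> i (cadj L ** R)) \<le> (Re (\<phi> i (cadj L ** L)) + Re (\<phi> i (cadj R ** R))) / 2" for i
  proof (rule positive_functional_cauchy_schwarz)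
    have "psd (\<Phi> (outer (column i U)))" by (rule pos_map_psd[OF \<Phi> psd_outer])
    thus "Re (\<phi> i (cadj L ** L)) \<ge> 0" "Im (\<phi> i (cadj L ** L)) = 0" for L :: "complex^'l^'l"
      unfolding \<phi>_def by (rule psd_trace_mult)+
  qed (simp_all add: \<phi>_def matrix_add_ldistrib trace_add cscale_mult_right trace_cscale)
  have "cmod (trace (\<Phi> T ** (cadj L ** R))) \<le> (\<Sum>i\<in>UNIV. cmod (\<tau> i * \<phi> i (cadj L ** R)))"
    unfolding T sum by (rule norm_sum)
  also have "\<dots> \<le> (\<Sum>i\<in>UNIV. (Re (\<phi> i (cadj L ** L)) + Re (\<phi> i (cadj R ** R))) / 2)"
    using cs by (intro sum_mono) (simp add: norm_mult \<tau>)
  also have "\<dots> = (Re (trace (\<Phi> (mat 1) ** (cadj L ** L))) +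
      Re (trace (\<Phi> (mat 1) ** (cadj R ** R)))) / 2"
    by (simp add: one sum.distrib sum_divide_distrib[symmetric])
  finally show ?thesis .
qed

text \<open>The counterpart for the other edge: with T on the right, the positive functionals send Q
  to \<open>cip u (\<Phi> Q *v u)\<close> at the eigenvectors u of T, and they add up to
  \<open>trace (\<Phi> Q)\<close>.\<close>

lemma pos_map_unitary_right_bound:
  fixes \<Phi> :: "complex^'n^'n \<Rightarrow> complex^'l^'l" and L R :: "complex^'n^'n"
  assumes \<Phi>: "pos_map \<Phi>" and T: "unitary_mat T"
  shows "cmod (trace (\<Phi> (cadj L ** R) ** T)) \<le>
    (Re (trace (\<Phi> (cadj L ** L))) + Re (trace (\<Phi> (cadj R ** R)))) / 2"
proof -
  note lin = pos_map_clinear[OF \<Phi>]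
  obtain U \<tau> where U: "unitary_mat U" and T: "T = sp U \<tau>" and \<tau>: "\<And>i. cmod (\<tau> i) = 1"
    using unitary_spectral[OF T] by metis
  define \<phi> where "\<phi> i Q = cip (column i U) (\<Phi> Q *v column i U)" for i Q
  have sum: "trace (\<Phi> Q ** sp U d) = (\<Sum>i\<in>UNIV. d i * \<phi> i Q)" for d Q
    by (simp add: sp_eq_sum matrix_mult_sum_right trace_sum cscale_mult_right trace_cscale \<phi>_def
        trace_mult_outer)
  have one: "trace (\<Phi> Q) = (\<Sum>i\<in>UNIV. \<phi> i Q)" for Q
    using sum[of Q "\<lambda>_. 1"] by (simp add: sp_1[OF U])
  have cs: "cmod (\<phi> i (cadj L ** R)) \<le> (Re (\<phi> i (cadj L ** L)) + Re (\<phi> i (cadj R ** R))) / 2" for i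
  proof (rule positive_functional_cauchy_schwarz)
    show "Re (\<phi> i (cadj L ** L)) \<ge> 0" "Im (\<phi> i (cadj L ** L)) = 0" for L :: "complex^'n^'n"
      using pos_map_psd[OF \<Phi> psd_cadj_mult[of L]] by (auto simp: \<phi>_def psd_def hermitian_Im_cip)
  qed (simp_all add: \<phi>_def clinear_map_add[OF lin] clinear_map_cscale[OF lin] cscale_vector
      matrix_vector_mult_add_rdistrib cip_simps)
  have "cmod (trace (\<Phi> (cadj L ** R) ** T)) \<le> (\<Sum>i\<in>UNIV. cmod (\<tau> i * \<phi> i (cadj L ** R)))"
    unfolding T sum by (rule norm_sum)
  also have "\<dots> \<le> (\<Sum>i\<in>UNIV. (Re (\<phi> i (cadj L ** L)) + Re (\<phi> i (cadj R ** R))) / 2)"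
    using cs by (intro sum_mono) (simp add: norm_mult \<tau>)
  also have "\<dots> = (Re (trace (\<Phi> (cadj L ** L))) + Re (trace (\<Phi> (cadj R ** R)))) / 2"
    by (simp add: one sum.distrib sum_divide_distrib[symmetric])
  finally show ?thesis .
qed

text \<open>Only meaningful for positive definite \<open>A\<close>; otherwise the choice is arbitrary.\<close>

definition cpow :: "complex^'n^'n \<Rightarrow> complex \<Rightarrow> complex^'n^'n" where
  "cpow A w = (let (U, d) = (SOME (U, d). unitary_mat U \<and> (\<forall>i. d i > 0) \<and> A = rsp U d)
     in sp U (\<lambda>i. exp (w * of_real (ln (d i)))))"

lemma cpow_spectral:
  assumes "posdef A"
  obtains U d where "unitary_mat U" "\<And>i. d i > 0" "A = rsp U d"
    "\<And>w. cpow A w = sp U (\<lambda>i. exp (w * of_real (ln (d i))))"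
proof -
  let ?P = "\<lambda>(U, d). unitary_mat U \<and> (\<forall>i. d i > 0) \<and> A = rsp U d"
  obtain U d where Ud: "(SOME x. ?P x) = (U, d)" by fastforce
  obtain U' d' where "unitary_mat U'" "A = rsp U' d'" "\<And>i. d' i > 0"
    using posdef_spectral[OF assms] by blast
  hence "?P (U', d')" by simp
  hence "?P (SOME x. ?P x)" by (rule someI)
  hence "unitary_mat U" "\<And>i. d i > 0" "A = rsp U d" unfolding Ud by auto
  moreover have "cpow A w = sp U (\<lambda>i. exp (w * of_real (ln (d i))))" for w
    using Ud by (simp add: cpow_def)
  ultimately show thesis using that by blast
qed

lemma cpow_mult: 
  assumes "posdef A"
  shows "cpow A v ** cpow A w = cpow A (v + w)"
proof -
  obtain U d where "unitary_mat U" and H: "\<And>w. cpow A w = sp U (\<lambda>i. exp (w * of_real (ln (d i))))"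
    using cpow_spectral[OF assms] by metis
  thus ?thesis by (simp add: H sp_mult exp_add distrib_right)
qed

lemma cpow_0: "posdef A \<Longrightarrow> cpow A 0 = mat 1"
proof -
  assume "posdef A"
  then obtain U d where "unitary_mat U" and H: "\<And>w. cpow A w = sp U (\<lambda>i. exp (w * of_real (ln (d i))))"
    using cpow_spectral by metis
  thus ?thesis by (simp add: H sp_1)
qed

definition mpow :: "complex^'n^'n \<Rightarrow> real \<Rightarrow> complex^'n^'n" where
  "mpow A r = matfun (\<lambda>x. x powr r) A"

lemma mpow_rsp: "unitary_mat U \<Longrightarrow> mpow (rsp U d) r = rsp U (\<lambda>i. d i powr r)"
  unfolding mpow_def by (rule matfun_rsp)

lemma cpow_of_real:
  assumes "posdef A"
  shows "cpow A (of_real r) = mpow A r"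
proof -
  obtain U d where H: "unitary_mat U" "\<And>i. d i > 0" "A = rsp U d"
    "\<And>w. cpow A w = sp U (\<lambda>i. exp (w * of_real (ln (d i))))"
    using cpow_spectral[OF assms] by metis
  have "exp (of_real r * of_real (ln (d i))) = complex_of_real (d i powr r)" for i
    using H(2)[of i] by (simp add: powr_def exp_of_real[symmetric])
  thus ?thesis by (simp add: H(3) H(4)[unfolded H(3)] mpow_rsp[OF H(1)])
qed

lemma cpow_1: 
  assumes "posdef A"
  shows "cpow A 1 = A"
proof -
  obtain U d where H: "unitary_mat U" "\<And>i. d i > 0" "A = rsp U d"
    "\<And>w. cpow A w = sp U (\<lambda>i. exp (w * of_real (ln (d i))))"
    using cpow_spectral[OF assms] by metis
  have "exp (1 * of_real (ln (d i))) = complex_of_real (d i)" for i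
    using H(2)[of i] by (simp add: exp_of_real)
  thus ?thesis using H(3) H(4)[of 1] by simp
qed

lemma cadj_cpow:
  assumes "posdef A"
  shows "cadj (cpow A w) = cpow A (cnj w)"
proof -
  obtain U d where H: "\<And>w. cpow A w = sp U (\<lambda>i. exp (w * of_real (ln (d i))))"
    using cpow_spectral[OF assms] by metis
  show ?thesis by (simp add: H cadj_sp exp_cnj)
qed

lemma unitary_cpow:
  assumes "posdef A" "Re w = 0"
  shows "unitary_mat (cpow A w)"
proof -
  have "cnj w + w = 0" using assms(2) by (simp add: complex_eq_iff)
  thus ?thesis
    using assms(1) by (simp add: unitary_mat_def cadj_cpow cpow_mult cpow_0)
qed

section \<open>Entire functions bounded on the strip, and the three lines theorem\<close>

definition strip_fn :: "(complex \<Rightarrow> complex) \<Rightarrow> bool" where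
  "strip_fn f \<longleftrightarrow> f holomorphic_on UNIV \<and> (\<exists>B. \<forall>z. 0 \<le> Re z \<and> Re z \<le> 1 \<longrightarrow> cmod (f z) \<le> B)"

lemma strip_fn_const: "strip_fn (\<lambda>_. c)"
  unfolding strip_fn_def by (auto intro: exI[of _ "cmod c"])

lemma strip_fn_add:
  assumes "strip_fn f" "strip_fn g"
  shows "strip_fn (\<lambda>z. f z + g z)"
proof -
  obtain B C where "\<forall>z. 0 \<le> Re z \<and> Re z \<le> 1 \<longrightarrow> cmod (f z) \<le> B"
    "\<forall>z. 0 \<le> Re z \<and> Re z \<le> 1 \<longrightarrow> cmod (g z) \<le> C"
    using assms unfolding strip_fn_def by blast
  hence "\<forall>z. 0 \<le> Re z \<and> Re z \<le> 1 \<longrightarrow> cmod (f z + g z) \<le> B + C"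
    by (meson add_mono norm_triangle_le)
  thus ?thesis using assms unfolding strip_fn_def by (auto intro!: holomorphic_intros)
qed

lemma strip_fn_mult:
  assumes "strip_fn f" "strip_fn g"
  shows "strip_fn (\<lambda>z. f z * g z)"
proof -
  obtain B C where BC: "\<forall>z. 0 \<le> Re z \<and> Re z \<le> 1 \<longrightarrow> cmod (f z) \<le> B"
    "\<forall>z. 0 \<le> Re z \<and> Re z \<le> 1 \<longrightarrow> cmod (g z) \<le> C"
    using assms unfolding strip_fn_def by blast
  hence "B \<ge> 0" by (metis norm_ge_zero order_trans zero_complex.sel(1) order_refl zero_le_one)
  hence "\<forall>z. 0 \<le> Re z \<and> Re z \<le> 1 \<longrightarrow> cmod (f z * g z) \<le> B * C"
    using BC by (simp add: norm_mult mult_mono)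
  thus ?thesis using assms unfolding strip_fn_def by (auto intro!: holomorphic_intros)
qed

lemma strip_fn_sum: "(\<And>i. i \<in> S \<Longrightarrow> strip_fn (f i)) \<Longrightarrow> strip_fn (\<lambda>z. \<Sum>i\<in>S. f i z)"
  by (induction S rule: infinite_finite_induct) (auto intro: strip_fn_const strip_fn_add)

lemma strip_fn_exp: "strip_fn (\<lambda>z. exp ((of_real b * z + of_real c) * of_real r))"
  unfolding strip_fn_def
proof (intro conjI exI[of _ "exp ((\<bar>b\<bar> + \<bar>c\<bar>) * \<bar>r\<bar>)"] allI impI)
  fix z assume z: "0 \<le> Re z \<and> Re z \<le> 1"
  have "(b * Re z + c) * r \<le> \<bar>b * Re z + c\<bar> * \<bar>r\<bar>"
    by (metis abs_ge_self abs_mult)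
  also have "\<dots> \<le> (\<bar>b\<bar> + \<bar>c\<bar>) * \<bar>r\<bar>"
  proof (intro mult_right_mono)
    have "\<bar>b * Re z\<bar> \<le> \<bar>b\<bar>" using z by (simp add: abs_mult mult_left_le)
    thus "\<bar>b * Re z + c\<bar> \<le> \<bar>b\<bar> + \<bar>c\<bar>" by linarith
  qed simp
  finally show "cmod (exp ((of_real b * z + of_real c) * of_real r)) \<le> exp ((\<bar>b\<bar> + \<bar>c\<bar>) * \<bar>r\<bar>)"
    by simp
qed (intro holomorphic_intros)

text \<open>The factor \<open>exp (e * (z^2 - 1))\<close> has modulus at most 1 on the strip and
  decays as the imaginary part grows. The maximum modulus principle on a tall rectangle therefore
  bounds the product by \<open>B + e\<close>, and e tends to 0.\<close>

lemma three_lines: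
  assumes f: "strip_fn f" and p: "0 \<le> p" "p \<le> 1"
    and left: "\<And>z. Re z = 0 \<Longrightarrow> cmod (f z) \<le> B" and right: "\<And>z. Re z = 1 \<Longrightarrow> cmod (f z) \<le> B"
  shows "cmod (f (of_real p)) \<le> B"
proof -
  obtain K0 where K0: "\<And>z. 0 \<le> Re z \<Longrightarrow> Re z \<le> 1 \<Longrightarrow> cmod (f z) \<le> K0"
    using f unfolding strip_fn_def by blast
  define K where "K = \<bar>K0\<bar>"
  have K: "cmod (f z) \<le> K" if "0 \<le> Re z" "Re z \<le> 1" for z
    using K0[OF that] by (simp add: K_def)
  have K_nonneg: "K \<ge> 0" by (simp add: K_def)
  have holf: "f holomorphic_on UNIV" using f by (simp add: strip_fn_def)
  have B: "B \<ge> 0" using left[of 0] by (metis norm_ge_zero order_trans zero_complex.sel(1))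
  have bound: "cmod (f (of_real p)) * exp (e * (p\<^sup>2 - 1)) \<le> B + e" if e: "e > 0" for e
  proof -
    define g where "g z = f z * exp (of_real e * (z\<^sup>2 - 1))" for z
    \<comment> \<open>At this height the factor is at most \<open>exp (- (K / e))\<close> on the
      horizontal edges, and
      \<open>K * exp (- (K / e)) \<le> K / (1 + K / e) \<le> e\<close>.\<close>
    define N where "N = sqrt (K / e\<^sup>2)"
    define S where "S = cbox (Complex 0 (- N)) (Complex 1 N)"
    have N: "N \<ge> 0" "N\<^sup>2 = K / e\<^sup>2" using K_nonneg by (simp_all add: N_def)
    have norm_g: "cmod (g z) = cmod (f z) * exp (e * ((Re z)\<^sup>2 - (Im z)\<^sup>2 - 1))" for z
      by (simp add: g_def norm_mult Re_power2)
    have holg: "g holomorphic_on T" for T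
      unfolding g_def using holf by (intro holomorphic_intros holomorphic_on_subset[OF holf]) auto
    have "norm (g (of_real p)) \<le> B + e"
    proof (rule maximum_modulus_frontier[of g S])
      show "g holomorphic_on interior S" by (rule holg)
      show "continuous_on (closure S) g" using holg by (rule holomorphic_on_imp_continuous_on)
      show "bounded S" by (simp add: S_def)
      show "of_real p \<in> S" using p N(1) by (simp add: S_def in_cbox_complex_iff)
      fix z assume "z \<in> frontier S"
      hence zS: "z \<in> S" and zbd: "z \<notin> box (Complex 0 (- N)) (Complex 1 N)"
        by (auto simp: S_def frontier_cbox)
      have R: "0 \<le> Re z" "Re z \<le> 1" and I: "- N \<le> Im z" "Im z \<le> N"
        using zS by (auto simp: S_def in_cbox_complex_iff)
      have R2: "(Re z)\<^sup>2 \<le> 1" using R by (simp add: power_le_one)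
      have le1: "exp (e * ((Re z)\<^sup>2 - (Im z)\<^sup>2 - 1)) \<le> 1"
      proof -
        have "(Re z)\<^sup>2 - (Im z)\<^sup>2 - 1 \<le> 0" using R2 zero_le_power2[of "Im z"] by linarith
        thus ?thesis using e by (simp add: mult_le_0_iff)
      qed
      consider "Re z = 0" | "Re z = 1" | "\<bar>Im z\<bar> = N"
        using zbd R I by (force simp: in_box_complex_iff)
      thus "norm (g z) \<le> B + e"
      proof cases
        case 3
        hence I2: "(Im z)\<^sup>2 = K / e\<^sup>2" using N(2) by (metis power2_abs)
        have "exp (e * ((Re z)\<^sup>2 - (Im z)\<^sup>2 - 1)) \<le> exp (- (K / e))"
        proof -
          have "e * ((Re z)\<^sup>2 - 1) \<le> 0" using R2 e by (simp add: mult_nonneg_nonpos)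
          moreover have "e * ((Re z)\<^sup>2 - (Im z)\<^sup>2 - 1) = e * ((Re z)\<^sup>2 - 1) - K / e"
            unfolding I2 using e by (simp add: field_simps power2_eq_square)
          ultimately show ?thesis by simp
        qed
        also have "\<dots> \<le> 1 / (1 + K / e)"
        proof -
          have "1 + K / e \<le> exp (K / e)" by (rule exp_ge_add_one_self)
          moreover have "1 + K / e > 0" using K_nonneg e by (simp add: add_pos_nonneg)
          ultimately have "inverse (exp (K / e)) \<le> inverse (1 + K / e)"
            by (intro le_imp_inverse_le)
          thus ?thesis by (simp add: exp_minus inverse_eq_divide)
        qed
        finally have "cmod (g z) \<le> K * (1 / (1 + K / e))"
          unfolding norm_g using K[OF R] K_nonneg by (intro mult_mono) auto
        also have "\<dots> \<le> e" using K_nonneg e by (simp add: field_simps)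
        finally show ?thesis using B by simp
      next
        case 1
        have "cmod (g z) \<le> B * 1"
          unfolding norm_g using left[OF 1] le1 B by (intro mult_mono) auto
        thus ?thesis using e by simp
      next
        case 2
        have "cmod (g z) \<le> B * 1"
          unfolding norm_g using right[OF 2] le1 B by (intro mult_mono) auto
        thus ?thesis using e by simp
      qed
    qed
    thus ?thesis by (simp add: norm_g)
  qed
  have "((\<lambda>e. B + e) \<longlongrightarrow> B + 0) (at_right 0)"
    by (intro tendsto_intros)
  moreover have "((\<lambda>e. cmod (f (of_real p)) * exp (e * (p\<^sup>2 - 1))) \<longlongrightarrow>
      cmod (f (of_real p)) * exp (0 * (p\<^sup>2 - 1))) (at_right 0)"
    by (intro tendsto_intros)
  moreover have "eventually (\<lambda>e. cmod (f (of_real p)) * exp (e * (p\<^sup>2 - 1)) \<le> B + e) (at_right 0)"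
    using bound by (auto simp: eventually_at_right_less eventually_at intro: exI[of _ 1])
  ultimately have "cmod (f (of_real p)) * exp (0 * (p\<^sup>2 - 1)) \<le> B + 0"
    by (intro tendsto_le[OF trivial_limit_at_right_real])
  thus ?thesis by simp
qed

definition mat_strip :: "(complex \<Rightarrow> complex^'n^'m) \<Rightarrow> bool" where
  "mat_strip M \<longleftrightarrow> (\<forall>i j. strip_fn (\<lambda>z. M z $ i $ j))"

lemma mat_strip_mult:
  "mat_strip M \<Longrightarrow> mat_strip N \<Longrightarrow> mat_strip (\<lambda>z. M z ** N z)"
  unfolding mat_strip_def matrix_matrix_mult_def
  by (auto intro!: strip_fn_sum strip_fn_mult)

text \<open>Expanded in the matrix units \<open>E i j\<close>, each entry of
  \<open>\<Phi> (M z)\<close> is a fixed linear combination of the entries of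
  \<open>M z\<close>.\<close>

lemma mat_strip_clinear:
  fixes \<Phi> :: "complex^'n^'n \<Rightarrow> complex^'l^'l"
  assumes lin: "clinear_map \<Phi>" and M: "mat_strip M"
  shows "mat_strip (\<lambda>z. \<Phi> (M z))"
proof -
  define E :: "'n \<Rightarrow> 'n \<Rightarrow> complex^'n^'n" where
    "E i j = (\<chi> a b. if a = i then if b = j then 1 else 0 else 0)" for i j
  have "(\<Sum>i\<in>UNIV. \<Sum>j\<in>UNIV. cscale (X $ i $ j) (E i j)) $ a $ b = X $ a $ b" for X a b
  proof -
    have "(\<Sum>i\<in>UNIV. \<Sum>j\<in>UNIV. cscale (X $ i $ j) (E i j)) $ a $ b
        = (\<Sum>i\<in>UNIV. \<Sum>j\<in>UNIV. if a = i then if b = j then X $ i $ j else 0 else 0)"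
      unfolding sum_component cscale_nth E_def by (intro sum.cong refl) simp
    also have "\<dots> = (\<Sum>i\<in>UNIV. if a = i then X $ i $ b else 0)"
      by (intro sum.cong refl) simp
    finally show ?thesis by simp
  qed
  hence units: "(\<Sum>i\<in>UNIV. \<Sum>j\<in>UNIV. cscale (X $ i $ j) (E i j)) = X" for X
    unfolding vec_eq_iff by blast
  have "\<Phi> (\<Sum>i\<in>UNIV. \<Sum>j\<in>UNIV. cscale (X $ i $ j) (E i j)) =
      (\<Sum>i\<in>UNIV. \<Sum>j\<in>UNIV. cscale (X $ i $ j) (\<Phi> (E i j)))" for X
    by (simp add: clinear_map_sum[OF lin] clinear_map_cscale[OF lin])
  hence "\<Phi> X = (\<Sum>i\<in>UNIV. \<Sum>j\<in>UNIV. cscale (X $ i $ j) (\<Phi> (E i j)))" for X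
    unfolding units .
  hence "\<Phi> X $ k $ l = (\<Sum>i\<in>UNIV. \<Sum>j\<in>UNIV. cscale (X $ i $ j) (\<Phi> (E i j))) $ k $ l" for X k l
    by (rule arg_cong)
  hence entry: "\<Phi> (M z) $ k $ l = (\<Sum>i\<in>UNIV. \<Sum>j\<in>UNIV. M z $ i $ j * \<Phi> (E i j) $ k $ l)" for z k l
    unfolding sum_component cscale_nth .
  show ?thesis
    unfolding mat_strip_def entry
    using M by (intro allI strip_fn_sum strip_fn_mult strip_fn_const) (simp add: mat_strip_def)
qed

lemma mat_strip_cpow:
  assumes "posdef A"
  shows "mat_strip (\<lambda>z. cpow A (of_real b * z + of_real c))"
proof -
  obtain U d where H: "\<And>w. cpow A w = sp U (\<lambda>i. exp (w * of_real (ln (d i))))"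
    using cpow_spectral[OF assms] by metis
  show ?thesis
    unfolding mat_strip_def H sp_eq_sum sum_component cscale_nth
    by (intro allI strip_fn_sum strip_fn_mult strip_fn_exp strip_fn_const)
qed

section \<open>Congruences of positive maps and Lieb's concavity theorem\<close>

lemma psd_congruence:
  assumes "psd A"
  shows "psd (cadj G ** A ** G)"
proof -
  have "cip x ((cadj G ** A ** G) *v x) = cip (G *v x) (A *v (G *v x))" for x
    by (simp add: cip_cadj' matrix_vector_mul_assoc matrix_mul_assoc)
  thus ?thesis using assms by (simp add: psd_def hermitian_congruence)
qed

lemma pos_map_congruence:
  assumes "pos_map \<Phi>"
  shows "pos_map (\<lambda>S. cadj H ** \<Phi> (cadj G ** S ** G) ** H)"
  using assms unfolding pos_map_def clinear_map_def
  by (simp add: matrix_add_ldistrib matrix_add_rdistrib cscale_mult_left cscale_mult_right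
      psd_congruence)

lemma cpow_mult_assoc: "posdef A \<Longrightarrow> M ** cpow A v ** cpow A w = M ** cpow A (v + w)"
  by (simp add: cpow_mult matrix_mul_assoc[symmetric])

text \<open>The middle power is split with 1/2 as one of the two exponents. Since e has real part 1,
  the middle of \<open>cadj L ** L\<close> is the summand itself. The summands add up to A, which
  the outer powers, of total exponent -1, turn into the identity.\<close>

lemma cpow_sum_splitting:
  fixes A\<^sub>1 A\<^sub>2 :: "complex^'n^'n"
  assumes A: "posdef A\<^sub>1" "posdef A\<^sub>2" and c: "Re c = - (1/2)" and e: "Re e = 1"
  obtains L\<^sub>1 R\<^sub>1 L\<^sub>2 R\<^sub>2 :: "complex^'n^'n" where
    "cpow (A\<^sub>1 + A\<^sub>2) c ** cpow A\<^sub>1 e ** cpow (A\<^sub>1 + A\<^sub>2) c = cadj L\<^sub>1 ** R\<^sub>1"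
    "cpow (A\<^sub>1 + A\<^sub>2) c ** cpow A\<^sub>2 e ** cpow (A\<^sub>1 + A\<^sub>2) c = cadj L\<^sub>2 ** R\<^sub>2"
    "cadj L\<^sub>1 ** L\<^sub>1 + cadj L\<^sub>2 ** L\<^sub>2 = mat 1" "cadj R\<^sub>1 ** R\<^sub>1 + cadj R\<^sub>2 ** R\<^sub>2 = mat 1"
proof -
  define A where "A = A\<^sub>1 + A\<^sub>2"
  have pA: "posdef A" using A by (simp add: A_def posdef_add)
  define L where "L X = cpow X (cnj e - 1/2) ** cpow A (cnj c)" for X
  define R where "R X = cpow X (1/2) ** cpow A c" for X
  have ee: "e - 1/2 + (cnj e - 1/2) = 1" and cc: "c + (1 + cnj c) = 0" "cnj c + (1 + c) = 0"
    using c e by (simp_all add: complex_eq_iff)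
  have split: "cpow A c ** cpow X e ** cpow A c = cadj (L X) ** R X" if "posdef X" for X
    unfolding L_def R_def
    by (simp add: cadj_mult cadj_cpow[OF pA] cadj_cpow[OF that] matrix_mul_assoc
        cpow_mult_assoc[OF that])
  have LL: "cadj (L X) ** L X = cpow A c ** X ** cpow A (cnj c)" if "posdef X" for X
    unfolding L_def
    by (simp add: cadj_mult cadj_cpow[OF pA] cadj_cpow[OF that] matrix_mul_assoc
        cpow_mult_assoc[OF that] ee cpow_1[OF that])
  have RR: "cadj (R X) ** R X = cpow A (cnj c) ** X ** cpow A c" if "posdef X" for X
    unfolding R_def
    by (simp add: cadj_mult cadj_cpow[OF pA] cadj_cpow[OF that] matrix_mul_assoc
        cpow_mult_assoc[OF that] cpow_1[OF that])
  have sum: "cpow A x ** A\<^sub>1 ** cpow A y + cpow A x ** A\<^sub>2 ** cpow A y = mat 1"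
    if "x + (1 + y) = 0" for x y
  proof -
    have "cpow A x ** A\<^sub>1 ** cpow A y + cpow A x ** A\<^sub>2 ** cpow A y = cpow A x ** cpow A 1 ** cpow A y"
      by (simp add: cpow_1[OF pA]) (simp add: A_def matrix_add_ldistrib matrix_add_rdistrib)
    also have "\<dots> = cpow A (x + (1 + y))"
      by (simp add: cpow_mult[OF pA] add.assoc)
    finally show ?thesis by (simp add: that cpow_0[OF pA])
  qed
  show thesis
    by (rule that[of "L A\<^sub>1" "R A\<^sub>1" "L A\<^sub>2" "R A\<^sub>2"])
       (simp_all add: split[unfolded A_def] A LL RR sum cc)
qed

text \<open>An analytic function F on the strip has the left side as its value at p. Congruence with
  the power \<open>p/2\<close> of A and \<open>(1-p)/2\<close> of Z turns the right side into the
  constant B. On each edge the Cauchy-Schwarz bounds and the resolutions of the identity give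
  modulus at most B, so the three lines theorem applies.\<close>

theorem lieb_concavity_pos_map:
  fixes \<Phi> :: "complex^'n^'n \<Rightarrow> complex^'l^'l"
  assumes \<Phi>: "pos_map \<Phi>" and A: "posdef A\<^sub>1" "posdef A\<^sub>2" and Z: "posdef Z\<^sub>1" "posdef Z\<^sub>2"
    and p: "0 \<le> p" "p \<le> 1"
  shows "Re (trace (\<Phi> (mpow A\<^sub>1 p) ** mpow Z\<^sub>1 (1 - p))) + Re (trace (\<Phi> (mpow A\<^sub>2 p) ** mpow Z\<^sub>2 (1 - p)))
    \<le> Re (trace (\<Phi> (mpow (A\<^sub>1 + A\<^sub>2) p) ** mpow (Z\<^sub>1 + Z\<^sub>2) (1 - p)))"
proof -
  define A where "A = A\<^sub>1 + A\<^sub>2"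
  define Z where "Z = Z\<^sub>1 + Z\<^sub>2"
  have pA: "posdef A" and pZ: "posdef Z" using assms by (simp_all add: A_def Z_def posdef_add)
  define G where "G = cpow A (of_real (p/2))"
  define H where "H = cpow Z (of_real ((1-p)/2))"
  have G: "cadj G = G" and H: "cadj H = H"
    by (simp_all add: G_def H_def cadj_cpow pA pZ)
  define \<Phi>' where "\<Phi>' = (\<lambda>S. cadj H ** \<Phi> (cadj G ** S ** G) ** H)"
  have \<Phi>': "pos_map \<Phi>'" unfolding \<Phi>'_def by (rule pos_map_congruence[OF \<Phi>])
  note lin' = pos_map_clinear[OF \<Phi>']
  define S where "S X w = cpow A (-w/2) ** cpow X w ** cpow A (-w/2)" for X w
  define R where "R Y w = cpow Z ((w-1)/2) ** cpow Y (1-w) ** cpow Z ((w-1)/2)" for Y w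
  \<comment> \<open>At \<open>w = p\<close> the outer powers of \<open>A\<close> and \<open>Z\<close> cancel those in \<open>\<Phi>'\<close>. For \<open>Re w = 0\<close> the factor \<open>S\<close>
    is unitary, for \<open>Re w = 1\<close> the factor \<open>R\<close>, and the other factors sum up to a resolution of \<open>1\<close>.\<close>
  define F where "F w = trace (\<Phi>' (S A\<^sub>1 w) ** R Z\<^sub>1 w) + trace (\<Phi>' (S A\<^sub>2 w) ** R Z\<^sub>2 w)" for w
  define B where "B = Re (trace (\<Phi>' (mat 1)))"
  have mS: "mat_strip (S X)" if "posdef X" for X
  proof -
    have "mat_strip (\<lambda>w. cpow A (of_real (-1/2) * w + of_real 0) ** cpow X (of_real 1 * w + of_real 0)
        ** cpow A (of_real (-1/2) * w + of_real 0))"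
      by (intro mat_strip_mult mat_strip_cpow pA that)
    thus ?thesis by (simp add: S_def[abs_def])
  qed
  have mR: "mat_strip (R Y)" if "posdef Y" for Y
  proof -
    have "mat_strip (\<lambda>w. cpow Z (of_real (1/2) * w + of_real (-1/2))
        ** cpow Y (of_real (-1) * w + of_real 1) ** cpow Z (of_real (1/2) * w + of_real (-1/2)))"
      by (intro mat_strip_mult mat_strip_cpow pZ that)
    thus ?thesis by (simp add: R_def[abs_def] diff_divide_distrib)
  qed
  have strip: "strip_fn F"
  proof -
    have "mat_strip (\<lambda>w. \<Phi>' (S X w) ** R Y w)" if "posdef X" "posdef Y" for X Y
      by (intro mat_strip_mult mat_strip_clinear[OF lin'] mS mR that)
    thus ?thesis
      unfolding F_def trace_def using assms
      by (intro strip_fn_add strip_fn_sum) (auto simp: mat_strip_def)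
  qed
  \<comment> \<open>In the two arithmetic means the first entries add up to B and so do the second
    entries; hence the means add up to B.\<close>
  have half_sums: "x + y \<le> B" if "x \<le> (a + b) / 2" "y \<le> (c + d) / 2" "a + c = B" "b + d = B"
    for x y a b c d :: real
    using that by (simp add: field_simps)
  have "cmod (F (of_real p)) \<le> B"
  proof (rule three_lines[OF strip p])
    fix w assume w: "Re w = 0"
    have uS: "unitary_mat (S X w)" if "posdef X" for X
      unfolding S_def using w that pA by (intro unitary_mult unitary_cpow) auto
    obtain L\<^sub>1 R\<^sub>1 L\<^sub>2 R\<^sub>2 :: "complex^'l^'l" where eq: "R Z\<^sub>1 w = cadj L\<^sub>1 ** R\<^sub>1" "R Z\<^sub>2 w = cadj L\<^sub>2 ** R\<^sub>2"
      and one: "cadj L\<^sub>1 ** L\<^sub>1 + cadj L\<^sub>2 ** L\<^sub>2 = mat 1" "cadj R\<^sub>1 ** R\<^sub>1 + cadj R\<^sub>2 ** R\<^sub>2 = mat 1"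
      unfolding R_def Z_def using w by (rule_tac cpow_sum_splitting[OF Z, of "(w-1)/2" "1-w"]) auto
    have split: "Re (trace (\<Phi>' (mat 1) ** X)) + Re (trace (\<Phi>' (mat 1) ** Y)) = B"
      if "X + Y = mat 1" for X Y
      using that by (simp add: B_def matrix_add_ldistrib[symmetric] trace_add[symmetric]
          plus_complex.sel(1)[symmetric] del: plus_complex.sel)
    show "cmod (F w) \<le> B"
      unfolding F_def eq
      by (rule order_trans[OF norm_triangle_ineq half_sums])
         (rule pos_map_unitary_left_bound[OF \<Phi>' uS] A split[OF one(1)] split[OF one(2)])+
  next
    fix w assume w: "Re w = 1"
    have uR: "unitary_mat (R Y w)" if "posdef Y" for Y
      unfolding R_def using w that pZ by (intro unitary_mult unitary_cpow) auto
    obtain L\<^sub>1 R\<^sub>1 L\<^sub>2 R\<^sub>2 :: "complex^'n^'n" where eq: "S A\<^sub>1 w = cadj L\<^sub>1 ** R\<^sub>1" "S A\<^sub>2 w = cadj L\<^sub>2 ** R\<^sub>2"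
      and one: "cadj L\<^sub>1 ** L\<^sub>1 + cadj L\<^sub>2 ** L\<^sub>2 = mat 1" "cadj R\<^sub>1 ** R\<^sub>1 + cadj R\<^sub>2 ** R\<^sub>2 = mat 1"
      unfolding S_def A_def using w by (rule_tac cpow_sum_splitting[OF A, of "-w/2" "w"]) auto
    have split: "Re (trace (\<Phi>' X)) + Re (trace (\<Phi>' Y)) = B" if "X + Y = mat 1" for X Y
      using that by (simp add: B_def clinear_map_add[OF lin', symmetric] trace_add[symmetric]
          plus_complex.sel(1)[symmetric] del: plus_complex.sel)
    show "cmod (F w) \<le> B"
      unfolding F_def eq
      by (rule order_trans[OF norm_triangle_ineq half_sums])
         (rule pos_map_unitary_right_bound[OF \<Phi>' uR] Z split[OF one(1)] split[OF one(2)])+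
  qed
  hence le: "Re (F (of_real p)) \<le> B" using complex_Re_le_cmod order_trans by blast
  define K where "K = cpow Z (of_real ((p-1)/2))"
  have KH: "K ** H = mat 1" "H ** K = mat 1"
    by (simp_all add: K_def H_def cpow_mult[OF pZ] cpow_0[OF pZ] field_simps flip: of_real_add)
  have val: "trace (\<Phi>' (S X (of_real p)) ** R Y (of_real p)) = trace (\<Phi> (mpow X p) ** mpow Y (1 - p))"
    if "posdef X" "posdef Y" for X Y
  proof -
    define J where "J = cpow A (of_real (- p / 2))"
    have GJ: "G ** J = mat 1" "J ** G = mat 1"
      by (simp_all add: G_def J_def cpow_mult[OF pA] cpow_0[OF pA] flip: of_real_add)
    have S_eq: "S X (of_real p) = J ** mpow X p ** J"
      by (simp add: S_def J_def cpow_of_real[OF that(1)])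
    have "G ** S X (of_real p) ** G = (G ** J) ** mpow X p ** (J ** G)"
      by (simp add: S_eq matrix_mul_assoc)
    hence S': "cadj G ** S X (of_real p) ** G = mpow X p" by (simp add: GJ G)
    have R_eq: "R Y (of_real p) = K ** mpow Y (1 - p) ** K"
      using cpow_of_real[OF that(2), of "1 - p"] by (simp add: R_def K_def)
    have "\<Phi>' (S X (of_real p)) ** R Y (of_real p) = H ** \<Phi> (mpow X p) ** (H ** K) ** mpow Y (1 - p) ** K"
      by (simp add: \<Phi>'_def S' R_eq H matrix_mul_assoc)
    hence "trace (\<Phi>' (S X (of_real p)) ** R Y (of_real p)) = trace (H ** \<Phi> (mpow X p) ** mpow Y (1 - p) ** K)"
      by (simp add: KH)
    also have "\<dots> = trace (K ** (H ** \<Phi> (mpow X p) ** mpow Y (1 - p)))"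
      by (rule trace_mul_sym)
    also have "\<dots> = trace (\<Phi> (mpow X p) ** mpow Y (1 - p))"
      by (simp add: matrix_mul_assoc KH)
    finally show ?thesis .
  qed
  \<comment> \<open>At the identity, \<open>\<Phi>'\<close> has \<open>G ** G\<close> inside \<Phi>
    and, by cyclicity of the trace, \<open>H ** H\<close> outside.\<close>
  have "B = Re (trace (\<Phi> (mpow A p) ** mpow Z (1 - p)))"
  proof -
    have "G ** G = mpow A p"
      by (simp add: G_def cpow_mult[OF pA] cpow_of_real[OF pA, symmetric] flip: of_real_add)
    hence "B = Re (trace (H ** \<Phi> (mpow A p) ** H))"
      by (simp add: B_def \<Phi>'_def G H)
    also have "trace (H ** \<Phi> (mpow A p) ** H) = trace (H ** (H ** \<Phi> (mpow A p)))"
      by (rule trace_mul_sym)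
    also have "\<dots> = trace (\<Phi> (mpow A p) ** (H ** H))"
      by (simp add: matrix_mul_assoc trace_mul_sym[of "H ** H"])
    also have "H ** H = mpow Z (1 - p)"
      by (simp add: H_def cpow_mult[OF pZ] cpow_of_real[OF pZ, symmetric] flip: of_real_add)
    finally show ?thesis .
  qed
  thus ?thesis
    using le unfolding F_def by (simp add: val A Z A_def Z_def)
qed

section \<open>Trace inequalities\<close>

lemma mpow_mult: "posdef A \<Longrightarrow> mpow A r ** mpow A s = mpow A (r + s)"
  by (simp add: cpow_of_real[symmetric] cpow_mult)

lemma mpow_0: "posdef A \<Longrightarrow> mpow A 0 = mat 1"
  using cpow_of_real[of A 0] by (simp add: cpow_0)

lemma mpow_1: "posdef A \<Longrightarrow> mpow A 1 = A"
  using cpow_of_real[of A 1] by (simp add: cpow_1)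

lemma posdef_mpow: "posdef A \<Longrightarrow> posdef (mpow A r)"
  by (erule posdef_spectral) (auto simp: mpow_rsp posdef_rsp less_imp_neq[THEN not_sym])

lemma cadj_mpow: "posdef A \<Longrightarrow> cadj (mpow A r) = mpow A r"
  using posdef_mpow[of A r] by (simp add: posdef_iff hermitian_mat_def)

lemma mpow_mpow: "posdef A \<Longrightarrow> mpow (mpow A r) s = mpow A (r * s)"
  by (erule posdef_spectral) (simp add: mpow_rsp powr_powr)

lemma scaleR_rsp: "r *\<^sub>R rsp U d = rsp U (\<lambda>i. r * d i)"
  unfolding sp_eq_sum scaleR_sum_right
  by (simp add: cscale_of_real[symmetric] cscale_cscale)

lemma mpow_scaleR:
  assumes "posdef A" "t > 0"
  shows "mpow (t *\<^sub>R A) r = (t powr r) *\<^sub>R mpow A r"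
proof -
  obtain U d where U: "unitary_mat U" and A: "A = rsp U d" and d: "\<And>i. d i > 0"
    using posdef_spectral[OF assms(1)] by blast
  show ?thesis
    unfolding A scaleR_rsp mpow_rsp[OF U] using assms(2) d
    by (simp add: powr_mult less_imp_le)
qed

lemma mpow_half: "posdef A \<Longrightarrow> mpow A (1/2) ** mpow A (1/2) = A"
  by (simp add: mpow_mult mpow_1)

lemma mpow_half_inverse:
  assumes "posdef A"
  shows "mpow A (1/2) ** mpow A (- (1/2)) = mat 1" "mpow A (- (1/2)) ** mpow A (1/2) = mat 1"
  using assms by (simp_all add: mpow_mult mpow_0)

lemma posdef_congruence:
  assumes A: "posdef A" and G: "G' ** G = mat 1"
  shows "posdef (cadj G ** A ** G)"
proof -
  have "Re (cip x ((cadj G ** A ** G) *v x)) > 0" if "x \<noteq> 0" for x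
  proof -
    have "cip x ((cadj G ** A ** G) *v x) = cip (G *v x) (A *v (G *v x))"
      by (simp add: cip_cadj' matrix_vector_mul_assoc matrix_mul_assoc)
    moreover have "G *v x \<noteq> 0"
      using that G by (metis matrix_vector_mul_assoc matrix_vector_mul_lid matrix_vector_mult_0_right)
    ultimately show ?thesis using A by (simp add: posdef_iff)
  qed
  thus ?thesis using A by (simp add: posdef_iff hermitian_congruence)
qed

text \<open>For positive definite X and Y this is the Hermitian matrix similar to the product of X
  and Y, to which f can be applied.\<close>

definition sandwich :: "complex^'n^'n \<Rightarrow> complex^'n^'n \<Rightarrow> complex^'n^'n" where
  "sandwich X Y = mpow X (1/2) ** Y ** mpow X (1/2)"

lemma posdef_sandwich:
  assumes "posdef X" "posdef Y"
  shows "posdef (sandwich X Y)"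
  using posdef_congruence[OF assms(2) mpow_half_inverse(2)[OF assms(1)]]
  by (simp add: sandwich_def cadj_mpow[OF assms(1)])

section \<open>Trace inequalities in a pair of eigenbases\<close>

lemma trace_rsp: "unitary_mat U \<Longrightarrow> Re (trace (rsp U d)) = (\<Sum>i\<in>UNIV. d i)"
  by (simp add: trace_sp)

lemma Re_trace_mult_rsp:
  "Re (trace (rsp U d ** rsp V e)) = (\<Sum>i\<in>UNIV. \<Sum>j\<in>UNIV. d i * e j * overlap U V i j)"
  by (simp add: trace_mult_sp flip: of_real_mult)

lemma sum_overlap_left:
  assumes "unitary_mat U" "unitary_mat V"
  shows "(\<Sum>i\<in>UNIV. \<Sum>j\<in>UNIV. d i * overlap U V i j) = (\<Sum>i\<in>UNIV. d i)"
  by (simp add: sum_distrib_left[symmetric] overlap_sum_right[OF assms])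

lemma sum_overlap_right:
  assumes "unitary_mat U" "unitary_mat V"
  shows "(\<Sum>i\<in>UNIV. \<Sum>j\<in>UNIV. e j * overlap U V i j) = (\<Sum>j\<in>UNIV. e j)"
  by (subst sum.swap) (simp add: sum_distrib_left[symmetric] overlap_sum_left[OF assms])

text \<open>The scalar Young inequality for each pair of eigenvalues, weighted by the overlaps,
  whose rows and columns sum to 1.\<close>

lemma trace_young:
  assumes "posdef A" "posdef B" "0 \<le> p" "p \<le> 1"
  shows "Re (trace (mpow A p ** mpow B (1 - p))) \<le> p * Re (trace A) + (1 - p) * Re (trace B)"
proof -
  obtain U a where U: "unitary_mat U" and A: "A = rsp U a" and a: "\<And>i. a i > 0"
    using posdef_spectral[OF assms(1)] by blast
  obtain V b where V: "unitary_mat V" and B: "B = rsp V b" and b: "\<And>i. b i > 0"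
    using posdef_spectral[OF assms(2)] by blast
  have "Re (trace (mpow A p ** mpow B (1 - p))) =
      (\<Sum>i\<in>UNIV. \<Sum>j\<in>UNIV. a i powr p * b j powr (1 - p) * overlap U V i j)"
    by (simp add: A B mpow_rsp U V Re_trace_mult_rsp)
  also have "\<dots> \<le> (\<Sum>i\<in>UNIV. \<Sum>j\<in>UNIV. (p * a i + (1 - p) * b j) * overlap U V i j)"
    using a b assms(3,4)
    by (intro sum_mono mult_right_mono Youngs_inequality_0 overlap_nonneg) auto
  also have "\<dots> = (\<Sum>i\<in>UNIV. \<Sum>j\<in>UNIV. p * a i * overlap U V i j) +
      (\<Sum>i\<in>UNIV. \<Sum>j\<in>UNIV. (1 - p) * b j * overlap U V i j)"
    by (simp add: distrib_right sum.distrib)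
  also have "\<dots> = p * Re (trace A) + (1 - p) * Re (trace B)"
    unfolding sum_overlap_left[OF U V] sum_overlap_right[OF U V]
    by (simp add: A B trace_rsp U V sum_distrib_left)
  finally show ?thesis .
qed

text \<open>For eigenvalues a of x and b of m put \<open>c = b powr p\<close>; then
  \<open>c / a + a / c \<ge> 2\<close>, multiplied by b, is the scalar form. The overlaps pass it to
  traces.\<close>

lemma trace_am_gm:
  assumes "posdef x" "posdef m"
  shows "2 * Re (trace m) \<le>
    Re (trace (mpow x (-1) ** mpow m (1 + p))) + Re (trace (x ** mpow m (1 - p)))"
proof -
  obtain U a where U: "unitary_mat U" and x: "x = rsp U a" and a: "\<And>i. a i > 0"
    using posdef_spectral[OF assms(1)] by blast
  obtain V b where V: "unitary_mat V" and m: "m = rsp V b" and b: "\<And>i. b i > 0"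
    using posdef_spectral[OF assms(2)] by blast
  have scalar: "2 * b j \<le> a i powr (-1) * b j powr (1 + p) + a i * b j powr (1 - p)" for i j
  proof -
    define c where "c = b j powr p"
    have c: "c > 0" using b[of j] by (simp add: c_def)
    have "b j powr (1 + p) = b j * c" "b j powr (1 - p) = b j / c"
      using b[of j] by (simp_all add: c_def powr_add powr_diff)
    moreover have "2 \<le> c / a i + a i / c"
      using a[of i] c sum_squares_ge_zero[of "c - a i" 0]
      by (simp add: field_simps power2_eq_square)
    hence "b j * 2 \<le> b j * (c / a i + a i / c)"
      using b by (intro mult_left_mono) (auto simp: less_imp_le)
    ultimately show ?thesis
      using a[of i] by (simp add: powr_minus_divide algebra_simps)
  qed
  have "2 * Re (trace m) = (\<Sum>i\<in>UNIV. \<Sum>j\<in>UNIV. 2 * b j * overlap U V i j)"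
    by (simp add: sum_overlap_right[OF U V] m trace_rsp[OF V] sum_distrib_left)
  also have "\<dots> \<le> (\<Sum>i\<in>UNIV. \<Sum>j\<in>UNIV.
      (a i powr (-1) * b j powr (1 + p) + a i * b j powr (1 - p)) * overlap U V i j)"
    by (intro sum_mono mult_right_mono scalar overlap_nonneg)
  also have "\<dots> = Re (trace (mpow x (-1) ** mpow m (1 + p))) + Re (trace (x ** mpow m (1 - p)))"
    unfolding x m mpow_rsp[OF U] mpow_rsp[OF V] Re_trace_mult_rsp
    by (simp add: distrib_right sum.distrib)
  finally show ?thesis .
qed

text \<open>The power 1 + p of m is \<open>sandwich x y\<close>, so by cyclicity the first term of
  the arithmetic-geometric mean inequality collapses to the trace of y.\<close>

lemma trace_sandwich_bound:
  assumes x: "posdef x" and y: "posdef y" and p: "p \<ge> 0"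
  defines "m \<equiv> mpow (sandwich x y) (1 / (1 + p))"
  shows "2 * Re (trace m) \<le> Re (trace y) + Re (trace (x ** mpow m (1 - p)))"
proof -
  have g: "posdef (sandwich x y)" by (rule posdef_sandwich[OF x y])
  have m: "posdef m" unfolding m_def by (rule posdef_mpow[OF g])
  have "mpow m (1 + p) = sandwich x y"
    unfolding m_def using p by (simp add: mpow_mpow[OF g] mpow_1[OF g])
  hence "trace (mpow x (-1) ** mpow m (1 + p)) = trace (mpow x (-1) ** mpow x (1/2) ** y ** mpow x (1/2))"
    by (simp add: sandwich_def matrix_mul_assoc)
  also have "\<dots> = trace (mpow x (1/2) ** (mpow x (-1) ** mpow x (1/2) ** y))"
    by (rule trace_mul_sym)
  also have "mpow x (1/2) ** (mpow x (-1) ** mpow x (1/2) ** y) = y"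
    by (simp add: matrix_mul_assoc mpow_mult[OF x] mpow_0[OF x])
  finally show ?thesis using trace_am_gm[OF x m, of p] by simp
qed

lemma trace_mult_mono:
  assumes "psd (X' - X)" "posdef N"
  shows "Re (trace (X ** N)) \<le> Re (trace (X' ** N))"
proof -
  have "Re (trace ((X' - X) ** (cadj (mpow N (1/2)) ** mpow N (1/2)))) \<ge> 0"
    by (rule psd_trace_mult[OF assms(1)])
  thus ?thesis
    using assms(2) by (simp add: cadj_mpow mpow_half matrix_diff_rdistrib trace_sub)
qed

lemma scaleR_mult: "(r *\<^sub>R A) ** B = r *\<^sub>R (A ** B)" "A ** (r *\<^sub>R B) = r *\<^sub>R (A ** B)"
  for A :: "complex^'n^'m"
  by (simp_all add: cscale_of_real[symmetric] cscale_mult_left cscale_mult_right)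

lemma trace_scaleR: "trace (r *\<^sub>R A) = of_real r * trace A" for A :: "complex^'n^'n"
  by (simp add: cscale_of_real[symmetric] trace_cscale)

text \<open>Joint homogeneity of degree \<open>p + (1 - p) = 1\<close> turns superadditivity into
  concavity.\<close>

lemma lieb_concavity_weighted:
  fixes \<Phi> :: "complex^'n^'n \<Rightarrow> complex^'l^'l"
  assumes \<Phi>: "pos_map \<Phi>" and A: "posdef A\<^sub>1" "posdef A\<^sub>2" and Z: "posdef Z\<^sub>1" "posdef Z\<^sub>2"
    and p: "0 \<le> p" "p \<le> 1" and t: "0 < t" "t < 1"
  shows "t * Re (trace (\<Phi> (mpow A\<^sub>1 p) ** mpow Z\<^sub>1 (1 - p))) +
      (1 - t) * Re (trace (\<Phi> (mpow A\<^sub>2 p) ** mpow Z\<^sub>2 (1 - p)))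
    \<le> Re (trace (\<Phi> (mpow (t *\<^sub>R A\<^sub>1 + (1 - t) *\<^sub>R A\<^sub>2) p) ** mpow (t *\<^sub>R Z\<^sub>1 + (1 - t) *\<^sub>R Z\<^sub>2) (1 - p)))"
proof -
  have hom: "Re (trace (\<Phi> (mpow (s *\<^sub>R B) p) ** mpow (s *\<^sub>R C) (1 - p))) =
      s * Re (trace (\<Phi> (mpow B p) ** mpow C (1 - p)))" if "s > 0" "posdef B" "posdef C" for s B C
  proof -
    have "s powr p * s powr (1 - p) = s"
      using that(1) by (simp add: powr_add[symmetric])
    hence "of_real (s powr p) * of_real (s powr (1 - p)) = complex_of_real s"
      by (simp only: of_real_mult[symmetric])
    thus ?thesis
      using that by (simp add: mpow_scaleR clinear_map_scaleR[OF pos_map_clinear[OF \<Phi>]] scaleR_mult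
          trace_scaleR mult.assoc[symmetric] mult.commute)
  qed
  show ?thesis
    using lieb_concavity_pos_map[OF \<Phi> posdef_scaleR[OF A(1) t(1)] posdef_scaleR[OF A(2)]
        posdef_scaleR[OF Z(1) t(1)] posdef_scaleR[OF Z(2)] p, of "1 - t" "1 - t"] t A Z
    by (simp add: hom)
qed

text \<open>The sandwich bound, Lieb's theorem and Young's inequality leave \<open>1 - p\<close>
  times the trace of the average N on the right, which the left side absorbs. The matrices
  \<open>x\<^sub>1\<close> and \<open>x\<^sub>2\<close> are merely dominated by values of \<Phi>;
  the function built from inverses makes use of this slack.\<close>

lemma trace_sandwich_concave:
  fixes \<Phi> :: "complex^'n^'n \<Rightarrow> complex^'l^'l"
  assumes \<Phi>: "pos_map \<Phi>" and A: "posdef A\<^sub>1" "posdef A\<^sub>2"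
    and p: "0 \<le> p" "p \<le> 1" and t: "0 < t" "t < 1"
    and x: "posdef x\<^sub>1" "posdef x\<^sub>2" and y: "posdef y\<^sub>1" "posdef y\<^sub>2" and m: "posdef m"
    and le: "psd (\<Phi> (mpow A\<^sub>1 p) - x\<^sub>1)" "psd (\<Phi> (mpow A\<^sub>2 p) - x\<^sub>2)"
    and mp: "\<Phi> (mpow (t *\<^sub>R A\<^sub>1 + (1 - t) *\<^sub>R A\<^sub>2) p) = mpow m p"
    and ym: "t * Re (trace y\<^sub>1) + (1 - t) * Re (trace y\<^sub>2) \<le> Re (trace m)"
  shows "t * Re (trace (mpow (sandwich x\<^sub>1 y\<^sub>1) (1 / (1 + p)))) +
    (1 - t) * Re (trace (mpow (sandwich x\<^sub>2 y\<^sub>2) (1 / (1 + p)))) \<le> Re (trace m)"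
proof -
  define z where "z x y = mpow (sandwich x y) (1 / (1 + p))" for x y :: "complex^'l^'l"
  define z\<^sub>1 where "z\<^sub>1 = z x\<^sub>1 y\<^sub>1"
  define z\<^sub>2 where "z\<^sub>2 = z x\<^sub>2 y\<^sub>2"
  define N where "N = t *\<^sub>R z\<^sub>1 + (1 - t) *\<^sub>R z\<^sub>2"
  have z: "posdef z\<^sub>1" "posdef z\<^sub>2"
    using x y by (simp_all add: z\<^sub>1_def z\<^sub>2_def z_def posdef_mpow posdef_sandwich)
  have N: "posdef N" unfolding N_def using z t by (intro posdef_add posdef_scaleR) auto
  have trN: "Re (trace N) = t * Re (trace z\<^sub>1) + (1 - t) * Re (trace z\<^sub>2)"
    by (simp add: N_def trace_add trace_scaleR)
  have b1: "2 * Re (trace z\<^sub>1) \<le> Re (trace y\<^sub>1) + Re (trace (\<Phi> (mpow A\<^sub>1 p) ** mpow z\<^sub>1 (1 - p)))"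
    using trace_sandwich_bound[OF x(1) y(1) p(1)] trace_mult_mono[OF le(1) posdef_mpow[OF z(1), of "1 - p"]]
    unfolding z\<^sub>1_def z_def by linarith
  have b2: "2 * Re (trace z\<^sub>2) \<le> Re (trace y\<^sub>2) + Re (trace (\<Phi> (mpow A\<^sub>2 p) ** mpow z\<^sub>2 (1 - p)))"
    using trace_sandwich_bound[OF x(2) y(2) p(1)] trace_mult_mono[OF le(2) posdef_mpow[OF z(2), of "1 - p"]]
    unfolding z\<^sub>2_def z_def by linarith
  have "2 * Re (trace N) = t * (2 * Re (trace z\<^sub>1)) + (1 - t) * (2 * Re (trace z\<^sub>2))"
    unfolding trN by simp
  also have "\<dots> \<le> t * (Re (trace y\<^sub>1) + Re (trace (\<Phi> (mpow A\<^sub>1 p) ** mpow z\<^sub>1 (1 - p)))) +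
      (1 - t) * (Re (trace y\<^sub>2) + Re (trace (\<Phi> (mpow A\<^sub>2 p) ** mpow z\<^sub>2 (1 - p))))"
    using t by (intro add_mono mult_left_mono b1 b2) auto
  also have "\<dots> \<le> Re (trace m) + Re (trace (mpow m p ** mpow N (1 - p)))"
    using ym lieb_concavity_weighted[OF \<Phi> A z p t, unfolded mp, folded N_def]
    by (simp add: distrib_left)
  also have "\<dots> \<le> Re (trace m) + (p * Re (trace m) + (1 - p) * Re (trace N))"
    by (intro add_left_mono trace_young m N p)
  finally have "(1 + p) * Re (trace N) \<le> (1 + p) * Re (trace m)" by (simp add: algebra_simps)
  thus ?thesis using p(1) unfolding trN z\<^sub>1_def z\<^sub>2_def z_def by simp
qed

section \<open>Interlacing and majorization\<close>

lemma Re_cip_rsp_le: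
  assumes U: "unitary_mat U" and le: "\<And>i. cip (column i U) x \<noteq> 0 \<Longrightarrow> d i \<le> c"
  shows "Re (cip x (rsp U d *v x)) \<le> c * (norm x)\<^sup>2"
proof -
  have "d i * (cmod (cip (column i U) x))\<^sup>2 \<le> c * (cmod (cip (column i U) x))\<^sup>2" for i
    using le[of i] by (cases "cip (column i U) x = 0") (auto intro: mult_right_mono)
  thus ?thesis
    unfolding Re_cip_rsp norm_columns[OF U] sum_distrib_left by (intro sum_mono)
qed

lemma Re_cip_rsp_ge:
  assumes U: "unitary_mat U" and le: "\<And>i. cip (column i U) x \<noteq> 0 \<Longrightarrow> c \<le> d i"
  shows "c * (norm x)\<^sup>2 \<le> Re (cip x (rsp U d *v x))"
proof -
  have "c * (cmod (cip (column i U) x))\<^sup>2 \<le> d i * (cmod (cip (column i U) x))\<^sup>2" for i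
    using le[of i] by (cases "cip (column i U) x = 0") (auto intro: mult_right_mono)
  thus ?thesis
    unfolding Re_cip_rsp norm_columns[OF U] sum_distrib_left by (intro sum_mono)
qed

lemma sp_vector_fixed:
  assumes U: "unitary_mat U" and d: "\<And>i. d i = 1 \<or> cip (column i U) x = 0"
  shows "sp U d *v x = x"
proof -
  have "cip y (sp U d *v x) = cip y (sp U (\<lambda>_. 1) *v x)" for y
    unfolding cip_sp using d by (intro sum.cong refl) auto
  hence "cip y (sp U d *v x - x) = 0" for y
    by (simp add: sp_1[OF U] cip_simps)
  thus ?thesis by (metis cip_self_eq_0 eq_iff_diff_eq_0)
qed

lemma card_idx_greater: "card {i::'n::finite. idx i > a} \<le> CARD('n) - 1 - a"
proof -
  have "card {i::'n. idx i > a} = card (idx ` {i::'n. idx i > a})"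
    by (rule card_image[symmetric]) (auto simp: inj_on_def)
  also have "\<dots> \<le> card {a<..<CARD('n)}"
    by (intro card_mono) auto
  finally show ?thesis by simp
qed

lemma card_idx_less: "card {i::'n::finite. idx i < a} \<le> a"
proof -
  have "card {i::'n. idx i < a} = card (idx ` {i::'n. idx i < a})"
    by (rule card_image[symmetric]) (auto simp: inj_on_def)
  also have "\<dots> \<le> card {..<a}"
    by (intro card_mono) auto
  finally show ?thesis by simp
qed

lemma card_idx_ge: "card {i::'n::finite. idx i \<ge> a} \<le> CARD('n) - a"
proof -
  have "card {i::'n. idx i \<ge> a} = card (idx ` {i::'n. idx i \<ge> a})"
    by (rule card_image[symmetric]) (auto simp: inj_on_def)
  also have "\<dots> \<le> card {a..<CARD('n)}"
    by (intro card_mono) auto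
  finally show ?thesis by simp
qed

text \<open>In the manner of Courant and Fischer, one vector w makes the quadratic forms of both
  sandwiches equal to \<open>cip w (Y *v w)\<close>: that of X and Y at \<omega>, that of x and y at
  \<beta>. Where \<open>G ** cadj H\<close> acts as the identity, Cauchy-Schwarz gives
  \<open>norm \<beta> \<le> norm \<omega>\<close>, and the eigenvalue bounds on the two sides can be
  chained.\<close>

lemma eigenvalue_interlacing:
  fixes X Y G H K W :: "complex^'l^'l"
  assumes X: "posdef X" and Y: "posdef Y" and x: "posdef x" and y: "posdef y"
    and xG: "x = cadj G ** X ** G" and yH: "y = cadj H ** Y ** H" and G: "G ** G' = mat 1"
    and K: "K' ** K = mat 1"
    and fixed: "\<And>u. (\<And>i. idx i \<ge> k \<Longrightarrow> cip (column i W) u = 0) \<Longrightarrow> (G ** cadj H) *v (K *v u) = K *v u"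
    and U: "unitary_mat U" "sandwich X Y = rsp U lam" "\<And>i j. idx i \<le> idx j \<Longrightarrow> lam i \<le> lam j"
    and V: "unitary_mat V" "sandwich x y = rsp V mu" "\<And>i j. idx i \<le> idx j \<Longrightarrow> mu i \<le> mu j"
    and k: "k \<le> CARD('l)" "idx i\<^sub>0 < k" and j\<^sub>0: "idx j\<^sub>0 = idx i\<^sub>0 + (CARD('l) - k)"
  shows "lam i\<^sub>0 \<le> mu j\<^sub>0"
proof -
  define P where "P = mpow x (1/2) ** G' ** K"
  define Q where "Q = mpow X (- (1/2)) ** H ** cadj G ** X ** K"
  \<comment> \<open>Orthogonality to \<open>S\<close> amounts to at most \<open>CARD('l) - 1\<close> linear equations. A nonzero solution \<open>u'\<close>
    yields a vector on which the quadratic forms of both sides can be compared.\<close>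
  define S where "S = (\<lambda>i. column i W) ` {i. idx i \<ge> k} \<union>
    (\<lambda>i. cadj P *v column i V) ` {i. idx i > idx j\<^sub>0} \<union> (\<lambda>i. cadj Q *v column i U) ` {i. idx i < idx i\<^sub>0}"
  have "card S \<le> card {i::'l. idx i \<ge> k} + card {i::'l. idx i > idx j\<^sub>0} + card {i::'l. idx i < idx i\<^sub>0}"
    unfolding S_def
    by (intro order_trans[OF card_Un_le] add_mono card_image_le) auto
  also have "\<dots> \<le> (CARD('l) - k) + (CARD('l) - 1 - idx j\<^sub>0) + idx i\<^sub>0"
    by (intro add_mono card_idx_ge card_idx_greater card_idx_less)
  also have "\<dots> < CARD('l)" using k j\<^sub>0 by simp
  finally have "card S < CARD('l)" .
  moreover have "finite S" by (simp add: S_def)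
  ultimately obtain u' where u': "u' \<noteq> 0" "\<And>s. s \<in> S \<Longrightarrow> cip s u' = 0"
    using exists_orthogonal_vector by blast
  define u where "u = K *v u'"
  define \<beta> where "\<beta> = P *v u'"
  define \<omega> where "\<omega> = Q *v u'"
  define w where "w = H *v (cadj G *v (X *v u))"
  have "u \<noteq> 0"
    unfolding u_def using u'(1) K
    by (metis matrix_vector_mul_assoc matrix_vector_mul_lid matrix_vector_mult_0_right)
  have fix_u: "(G ** cadj H) *v u = u"
    unfolding u_def by (rule fixed) (auto intro!: u'(2) simp: S_def)
  have \<beta>_perp: "cip (column i V) \<beta> = 0" if "idx i > idx j\<^sub>0" for i
    unfolding \<beta>_def cip_cadj using that by (auto intro!: u'(2) simp: S_def)
  have \<omega>_perp: "cip (column i U) \<omega> = 0" if "idx i < idx i\<^sub>0" for i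
    unfolding \<omega>_def cip_cadj using that by (auto intro!: u'(2) simp: S_def)
  have GG': "G *v (G' *v v) = v" for v by (simp add: matrix_vector_mul_assoc G)
  have hX: "cip (mpow X r *v a) b = cip a (mpow X r *v b)" for r a b
    by (simp add: cip_cadj' cadj_mpow[OF X])
  have hx: "cip (mpow x r *v a) b = cip a (mpow x r *v b)" for r a b
    by (simp add: cip_cadj' cadj_mpow[OF x])
  have X_half: "mpow X (1/2) *v (mpow X (1/2) *v a) = X *v a" for a
    by (simp add: matrix_vector_mul_assoc mpow_half[OF X])
  have x_half: "mpow x (1/2) *v (mpow x (1/2) *v a) = x *v a" for a
    by (simp add: matrix_vector_mul_assoc mpow_half[OF x])
  have \<beta>_eq: "\<beta> = mpow x (1/2) *v (G' *v u)"
    by (simp add: \<beta>_def P_def u_def matrix_vector_mul_assoc matrix_mul_assoc)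
  have \<omega>_eq: "\<omega> = mpow X (- (1/2)) *v w"
    by (simp add: \<omega>_def Q_def u_def w_def matrix_vector_mul_assoc matrix_mul_assoc)
  have w_eq: "mpow X (1/2) *v \<omega> = w"
    unfolding \<omega>_eq by (simp add: matrix_vector_mul_assoc mpow_half_inverse[OF X])
  have x\<beta>: "mpow x (1/2) *v \<beta> = cadj G *v (X *v u)"
  proof -
    have "mpow x (1/2) *v \<beta> = x *v (G' *v u)"
      unfolding \<beta>_eq x_half ..
    also have "\<dots> = cadj G *v (X *v (G *v (G' *v u)))"
      unfolding xG by (simp add: matrix_vector_mul_assoc matrix_mul_assoc)
    finally show ?thesis by (simp add: GG')
  qed
  have norm_\<beta>: "cip \<beta> \<beta> = cip u (X *v u)"
  proof -
    have "cip \<beta> \<beta> = cip (G' *v u) (mpow x (1/2) *v \<beta>)"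
      by (subst \<beta>_eq) (simp add: hx)
    also have "\<dots> = cip (G *v (G' *v u)) (X *v u)"
      unfolding x\<beta> by (simp add: cip_cadj')
    finally show ?thesis by (simp add: GG')
  qed
  have "\<beta> \<noteq> 0"
  proof
    assume "\<beta> = 0"
    hence "cip u (X *v u) = 0" using norm_\<beta> by simp
    thus False using X \<open>u \<noteq> 0\<close> by (metis less_irrefl posdef_iff zero_complex.sel(1))
  qed
  \<comment> \<open>The squared norm of \<beta> is \<open>cip u (X *v u)\<close>. Inserting
    \<open>G ** cadj H\<close> before the first u rewrites it as the pairing of
    \<open>X^(1/2) u\<close>, which has the norm of \<beta>, with \<omega>.\<close>
  have "norm \<beta> \<le> norm \<omega>"
  proof -
    have "cip u (X *v u) = cip ((G ** cadj H) *v u) (X *v u)" by (simp add: fix_u)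
    also have "\<dots> = cip u w"
      by (simp add: cip_cadj' cadj_mult w_def matrix_vector_mul_assoc matrix_mul_assoc)
    also have "\<dots> = cip (mpow X (1/2) *v u) \<omega>"
      by (simp add: hX w_eq)
    finally have "Re (cip \<beta> \<beta>) \<le> norm (mpow X (1/2) *v u) * norm \<omega>"
      unfolding norm_\<beta> Re_cip by (metis Re_cip norm_cauchy_schwarz)
    moreover have "cip (mpow X (1/2) *v u) (mpow X (1/2) *v u) = cip \<beta> \<beta>"
      unfolding norm_\<beta> by (simp add: hX X_half)
    hence "norm (mpow X (1/2) *v u) = norm \<beta>"
      by (metis Re_cip norm_eq)
    ultimately have "norm \<beta> * norm \<beta> \<le> norm \<beta> * norm \<omega>"
      by (simp add: cip_self power2_eq_square)
    thus ?thesis using \<open>\<beta> \<noteq> 0\<close> by simp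
  qed
  have "cip \<omega> (sandwich X Y *v \<omega>) = cip w (Y *v w)"
    unfolding sandwich_def matrix_vector_mul_assoc[symmetric] w_eq hX[symmetric] ..
  moreover have "cip \<beta> (sandwich x y *v \<beta>) = cip w (Y *v w)"
  proof -
    have "cip \<beta> (sandwich x y *v \<beta>) = cip (cadj G *v (X *v u)) (y *v (cadj G *v (X *v u)))"
      unfolding sandwich_def matrix_vector_mul_assoc[symmetric] x\<beta> hx[symmetric] ..
    also have "\<dots> = cip w (Y *v w)"
      unfolding yH w_def matrix_vector_mul_assoc[symmetric] by (simp add: cip_cadj)
    finally show ?thesis .
  qed
  moreover have "lam i\<^sub>0 * (norm \<omega>)\<^sup>2 \<le> Re (cip \<omega> (sandwich X Y *v \<omega>))"
    unfolding U(2) using \<omega>_perp U(3) by (intro Re_cip_rsp_ge[OF U(1)]) (metis not_le)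
  moreover have "Re (cip \<beta> (sandwich x y *v \<beta>)) \<le> mu j\<^sub>0 * (norm \<beta>)\<^sup>2"
    unfolding V(2) using \<beta>_perp V(3) by (intro Re_cip_rsp_le[OF V(1)]) (metis not_le)
  moreover have "mu j\<^sub>0 * (norm \<beta>)\<^sup>2 \<le> mu j\<^sub>0 * (norm \<omega>)\<^sup>2"
  proof -
    have "mu j\<^sub>0 > 0" using posdef_sandwich[OF x y] V(1,2) posdef_rsp by metis
    thus ?thesis using \<open>norm \<beta> \<le> norm \<omega>\<close> by (intro mult_left_mono power_mono) auto
  qed
  ultimately have "lam i\<^sub>0 * (norm \<omega>)\<^sup>2 \<le> mu j\<^sub>0 * (norm \<omega>)\<^sup>2" by simp
  moreover have "norm \<omega> > 0" using \<open>\<beta> \<noteq> 0\<close> \<open>norm \<beta> \<le> norm \<omega>\<close> by (metis norm_le_zero_iff not_le order_trans)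
  ultimately show ?thesis by simp
qed

text \<open>c is the right derivative of h, written through the infimum of the slopes of the convex
  function -h. Adding the supergradient inequalities at x and y shows that c decreases, and
  monotonicity of h makes it nonnegative.\<close>

lemma concave_mono_supergradient:
  fixes h :: "real \<Rightarrow> real"
  assumes conc: "concave_on {0<..} h" and mono: "\<And>x y. 0 < x \<Longrightarrow> x \<le> y \<Longrightarrow> h x \<le> h y"
  obtains c where "\<And>x y. 0 < x \<Longrightarrow> 0 < y \<Longrightarrow> h y \<le> h x + c x * (y - x)"
    "\<And>x. 0 < x \<Longrightarrow> 0 \<le> c x" "\<And>x y. 0 < x \<Longrightarrow> x \<le> y \<Longrightarrow> c y \<le> c x"
proof -
  define c where "c x = - Inf ((\<lambda>t. (- h x - - h t) / (x - t)) ` ({x<..} \<inter> {0<..}))" for x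
  have sg: "h y \<le> h x + c x * (y - x)" if "0 < x" "0 < y" for x y
  proof -
    have "convex_on {0<..} (\<lambda>x. - h x)" using conc by (simp add: concave_on_def)
    moreover have "x \<in> interior {0<..}" using that by (simp add: interior_open)
    ultimately show ?thesis
      using convex_le_Inf_differential[of "{0<..}" "\<lambda>x. - h x" x y] that by (simp add: c_def)
  qed
  show thesis
  proof (rule that[of c])
    show "h y \<le> h x + c x * (y - x)" if "0 < x" "0 < y" for x y by (rule sg[OF that])
    show "0 \<le> c x" if "0 < x" for x
      using sg[of x "x + 1"] mono[of x "x + 1"] that by simp
    show "c y \<le> c x" if "0 < x" "x \<le> y" for x y
    proof (cases "x = y")
      case False
      have "0 \<le> (c x - c y) * (y - x)"
        using sg[of x y] sg[of y x] that by (simp add: algebra_simps)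
      thus ?thesis using False that by (simp add: zero_le_mult_iff)
    qed simp
  qed
qed

text \<open>Abel summation in inductive form: because c decreases, \<open>c k\<close> times the
  partial sum of e stays below the weighted partial sum.\<close>

lemma sum_mult_antimono_nonneg:
  fixes c e :: "nat \<Rightarrow> real"
  assumes "\<And>k. k \<le> n \<Longrightarrow> 0 \<le> (\<Sum>i<k. e i)" "\<And>i. i < n \<Longrightarrow> 0 \<le> c i"
    "\<And>i j. i \<le> j \<Longrightarrow> j < n \<Longrightarrow> c j \<le> c i"
  shows "0 \<le> (\<Sum>i<n. c i * e i)"
proof (cases n)
  case (Suc m)
  have "k \<le> m \<Longrightarrow> c k * (\<Sum>i<Suc k. e i) \<le> (\<Sum>i<Suc k. c i * e i)" for k
  proof (induction k)
    case (Suc k)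
    have "c (Suc k) * (\<Sum>i<Suc k. e i) \<le> c k * (\<Sum>i<Suc k. e i)"
      using Suc.prems assms(1)[of "Suc k"] assms(3)[of k "Suc k"] \<open>n = Suc m\<close>
      by (intro mult_right_mono) auto
    thus ?case using Suc by (simp add: distrib_left)
  qed simp
  from this[of m] assms(1)[of n] assms(2)[of m] Suc show ?thesis
    by (metis lessI mult_nonneg_nonneg order_refl order_trans)
qed simp

text \<open>Bounding h by its tangent at \<open>a i\<close> leaves the sum of
  \<open>a i - b i\<close> with weights \<open>c (a i)\<close>. The weights decrease because a
  increases, so Abel summation applies to the hypothesis on partial sums.\<close>

lemma concave_majorization:
  fixes h :: "real \<Rightarrow> real" and a b :: "nat \<Rightarrow> real"
  assumes conc: "concave_on {0<..} h" and mono: "\<And>x y. 0 < x \<Longrightarrow> x \<le> y \<Longrightarrow> h x \<le> h y"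
    and a: "\<And>i. i < n \<Longrightarrow> 0 < a i" "\<And>i j. i \<le> j \<Longrightarrow> j < n \<Longrightarrow> a i \<le> a j"
    and b: "\<And>i. i < n \<Longrightarrow> 0 < b i"
    and le: "\<And>k. k \<le> n \<Longrightarrow> (\<Sum>i<k. b i) \<le> (\<Sum>i<k. a i)"
  shows "(\<Sum>i<n. h (b i)) \<le> (\<Sum>i<n. h (a i))"
proof -
  obtain c where c: "\<And>x y. 0 < x \<Longrightarrow> 0 < y \<Longrightarrow> h y \<le> h x + c x * (y - x)"
    "\<And>x. 0 < x \<Longrightarrow> 0 \<le> c x" "\<And>x y. 0 < x \<Longrightarrow> x \<le> y \<Longrightarrow> c y \<le> c x"
    using concave_mono_supergradient[OF conc mono] by blast
  have "0 \<le> (\<Sum>i<n. c (a i) * (a i - b i))"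
    using le a c by (intro sum_mult_antimono_nonneg) (auto simp: sum_subtractf)
  moreover have "(\<Sum>i<n. h (b i)) \<le> (\<Sum>i<n. h (a i) + c (a i) * (b i - a i))"
    using a b by (intro sum_mono c) auto
  moreover have "(\<Sum>i<n. h (a i) + c (a i) * (b i - a i)) =
      (\<Sum>i<n. h (a i)) - (\<Sum>i<n. c (a i) * (a i - b i))"
    by (simp add: sum.distrib sum_subtractf right_diff_distrib)
  ultimately show ?thesis by linarith
qed

text \<open>Interlacing compares the eigenvalue in position i with the one of the transformed pair
  in position i + n - k, n being the dimension. This shift is injective, so the k smallest values
  are matched with the k largest, whose powers are part of the full trace.\<close>

lemma bottom_eigenvalue_sum_le_trace:
  fixes X Y G H K W :: "complex^'l^'l"
  assumes X: "posdef X" and Y: "posdef Y" and x: "posdef x" and y: "posdef y"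
    and xG: "x = cadj G ** X ** G" and yH: "y = cadj H ** Y ** H" and G: "G ** G' = mat 1"
    and K: "K' ** K = mat 1"
    and fixed: "\<And>u. (\<And>i. idx i \<ge> k \<Longrightarrow> cip (column i W) u = 0) \<Longrightarrow> (G ** cadj H) *v (K *v u) = K *v u"
    and U: "unitary_mat U" "sandwich X Y = rsp U lam" "\<And>i j. idx i \<le> idx j \<Longrightarrow> lam i \<le> lam j"
    and k: "k \<le> CARD('l)" and s: "s \<ge> 0"
  shows "(\<Sum>i | idx i < k. lam i powr s) \<le> Re (trace (mpow (sandwich x y) s))"
proof -
  obtain V mu where V: "unitary_mat V" "sandwich x y = rsp V mu" "\<And>i. mu i > 0"
    "\<And>i j. idx i \<le> idx j \<Longrightarrow> mu i \<le> mu j"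
    using posdef_spectral[OF posdef_sandwich[OF x y]] by metis
  have lam: "lam i > 0" for i using posdef_sandwich[OF X Y] U(1,2) posdef_rsp by metis
  have "\<exists>j::'l. idx j = idx i + (CARD('l) - k)" if "idx i < k" for i :: 'l
  proof -
    have "idx i + (CARD('l) - k) \<in> {..<CARD('l)}" using that k by simp
    thus ?thesis using bij_betw_idx[where 'n = 'l] by (metis bij_betw_def imageE)
  qed
  then obtain \<sigma> :: "'l \<Rightarrow> 'l" where \<sigma>: "\<And>i. idx i < k \<Longrightarrow> idx (\<sigma> i) = idx i + (CARD('l) - k)"
    by metis
  have inj: "inj_on \<sigma> {i. idx i < k}"
    by (rule inj_onI) (metis (mono_tags) \<sigma> add_right_cancel idx_eq_iff mem_Collect_eq)
  have "(\<Sum>i | idx i < k. lam i powr s) \<le> (\<Sum>i | idx i < k. mu (\<sigma> i) powr s)"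
  proof (intro sum_mono powr_mono2 s)
    fix i :: 'l assume "i \<in> {i. idx i < k}"
    hence i: "idx i < k" by simp
    show "lam i \<le> mu (\<sigma> i)"
      by (rule eigenvalue_interlacing[OF X Y x y xG yH G K fixed U V(1,2,4) k i \<sigma>[OF i]])
  qed (simp add: lam less_imp_le)
  also have "\<dots> = (\<Sum>i\<in>\<sigma> ` {i. idx i < k}. mu i powr s)"
    by (simp add: sum.reindex[OF inj])
  also have "\<dots> \<le> (\<Sum>i\<in>UNIV. mu i powr s)"
    by (intro sum_mono2) auto
  also have "\<dots> = Re (trace (mpow (sandwich x y) s))"
    by (simp add: V(2) mpow_rsp[OF V(1)] trace_rsp[OF V(1)])
  finally show ?thesis .
qed

section \<open>Concavity of the sums of the smallest eigenvalues\<close>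

lemma Re_trace_congruence:
  "Re (trace (cadj H ** Y ** H)) = (\<Sum>i\<in>UNIV. Re (cip (column i H) (Y *v column i H)))"
  by (simp add: trace_def cip_column column_mult[symmetric] matrix_mul_assoc)

text \<open>After congruences that normalise the convex combination, the trace inequality bounds the
  average of the end point traces by the trace of m. Interlacing recovers the k smallest eigenvalues
  at the end points, and shrinking the other eigenvalues brings the trace of m within \<delta> of
  the bottom sum.\<close>

lemma bottom_eigenvalue_sums_concave:
  fixes \<Phi> :: "complex^'n^'n \<Rightarrow> complex^'l^'l" and X Y :: "complex^'l^'l"
  assumes \<Phi>: "pos_map \<Phi>" and A: "posdef A\<^sub>1" "posdef A\<^sub>2"
    and p: "0 \<le> p" "p \<le> 1" and t: "0 < t" "t < 1"
    and pX: "posdef X\<^sub>1" "posdef X\<^sub>2" "posdef X" and pY: "posdef Y\<^sub>1" "posdef Y\<^sub>2" "posdef Y"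
    and le: "psd (\<Phi> (mpow A\<^sub>1 p) - X\<^sub>1)" "psd (\<Phi> (mpow A\<^sub>2 p) - X\<^sub>2)"
    and X: "\<Phi> (mpow (t *\<^sub>R A\<^sub>1 + (1 - t) *\<^sub>R A\<^sub>2) p) = X"
    and Y: "\<And>v. t * Re (cip v (Y\<^sub>1 *v v)) + (1 - t) * Re (cip v (Y\<^sub>2 *v v)) \<le> Re (cip v (Y *v v))"
    and U1: "unitary_mat U\<^sub>1" "sandwich X\<^sub>1 Y\<^sub>1 = rsp U\<^sub>1 l\<^sub>1" "\<And>i j. idx i \<le> idx j \<Longrightarrow> l\<^sub>1 i \<le> l\<^sub>1 j"
    and U2: "unitary_mat U\<^sub>2" "sandwich X\<^sub>2 Y\<^sub>2 = rsp U\<^sub>2 l\<^sub>2" "\<And>i j. idx i \<le> idx j \<Longrightarrow> l\<^sub>2 i \<le> l\<^sub>2 j"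
    and R: "unitary_mat R" "sandwich X Y = rsp R l"
    and k: "k \<le> CARD('l)" and s: "s = 1 / (1 + p)"
  shows "t * (\<Sum>i | idx i < k. l\<^sub>1 i powr s) + (1 - t) * (\<Sum>i | idx i < k. l\<^sub>2 i powr s)
    \<le> (\<Sum>i | idx i < k. l i powr s)"
proof (rule field_le_epsilon)
  fix \<delta> :: real assume \<delta>: "\<delta> > 0"
  have l: "l i > 0" for i using posdef_sandwich[OF pX(3) pY(3)] R posdef_rsp by metis
  \<comment> \<open>The congruences \<open>G\<close> and \<open>H\<close> carry \<open>X\<close> and \<open>Y\<close> to \<open>m\<^sup>p\<close> and \<open>m\<close>, where \<open>m\<close> is the power \<open>s\<close> of
    \<open>sandwich X Y\<close> with all but its \<open>k\<close> smallest eigenvalues multiplied by \<open>\<epsilon>\<close>.\<close>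
  define M where "M i = l i powr s" for i
  have M: "M i > 0" for i using l[of i] by (simp add: M_def)
  define tot where "tot = (\<Sum>i\<in>UNIV. M i)"
  have tot: "tot > 0" unfolding tot_def using M by (intro sum_pos) auto
  \<comment> \<open>Chosen so that the shrunken eigenvalues contribute at most
    \<open>\<epsilon> * tot = \<delta>\<close>.\<close>
  define \<epsilon> where "\<epsilon> = \<delta> / tot"
  have \<epsilon>: "\<epsilon> > 0" using \<delta> tot by (simp add: \<epsilon>_def)
  define c where "c i = (if idx i < k then 1 else \<epsilon>)" for i :: 'l
  have c: "c i > 0" for i using \<epsilon> by (simp add: c_def)
  define m where "m = rsp R (\<lambda>i. c i * M i)"
  have m: "posdef m" unfolding m_def posdef_rsp[OF R(1)] using c M by simp
  define g where "g i = (c i * M i) powr (p/2)" for i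
  \<comment> \<open>The exponents give \<open>\<kappa>^2 * l = c * M\<close>, as
    \<open>l = M powr (1 + p)\<close>, and \<open>g * \<kappa> = 1\<close> wherever
    \<open>c = 1\<close>. The first relation is behind \<open>HYH\<close>, the second behind
    \<open>fixed\<close>.\<close>
  define \<kappa> where "\<kappa> i = M i powr (- (p/2)) * c i powr (1/2)" for i
  have g: "g i > 0" and \<kappa>: "\<kappa> i > 0" for i
    using c[of i] M[of i] by (simp_all add: g_def \<kappa>_def)
  define G where "G = mpow X (- (1/2)) ** rsp R g"
  define g' where "g' i = 1 / g i" for i
  define \<kappa>' where "\<kappa>' i = 1 / \<kappa> i" for i
  define G' where "G' = rsp R g' ** mpow X (1/2)"
  define H where "H = mpow X (1/2) ** rsp R \<kappa>"
  define H' where "H' = rsp R \<kappa>' ** mpow X (- (1/2))"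
  have rmult: "sp R a ** sp R b = sp R (\<lambda>i. a i * b i)" for a b
    by (simp add: sp_mult[OF R(1)])
  have rmult': "B ** sp R a ** sp R b = B ** sp R (\<lambda>i. a i * b i)" for a b and B :: "complex^'l^'l"
    by (simp add: matrix_mul_assoc[symmetric] rmult)
  have "g i \<noteq> 0" "\<kappa> i \<noteq> 0" for i using g[of i] \<kappa>[of i] by auto
  hence gg': "complex_of_real (g i) * complex_of_real (g' i) = 1"
    "complex_of_real (g' i) * complex_of_real (g i) = 1"
    "complex_of_real (\<kappa>' i) * complex_of_real (\<kappa> i) = 1" for i
    by (simp_all add: g'_def \<kappa>'_def)
  note gg' = gg' sp_1[OF R(1)]
  note half = mpow_half_inverse[OF pX(3)]
  have half': "B ** mpow X (1/2) ** mpow X (- (1/2)) = B" "B ** mpow X (- (1/2)) ** mpow X (1/2) = B"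
    for B :: "complex^'l^'l"
    by (simp_all add: matrix_mul_assoc[symmetric] half)
  have GG': "G ** G' = mat 1"
    by (simp add: G_def G'_def matrix_mul_assoc rmult' gg' half)
  have G'G: "G' ** G = mat 1"
    by (simp add: G_def G'_def matrix_mul_assoc half' rmult gg')
  have H'H: "H' ** H = mat 1"
    by (simp add: H_def H'_def matrix_mul_assoc half' rmult gg')
  have cG: "cadj G = rsp R g ** mpow X (- (1/2))" and cH: "cadj H = rsp R \<kappa> ** mpow X (1/2)"
    by (simp_all add: G_def H_def cadj_mult cadj_mpow[OF pX(3)] cadj_sp)
  have "mpow X (- (1/2)) ** X ** mpow X (- (1/2)) = mat 1"
  proof -
    have "mpow X (- (1/2)) ** mpow X 1 ** mpow X (- (1/2)) = mat 1"
      by (simp only: mpow_mult[OF pX(3)]) (simp add: mpow_0[OF pX(3)])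
    thus ?thesis by (simp add: mpow_1[OF pX(3)])
  qed
  hence "cadj G ** X ** G = rsp R g ** rsp R g"
    by (metis (no_types, lifting) G_def cG matrix_mul_assoc matrix_mul_rid)
  also have "\<dots> = mpow m p"
  proof -
    have "g i * g i = (c i * M i) powr p" for i
      using c[of i] M[of i] by (simp add: g_def powr_add[symmetric])
    thus ?thesis by (simp add: rmult m_def mpow_rsp[OF R(1)] flip: of_real_mult)
  qed
  finally have GXG: "cadj G ** X ** G = mpow m p" .
  have HYH: "cadj H ** Y ** H = m"
  proof -
    have "cadj H ** Y ** H = rsp R \<kappa> ** sandwich X Y ** rsp R \<kappa>"
      unfolding cH sandwich_def by (simp add: H_def matrix_mul_assoc)
    also have "\<dots> = rsp R (\<lambda>i. \<kappa> i * l i * \<kappa> i)"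
      by (simp add: R(2) rmult flip: of_real_mult)
    also have "(\<lambda>i. \<kappa> i * l i * \<kappa> i) = (\<lambda>i. c i * M i)"
    proof
      fix i
      have "l i = M i powr (1 + p)"
        using l[of i] p(1) by (simp add: M_def powr_powr s)
      hence "\<kappa> i * l i * \<kappa> i = (c i powr (1/2) * c i powr (1/2)) *
          (M i powr (- (p/2)) * M i powr (1 + p) * M i powr (- (p/2)))"
        by (simp add: \<kappa>_def)
      also have "\<dots> = c i * M i"
        using c[of i] M[of i] by (simp only: powr_add[symmetric]) simp
      finally show "\<kappa> i * l i * \<kappa> i = c i * M i" .
    qed
    finally show ?thesis by (simp add: m_def)
  qed
  have fixed: "(G ** cadj H) *v (mpow X (- (1/2)) *v u) = mpow X (- (1/2)) *v u"
    if u: "\<And>i. idx i \<ge> k \<Longrightarrow> cip (column i R) u = 0" for u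
  proof -
    have "(G ** cadj H) *v (mpow X (- (1/2)) *v u) = mpow X (- (1/2)) *v (rsp R (\<lambda>i. g i * \<kappa> i) *v u)"
      by (simp add: G_def cH matrix_vector_mul_assoc matrix_mul_assoc half' rmult' flip: of_real_mult)
    also have "rsp R (\<lambda>i. g i * \<kappa> i) *v u = u"
    proof (rule sp_vector_fixed[OF R(1)])
      fix i
      show "complex_of_real (g i * \<kappa> i) = 1 \<or> cip (column i R) u = 0"
      proof (cases "idx i < k")
        case True
        have "g i * \<kappa> i = 1"
          using True M[of i] by (simp add: g_def \<kappa>_def c_def powr_add[symmetric])
        thus ?thesis by simp
      qed (simp add: u)
    qed
    finally show ?thesis .
  qed
  define \<Phi>' where "\<Phi>' = (\<lambda>S. cadj G ** \<Phi> S ** G)"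
  have \<Phi>': "pos_map \<Phi>'"
    using pos_map_congruence[OF \<Phi>, of G "mat 1"] by (simp add: \<Phi>'_def)
  define x where "x X = cadj G ** X ** G" for X
  define y where "y Y = cadj H ** Y ** H" for Y
  have px: "posdef (x B)" and py: "posdef (y B)" if "posdef B" for B
    unfolding x_def y_def using that by (auto intro: posdef_congruence G'G H'H)
  have le': "psd (\<Phi>' S - x B)" if "psd (\<Phi> S - B)" for S B
    using psd_congruence[OF that, of G]
    by (simp add: \<Phi>'_def x_def matrix_diff_ldistrib matrix_diff_rdistrib)
  \<comment> \<open>The trace of a congruence by H is the sum of the quadratic form over the columns
    of H, so the hypothesis on quadratic forms passes to traces.\<close>
  have "t * Re (trace (y Y\<^sub>1)) + (1 - t) * Re (trace (y Y\<^sub>2)) \<le> Re (trace (cadj H ** Y ** H))"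
    unfolding y_def Re_trace_congruence sum_distrib_left sum.distrib[symmetric]
    by (intro sum_mono Y)
  hence ym: "t * Re (trace (y Y\<^sub>1)) + (1 - t) * Re (trace (y Y\<^sub>2)) \<le> Re (trace m)"
    by (simp add: HYH)
  have "t * Re (trace (mpow (sandwich (x X\<^sub>1) (y Y\<^sub>1)) s)) + (1 - t) * Re (trace (mpow (sandwich (x X\<^sub>2) (y Y\<^sub>2)) s))
      \<le> Re (trace m)"
    unfolding s
    by (rule trace_sandwich_concave[OF \<Phi>' A p t px px py py m le' le' _ ym])
       (simp_all add: pX pY le \<Phi>'_def X GXG)
  moreover have "s \<ge> 0" using p by (simp add: s)
  have b1: "(\<Sum>i | idx i < k. l\<^sub>1 i powr s) \<le> Re (trace (mpow (sandwich (x X\<^sub>1) (y Y\<^sub>1)) s))"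
    by (rule bottom_eigenvalue_sum_le_trace[OF pX(1) pY(1) px[OF pX(1)] py[OF pY(1)] x_def y_def GG'
          half(1) fixed U1 k \<open>s \<ge> 0\<close>])
  have b2: "(\<Sum>i | idx i < k. l\<^sub>2 i powr s) \<le> Re (trace (mpow (sandwich (x X\<^sub>2) (y Y\<^sub>2)) s))"
    by (rule bottom_eigenvalue_sum_le_trace[OF pX(2) pY(2) px[OF pX(2)] py[OF pY(2)] x_def y_def GG'
          half(1) fixed U2 k \<open>s \<ge> 0\<close>])
  have "t * (\<Sum>i | idx i < k. l\<^sub>1 i powr s) + (1 - t) * (\<Sum>i | idx i < k. l\<^sub>2 i powr s) \<le>
      t * Re (trace (mpow (sandwich (x X\<^sub>1) (y Y\<^sub>1)) s)) + (1 - t) * Re (trace (mpow (sandwich (x X\<^sub>2) (y Y\<^sub>2)) s))"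
    using t by (intro add_mono mult_left_mono b1 b2) auto
  ultimately have "t * (\<Sum>i | idx i < k. l\<^sub>1 i powr s) + (1 - t) * (\<Sum>i | idx i < k. l\<^sub>2 i powr s)
      \<le> Re (trace m)" by linarith
  also have "Re (trace m) = (\<Sum>i\<in>UNIV. c i * M i)"
    unfolding m_def by (rule trace_rsp[OF R(1)])
  also have "\<dots> \<le> (\<Sum>i\<in>UNIV. (if idx i < k then M i else 0) + \<epsilon> * M i)"
    using M \<epsilon> by (intro sum_mono) (simp add: c_def less_imp_le)
  also have "\<dots> = (\<Sum>i | idx i < k. M i) + \<epsilon> * tot"
    by (simp add: sum.distrib sum_distrib_left tot_def sum.If_cases)
  also have "\<epsilon> * tot = \<delta>" using tot by (simp add: \<epsilon>_def)
  finally show "t * (\<Sum>i | idx i < k. l\<^sub>1 i powr s) + (1 - t) * (\<Sum>i | idx i < k. l\<^sub>2 i powr s)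
      \<le> (\<Sum>i | idx i < k. l i powr s) + \<delta>" by (simp add: M_def)
qed

section \<open>From eigenvalue sums to trace functions\<close>

lemma sum_idx:
  fixes f :: "'n::finite \<Rightarrow> real"
  assumes "k \<le> CARD('n)"
  shows "(\<Sum>i<k. f (inv_into UNIV idx i)) = (\<Sum>i | idx i < k. f i)"
proof (rule sum.reindex_bij_witness[of _ idx "inv_into UNIV idx"])
  have inj: "inj (idx :: 'n \<Rightarrow> nat)" and range: "range (idx :: 'n \<Rightarrow> nat) = {..<CARD('n)}"
    using bij_betw_idx[where 'n = 'n] by (auto simp: bij_betw_def)
  fix i assume "i \<in> {..<k}"
  hence "i \<in> range (idx :: 'n \<Rightarrow> nat)" using assms by (simp add: range)
  thus "idx (inv_into UNIV (idx :: 'n \<Rightarrow> nat) i) = i" by (rule f_inv_into_f)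
  thus "inv_into UNIV (idx :: 'n \<Rightarrow> nat) i \<in> {i. idx i < k}" using \<open>i \<in> {..<k}\<close> by simp
next
  have inj: "inj (idx :: 'n \<Rightarrow> nat)" using bij_betw_idx[where 'n = 'n] by (auto simp: bij_betw_def)
  thus "inv_into UNIV idx (idx i) = i" for i :: 'n by simp
qed auto

text \<open>With \<open>h x = f (x powr (1 + p))\<close>, the trace of f is the sum of h over the
  eigenvalues raised to the power \<open>1 / (1 + p)\<close>. Concavity of h handles the entrywise
  average of the two sorted lists, and majorisation compares this average with the list at the
  convex combination.\<close>

theorem trace_function_concave:
  fixes \<Phi> :: "complex^'n^'n \<Rightarrow> complex^'l^'l" and X Y :: "complex^'l^'l"
  assumes \<Phi>: "pos_map \<Phi>" and A: "posdef A\<^sub>1" "posdef A\<^sub>2"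
    and p: "0 \<le> p" "p \<le> 1" and t: "0 < t" "t < 1"
    and pX: "posdef X\<^sub>1" "posdef X\<^sub>2" "posdef X" and pY: "posdef Y\<^sub>1" "posdef Y\<^sub>2" "posdef Y"
    and le: "psd (\<Phi> (mpow A\<^sub>1 p) - X\<^sub>1)" "psd (\<Phi> (mpow A\<^sub>2 p) - X\<^sub>2)"
    and X: "\<Phi> (mpow (t *\<^sub>R A\<^sub>1 + (1 - t) *\<^sub>R A\<^sub>2) p) = X"
    and Y: "\<And>v. t * Re (cip v (Y\<^sub>1 *v v)) + (1 - t) * Re (cip v (Y\<^sub>2 *v v)) \<le> Re (cip v (Y *v v))"
    and mono: "\<And>x y. 0 < x \<Longrightarrow> x \<le> y \<Longrightarrow> f x \<le> f y"
    and conc: "concave_on {0<..} (\<lambda>x. f (x powr (1 + p)))"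
  shows "t * Re (trace (matfun f (sandwich X\<^sub>1 Y\<^sub>1))) + (1 - t) * Re (trace (matfun f (sandwich X\<^sub>2 Y\<^sub>2)))
    \<le> Re (trace (matfun f (sandwich X Y)))"
proof -
  obtain U\<^sub>1 l\<^sub>1 where U1: "unitary_mat U\<^sub>1" "sandwich X\<^sub>1 Y\<^sub>1 = rsp U\<^sub>1 l\<^sub>1" "\<And>i. l\<^sub>1 i > 0"
    "\<And>i j. idx i \<le> idx j \<Longrightarrow> l\<^sub>1 i \<le> l\<^sub>1 j"
    using posdef_spectral[OF posdef_sandwich[OF pX(1) pY(1)]] by metis
  obtain U\<^sub>2 l\<^sub>2 where U2: "unitary_mat U\<^sub>2" "sandwich X\<^sub>2 Y\<^sub>2 = rsp U\<^sub>2 l\<^sub>2" "\<And>i. l\<^sub>2 i > 0"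
    "\<And>i j. idx i \<le> idx j \<Longrightarrow> l\<^sub>2 i \<le> l\<^sub>2 j"
    using posdef_spectral[OF posdef_sandwich[OF pX(2) pY(2)]] by metis
  obtain R l where R: "unitary_mat R" "sandwich X Y = rsp R l" "\<And>i. l i > 0"
    "\<And>i j. idx i \<le> idx j \<Longrightarrow> l i \<le> l j"
    using posdef_spectral[OF posdef_sandwich[OF pX(3) pY(3)]] by metis
  define s where "s = 1 / (1 + p)"
  have s0: "s \<ge> 0" using p by (simp add: s_def)
  define h where "h x = f (x powr (1 + p))" for x
  have h: "f x = h (x powr s)" if "x > 0" for x
    using that p by (simp add: h_def s_def powr_powr)
  define v where "v e = (\<lambda>i. (e :: 'l \<Rightarrow> real) (inv_into UNIV idx i) powr s)" for e
  have tr: "Re (trace (matfun f B)) = (\<Sum>i<CARD('l). h (v e i))"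
    if "unitary_mat U" "B = rsp U e" "\<And>i. e i > 0" for B U e
  proof -
    have "Re (trace (matfun f B)) = (\<Sum>i | idx i < CARD('l). h (e i powr s))"
      using that by (simp add: matfun_rsp trace_rsp h)
    thus ?thesis
      using sum_idx[OF order_refl, of "\<lambda>i::'l. h (e i powr s)"] by (simp add: v_def)
  qed
  have vpos: "v e i > 0" if "\<And>i. e i > 0" for e i
    using that[of "inv_into UNIV idx i"] by (simp add: v_def)
  \<comment> \<open>Because the lists are sorted before averaging, the first k entries of b sum to
    the average of the two bottom sums.\<close>
  define b where "b i = t * v l\<^sub>1 i + (1 - t) * v l\<^sub>2 i" for i
  have hconc: "concave_on {0<..} h" using conc by (simp add: h_def[abs_def])
  have "t * Re (trace (matfun f (sandwich X\<^sub>1 Y\<^sub>1))) + (1 - t) * Re (trace (matfun f (sandwich X\<^sub>2 Y\<^sub>2)))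
      = (\<Sum>i<CARD('l). t * h (v l\<^sub>1 i) + (1 - t) * h (v l\<^sub>2 i))"
    by (simp add: tr[OF U1(1-3)] tr[OF U2(1-3)] sum.distrib sum_distrib_left)
  also have "\<dots> \<le> (\<Sum>i<CARD('l). h (b i))"
  proof (intro sum_mono)
    fix i
    show "t * h (v l\<^sub>1 i) + (1 - t) * h (v l\<^sub>2 i) \<le> h (b i)"
      using hconc t vpos[OF U1(3)] vpos[OF U2(3)] unfolding concave_on_iff b_def by auto
  qed
  also have "\<dots> \<le> (\<Sum>i<CARD('l). h (v l i))"
  proof (rule concave_majorization[OF hconc])
    show "h x \<le> h y" if "0 < x" "x \<le> y" for x y
      unfolding h_def using that p by (intro mono powr_mono2) auto
    show "0 < v l i" for i by (rule vpos[OF R(3)])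
    show "v l i \<le> v l j" if ij: "i \<le> j" "j < CARD('l)" for i j
    proof -
      have range: "range (idx :: 'l \<Rightarrow> nat) = {..<CARD('l)}"
        using bij_betw_idx[where 'n = 'l] by (auto simp: bij_betw_def)
      have "idx (inv_into UNIV (idx :: 'l \<Rightarrow> nat) i) = i" "idx (inv_into UNIV (idx :: 'l \<Rightarrow> nat) j) = j"
        using ij by (auto intro!: f_inv_into_f simp: range)
      thus ?thesis
        unfolding v_def using ij R(3) by (intro powr_mono2 s0 R(4)) (auto simp: less_imp_le)
    qed
    show "0 < b i" for i
      unfolding b_def using t vpos[OF U1(3)] vpos[OF U2(3)] by (simp add: add_pos_pos)
    show "(\<Sum>i<k. b i) \<le> (\<Sum>i<k. v l i)" if "k \<le> CARD('l)" for k
    proof -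
      have "(\<Sum>i<k. b i) = t * (\<Sum>i<k. v l\<^sub>1 i) + (1 - t) * (\<Sum>i<k. v l\<^sub>2 i)"
        by (simp add: b_def sum.distrib sum_distrib_left)
      moreover have "(\<Sum>i<k. v e i) = (\<Sum>i | idx i < k. e i powr s)" for e
        unfolding v_def using sum_idx[OF that, of "\<lambda>i. e i powr s"] .
      ultimately show ?thesis
        using bottom_eigenvalue_sums_concave[OF \<Phi> A p t pX pY le X Y U1(1,2,4) U2(1,2,4) R(1,2) that s_def]
        by simp
    qed
  qed
  also have "\<dots> = Re (trace (matfun f (sandwich X Y)))"
    by (simp add: tr[OF R(1-3)])
  finally show ?thesis .
qed

section \<open>Joint concavity\<close>

text \<open>Polar decomposition of \<open>N = Y^(1/2) X^(1/2)\<close>: the unitary factor V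
  conjugates \<open>cadj N ** N\<close> into \<open>N ** cadj N\<close>, so both sandwiches have the
  same eigenvalues.\<close>

lemma trace_matfun_sandwich_commute:
  assumes X: "posdef X" and Y: "posdef Y"
  shows "trace (matfun f (sandwich X Y)) = trace (matfun f (sandwich Y X))"
proof -
  define T where "T = sandwich X Y"
  have T: "posdef T" unfolding T_def by (rule posdef_sandwich[OF X Y])
  obtain U l where U: "unitary_mat U" "T = rsp U l"
    using posdef_spectral[OF T] by blast
  define N where "N = mpow Y (1/2) ** mpow X (1/2)"
  have cN: "cadj N = mpow X (1/2) ** mpow Y (1/2)"
    by (simp add: N_def cadj_mult cadj_mpow X Y)
  have NN: "cadj N ** N = T"
  proof -
    have "cadj N ** N = mpow X (1/2) ** (mpow Y (1/2) ** mpow Y (1/2)) ** mpow X (1/2)"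
      unfolding cN by (simp add: N_def matrix_mul_assoc)
    thus ?thesis by (simp add: mpow_half[OF Y] T_def sandwich_def)
  qed
  have NN': "N ** cadj N = sandwich Y X"
  proof -
    have "N ** cadj N = mpow Y (1/2) ** (mpow X (1/2) ** mpow X (1/2)) ** mpow Y (1/2)"
      unfolding cN by (simp add: N_def matrix_mul_assoc)
    thus ?thesis by (simp add: mpow_half[OF X] sandwich_def)
  qed
  have inv: "mpow T (- (1/2)) ** T ** mpow T (- (1/2)) = mat 1"
  proof -
    have "mpow T (- (1/2)) ** mpow T 1 ** mpow T (- (1/2)) = mat 1"
      by (simp only: mpow_mult[OF T]) (simp add: mpow_0[OF T])
    thus ?thesis by (simp add: mpow_1[OF T])
  qed
  define V where "V = N ** mpow T (- (1/2))"
  have cV: "cadj V = mpow T (- (1/2)) ** cadj N"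
    by (simp add: V_def cadj_mult cadj_mpow[OF T])
  have V: "unitary_mat V"
  proof -
    have "cadj V ** V = mpow T (- (1/2)) ** (cadj N ** N) ** mpow T (- (1/2))"
      unfolding cV by (simp add: V_def matrix_mul_assoc)
    thus ?thesis by (simp add: NN inv unitary_mat_def)
  qed
  have "sandwich Y X = V ** T ** cadj V"
  proof -
    have "V ** T ** cadj V = N ** (mpow T (- (1/2)) ** T ** mpow T (- (1/2))) ** cadj N"
      unfolding cV by (simp add: V_def matrix_mul_assoc)
    thus ?thesis by (simp add: inv NN')
  qed
  also have "\<dots> = rsp (V ** U) l"
    by (simp add: U(2) sp_def cadj_mult matrix_mul_assoc)
  finally show ?thesis
    using U V by (simp add: T_def[symmetric] matfun_rsp unitary_mult trace_sp)
qed

section \<open>Combination of the two positive maps\<close>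

lemma posdef_weighted:
  "posdef A \<Longrightarrow> posdef B \<Longrightarrow> 0 < t \<Longrightarrow> t < 1 \<Longrightarrow> posdef (t *\<^sub>R A + (1 - t) *\<^sub>R B)"
  by (intro posdef_add posdef_scaleR) auto

lemma mpow_mat_1: "mpow (mat 1) r = mat 1"
proof -
  have U: "unitary_mat (mat 1)" by (simp add: unitary_mat_def)
  show ?thesis using mpow_rsp[OF U, of "\<lambda>_. 1" r] by (simp add: sp_1[OF U])
qed

text \<open>Lieb's inequality with both Z equal to the identity, for \<Psi> compressed to the vector
  v.\<close>

lemma pos_map_mpow_concave:
  fixes \<Psi> :: "complex^'m^'m \<Rightarrow> complex^'l^'l" and v :: "complex^'l"
  assumes \<Psi>: "pos_map \<Psi>" and B: "posdef B\<^sub>1" "posdef B\<^sub>2" and q: "0 \<le> q" "q \<le> 1" and t: "0 < t" "t < 1"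
  shows "t * Re (cip v (\<Psi> (mpow B\<^sub>1 q) *v v)) + (1 - t) * Re (cip v (\<Psi> (mpow B\<^sub>2 q) *v v))
    \<le> Re (cip v (\<Psi> (mpow (t *\<^sub>R B\<^sub>1 + (1 - t) *\<^sub>R B\<^sub>2) q) *v v))"
proof -
  \<comment> \<open>\<open>H\<close> has \<open>v\<close> as its only nonzero column, so that the trace below is the quadratic form at \<open>v\<close>.\<close>
  define H :: "complex^'l^'l" where "H = (\<chi> i j. if j = undefined then v $ i else 0)"
  have col: "column j H = (if j = undefined then v else 0)" for j
    by (simp add: column_def H_def vec_eq_iff)
  have tr: "Re (trace (cadj H ** S ** H)) = Re (cip v (S *v v))" for S
  proof -
    have "Re (trace (cadj H ** S ** H)) = (\<Sum>j\<in>UNIV. if j = (undefined :: 'l) then Re (cip v (S *v v)) else 0)"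
      unfolding Re_trace_congruence by (intro sum.cong refl) (simp add: col)
    thus ?thesis by simp
  qed
  have one: "t *\<^sub>R mat 1 + (1 - t) *\<^sub>R mat 1 = (mat 1 :: complex^'l^'l)"
    by (simp add: scaleR_add_left[symmetric])
  have "pos_map (\<lambda>S. cadj H ** \<Psi> S ** H)"
    using pos_map_congruence[OF \<Psi>, of H "mat 1"] by simp
  from lieb_concavity_weighted[OF this B posdef_mat_1 posdef_mat_1 q t]
  show ?thesis by (simp add: one mpow_mat_1 tr)
qed

lemma psd_diffD: "psd (A - B) \<Longrightarrow> Re (cip v (B *v v)) \<le> Re (cip v (A *v v))"
  by (simp add: psd_def matrix_vector_mult_diff_rdistrib cip_simps)

text \<open>The quadratic form condition on Y follows from concavity of \<Psi> composed with the
  power q; the domination of \<open>Y\<^sub>1\<close> and \<open>Y\<^sub>2\<close> works in the same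
  direction.\<close>

lemma trace_function_concave_left:
  fixes \<Phi> :: "complex^'n^'n \<Rightarrow> complex^'l^'l" and \<Psi> :: "complex^'m^'m \<Rightarrow> complex^'l^'l"
  assumes \<Phi>: "pos_map \<Phi>" and \<Psi>: "pos_map \<Psi>" and A: "posdef A\<^sub>1" "posdef A\<^sub>2"
    and B: "posdef B\<^sub>1" "posdef B\<^sub>2"
    and p: "0 \<le> p" "p \<le> 1" and q: "0 \<le> q" "q \<le> 1" and t: "0 < t" "t < 1"
    and pX: "posdef X\<^sub>1" "posdef X\<^sub>2" "posdef X" and pY: "posdef Y\<^sub>1" "posdef Y\<^sub>2" "posdef Y"
    and leX: "psd (\<Phi> (mpow A\<^sub>1 p) - X\<^sub>1)" "psd (\<Phi> (mpow A\<^sub>2 p) - X\<^sub>2)"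
    and leY: "psd (\<Psi> (mpow B\<^sub>1 q) - Y\<^sub>1)" "psd (\<Psi> (mpow B\<^sub>2 q) - Y\<^sub>2)"
    and X: "\<Phi> (mpow (t *\<^sub>R A\<^sub>1 + (1 - t) *\<^sub>R A\<^sub>2) p) = X"
    and Y: "\<Psi> (mpow (t *\<^sub>R B\<^sub>1 + (1 - t) *\<^sub>R B\<^sub>2) q) = Y"
    and mono: "\<And>x y. 0 < x \<Longrightarrow> x \<le> y \<Longrightarrow> f x \<le> f y"
    and conc: "concave_on {0<..} (\<lambda>x. f (x powr (1 + p)))"
  shows "t * Re (trace (matfun f (sandwich X\<^sub>1 Y\<^sub>1))) + (1 - t) * Re (trace (matfun f (sandwich X\<^sub>2 Y\<^sub>2)))
    \<le> Re (trace (matfun f (sandwich X Y)))"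
proof (rule trace_function_concave[OF \<Phi> A p t pX pY leX X _ mono conc])
  fix v
  have "t * Re (cip v (Y\<^sub>1 *v v)) + (1 - t) * Re (cip v (Y\<^sub>2 *v v)) \<le>
      t * Re (cip v (\<Psi> (mpow B\<^sub>1 q) *v v)) + (1 - t) * Re (cip v (\<Psi> (mpow B\<^sub>2 q) *v v))"
    using t by (intro add_mono mult_left_mono psd_diffD leY) auto
  also have "\<dots> \<le> Re (cip v (Y *v v))"
    using pos_map_mpow_concave[OF \<Psi> B q t] by (simp add: Y)
  finally show "t * Re (cip v (Y\<^sub>1 *v v)) + (1 - t) * Re (cip v (Y\<^sub>2 *v v)) \<le> Re (cip v (Y *v v))" .
qed

text \<open>The alternative with exponent 1 + q is the one with 1 + p after interchanging the two
  maps, since exchanging the factors of a sandwich preserves the trace of f.\<close>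

lemma trace_function_concave_both:
  fixes \<Phi> :: "complex^'n^'n \<Rightarrow> complex^'l^'l" and \<Psi> :: "complex^'m^'m \<Rightarrow> complex^'l^'l"
  assumes \<Phi>: "pos_map \<Phi>" and \<Psi>: "pos_map \<Psi>" and A: "posdef A\<^sub>1" "posdef A\<^sub>2"
    and B: "posdef B\<^sub>1" "posdef B\<^sub>2"
    and p: "0 \<le> p" "p \<le> 1" and q: "0 \<le> q" "q \<le> 1" and t: "0 < t" "t < 1"
    and pX: "posdef X\<^sub>1" "posdef X\<^sub>2" "posdef X" and pY: "posdef Y\<^sub>1" "posdef Y\<^sub>2" "posdef Y"
    and leX: "psd (\<Phi> (mpow A\<^sub>1 p) - X\<^sub>1)" "psd (\<Phi> (mpow A\<^sub>2 p) - X\<^sub>2)"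
    and leY: "psd (\<Psi> (mpow B\<^sub>1 q) - Y\<^sub>1)" "psd (\<Psi> (mpow B\<^sub>2 q) - Y\<^sub>2)"
    and X: "\<Phi> (mpow (t *\<^sub>R A\<^sub>1 + (1 - t) *\<^sub>R A\<^sub>2) p) = X"
    and Y: "\<Psi> (mpow (t *\<^sub>R B\<^sub>1 + (1 - t) *\<^sub>R B\<^sub>2) q) = Y"
    and mono: "\<And>x y. 0 < x \<Longrightarrow> x \<le> y \<Longrightarrow> f x \<le> f y"
    and conc: "concave_on {0<..} (\<lambda>x. f (x powr (1 + p))) \<or> concave_on {0<..} (\<lambda>x. f (x powr (1 + q)))"
  shows "t * Re (trace (matfun f (sandwich X\<^sub>1 Y\<^sub>1))) + (1 - t) * Re (trace (matfun f (sandwich X\<^sub>2 Y\<^sub>2)))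
    \<le> Re (trace (matfun f (sandwich X Y)))"
  using conc
proof
  assume conc: "concave_on {0<..} (\<lambda>x. f (x powr (1 + p)))"
  show ?thesis
    by (rule trace_function_concave_left[OF \<Phi> \<Psi> A B p q t pX pY leX leY X Y mono conc])
next
  assume conc: "concave_on {0<..} (\<lambda>x. f (x powr (1 + q)))"
  show ?thesis
    using trace_function_concave_left[OF \<Psi> \<Phi> B A q p t pY pX leY leX Y X mono conc]
    by (simp add: trace_matfun_sandwich_commute pX pY)
qed

section \<open>Inverses of positive maps as minima\<close>

lemma outer_mult: "outer (M *v v) = M ** outer v ** cadj M"
proof -
  have "(M ** outer v ** cadj M) $ i $ j = outer (M *v v) $ i $ j" for i j
  proof -
    have "(M ** outer v) $ i $ k = (M *v v) $ i * cnj (v $ k)" for k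
      by (simp add: matrix_matrix_mult_def outer_def matrix_vector_mult_def sum_distrib_right mult.assoc)
    hence "(M ** outer v ** cadj M) $ i $ j = (\<Sum>k\<in>UNIV. (M *v v) $ i * cnj (v $ k) * cnj (M $ j $ k))"
      by (subst matrix_matrix_mult_def) (simp add: cadj_def)
    thus ?thesis
      by (simp add: outer_def matrix_vector_mult_def[of M v] sum_distrib_left mult_ac)
  qed
  thus ?thesis by (simp add: vec_eq_iff)
qed

text \<open>Diagonalising \<open>S^(1/2) K S^(1/2)\<close> expands \<open>S^(-1)\<close>, K and
  \<open>K S K\<close> in common rank one matrices with coefficients 1, \<kappa> and
  \<open>\<kappa>^2\<close>. After applying \<Phi>, the difference of the two sides is a sum of
  positive semidefinite forms evaluated at \<open>u - \<kappa> w\<close>.\<close>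

lemma pos_map_block_inequality:
  fixes \<Phi> :: "complex^'n^'n \<Rightarrow> complex^'l^'l"
  assumes \<Phi>: "pos_map \<Phi>" and S: "posdef S" and K: "hermitian_mat K"
  shows "2 * Re (cip u (\<Phi> K *v w)) \<le>
    Re (cip u (\<Phi> (mpow S (-1)) *v u)) + Re (cip w (\<Phi> (K ** S ** K) *v w))"
proof -
  note lin = pos_map_clinear[OF \<Phi>]
  have "hermitian_mat (mpow S (1/2) ** K ** mpow S (1/2))"
    using hermitian_congruence[OF K, of "mpow S (1/2)"] by (simp add: cadj_mpow[OF S])
  then obtain V \<kappa> where V: "unitary_mat V" and \<kappa>: "mpow S (1/2) ** K ** mpow S (1/2) = rsp V \<kappa>"
    using hermitian_spectral by metis
  define J where "J = mpow S (- (1/2))"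
  have J: "J ** mpow S (1/2) = mat 1" "mpow S (1/2) ** J = mat 1"
    by (simp_all add: J_def mpow_half_inverse[OF S])
  define \<Theta> where "\<Theta> d = J ** rsp V d ** J" for d
  define \<phi> where "\<phi> i = \<Phi> (outer (J *v column i V))" for i
  have psd: "psd (\<phi> i)" for i unfolding \<phi>_def by (rule pos_map_psd[OF \<Phi> psd_outer])
  have \<Phi>\<Theta>: "cip a (\<Phi> (\<Theta> d) *v b) = (\<Sum>i\<in>UNIV. of_real (d i) * cip a (\<phi> i *v b))" for a b d
  proof -
    have "\<Theta> d = (\<Sum>i\<in>UNIV. cscale (of_real (d i)) (outer (J *v column i V)))"
      unfolding \<Theta>_def sp_eq_sum matrix_mult_sum_left matrix_mult_sum_right outer_mult
      by (simp add: cscale_mult_left cscale_mult_right J_def cadj_mpow[OF S])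
    thus ?thesis
      by (simp add: clinear_map_sum[OF lin] clinear_map_cscale[OF lin] \<phi>_def matrix_vector_mult_sum_left
          cip_sum_right cscale_vector cip_simps)
  qed
  have K_eq: "K = \<Theta> \<kappa>"
  proof -
    have "\<Theta> \<kappa> = (J ** mpow S (1/2)) ** K ** (mpow S (1/2) ** J)"
      unfolding \<Theta>_def \<kappa>[symmetric] by (simp only: matrix_mul_assoc)
    thus ?thesis by (simp add: J)
  qed
  have S_inv: "mpow S (-1) = \<Theta> (\<lambda>_. 1)"
    using sp_1[OF V] by (simp add: \<Theta>_def J_def mpow_mult[OF S])
  have "K ** S ** K = \<Theta> (\<lambda>i. \<kappa> i * \<kappa> i)"
  proof -
    have "J ** S ** J = mat 1"
    proof -
      have "J ** S ** J = (J ** mpow S (1/2)) ** (mpow S (1/2) ** J)"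
        by (simp add: matrix_mul_assoc[symmetric]) (simp add: matrix_mul_assoc mpow_half[OF S])
      thus ?thesis by (simp add: J)
    qed
    moreover have "\<Theta> \<kappa> ** S ** \<Theta> \<kappa> = J ** rsp V \<kappa> ** (J ** S ** J) ** rsp V \<kappa> ** J"
      unfolding \<Theta>_def by (simp only: matrix_mul_assoc)
    ultimately have "\<Theta> \<kappa> ** S ** \<Theta> \<kappa> = J ** (rsp V \<kappa> ** rsp V \<kappa>) ** J"
      by (simp add: matrix_mul_assoc)
    thus ?thesis by (simp add: K_eq[symmetric] sp_mult[OF V]) (simp add: \<Theta>_def)
  qed
  hence "Re (cip u (\<Phi> (mpow S (-1)) *v u)) + Re (cip w (\<Phi> (K ** S ** K) *v w)) -
      2 * Re (cip u (\<Phi> K *v w)) =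
      (\<Sum>i\<in>UNIV. Re (cip (u - \<kappa> i *\<^sub>R w) (\<phi> i *v (u - \<kappa> i *\<^sub>R w))))"
  proof -
    assume KSK: "K ** S ** K = \<Theta> (\<lambda>i. \<kappa> i * \<kappa> i)"
    have "Re (cip (u - \<kappa> i *\<^sub>R w) (\<phi> i *v (u - \<kappa> i *\<^sub>R w))) = Re (cip u (\<phi> i *v u)) +
        \<kappa> i * \<kappa> i * Re (cip w (\<phi> i *v w)) - 2 * (\<kappa> i * Re (cip u (\<phi> i *v w)))" for i
    proof -
      have "Re (cip w (\<phi> i *v u)) = Re (cip u (\<phi> i *v w))"
        using psd[of i] by (metis Re_cip_commute hermitian_cip psd_def)
      thus ?thesis
        by (simp add: matrix_vector_mult_diff_distrib matrix_vector_scaleR cip_simps algebra_simps)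
    qed
    thus ?thesis
      unfolding S_inv KSK by (subst K_eq) (simp add: \<Phi>\<Theta> sum.distrib sum_subtractf sum_distrib_left)
  qed
  moreover have "\<dots> \<ge> 0"
    using psd by (intro sum_nonneg) (simp add: psd_def)
  ultimately show ?thesis by linarith
qed

lemma mpow_inverse:
  assumes "posdef A"
  shows "mpow A r ** mpow A (- r) = mat 1" "mpow A (- r) ** mpow A r = mat 1"
  using assms by (simp_all add: mpow_mult mpow_0)

text \<open>Each K gives a positive linear map whose values dominate the inverse. The choice of K at
  the point A gives equality there, as required at the convex combination, and domination elsewhere,
  as required at the end points.\<close>

lemma inverse_as_minimum:
  fixes \<Phi> :: "complex^'n^'n \<Rightarrow> complex^'l^'l"
  assumes \<Phi>: "pos_map \<Phi>" "strictly_positive \<Phi>" and A: "posdef A"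
  obtains \<Phi>' where "pos_map \<Phi>'"
    "\<Phi>' (mpow A p) = mpow (\<Phi> (mpow A (- p))) (-1)"
    "\<And>B. posdef B \<Longrightarrow> psd (\<Phi>' (mpow B p) - mpow (\<Phi> (mpow B (- p))) (-1))"
proof -
  define K where "K = mpow A (- p)"
  have K: "posdef K" unfolding K_def by (rule posdef_mpow[OF A])
  define W where "W = \<Phi> K"
  have W: "posdef W" using \<Phi>(2) K by (simp add: W_def strictly_positive_def)
  have inv: "mpow C (-1) *v (C *v v) = v" "C *v (mpow C (-1) *v v) = v" if "posdef C" for C :: "complex^'l^'l" and v
    using mpow_inverse[OF that, of 1] by (simp_all add: matrix_vector_mul_assoc mpow_1[OF that])
  define \<Phi>' where "\<Phi>' = (\<lambda>S. mpow W (-1) ** \<Phi> (K ** S ** K) ** mpow W (-1))"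
  have cK: "cadj K = K" using K by (simp add: posdef_iff hermitian_mat_def)
  have pos: "pos_map \<Phi>'"
    using pos_map_congruence[OF \<Phi>(1), of "mpow W (-1)" K] by (simp add: \<Phi>'_def cK cadj_mpow[OF W])
  show thesis
  proof (rule that[OF pos])
    have "K ** mpow A p ** K = K"
      using mpow_inverse(2)[OF A, of p] by (simp add: K_def)
    hence "\<Phi>' (mpow A p) = mpow W (-1) ** mpow W 1 ** mpow W (-1)"
      by (simp add: \<Phi>'_def mpow_1[OF W]) (simp add: W_def)
    also have "\<dots> = mpow W (-1)"
      by (simp only: mpow_mult[OF W]) simp
    finally show "\<Phi>' (mpow A p) = mpow (\<Phi> (mpow A (- p))) (-1)" by (simp add: W_def K_def)
  next
    fix B :: "complex^'n^'n" assume B: "posdef B"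
    define S where "S = mpow B p"
    have S: "posdef S" unfolding S_def by (rule posdef_mpow[OF B])
    have S_inv: "mpow S (-1) = mpow B (- p)" by (simp add: S_def mpow_mpow[OF B])
    define P where "P = \<Phi> (mpow S (-1))"
    have P: "posdef P" using \<Phi>(2) posdef_mpow[OF S] by (simp add: P_def strictly_positive_def)
    have "Re (cip v (mpow P (-1) *v v)) \<le> Re (cip v (\<Phi>' S *v v))" for v
    proof -
      \<comment> \<open>With w below, chosen so that \<open>P u = v\<close> and
        \<open>W w = v\<close>. The block inequality then says that twice the form of
        \<open>P^(-1)\<close> at v is at most that form plus the form of \<open>\<Phi>' S\<close> at
        v.\<close>
      define u where "u = mpow P (-1) *v v"
      define w where "w = mpow W (-1) *v v"
      have "2 * Re (cip u (W *v w)) \<le> Re (cip u (P *v u)) + Re (cip w (\<Phi> (K ** S ** K) *v w))"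
        unfolding W_def P_def using pos_map_block_inequality[OF \<Phi>(1) S, of K u w] K by (simp add: posdef_iff)
      moreover have "W *v w = v" "P *v u = v" by (simp_all add: w_def u_def inv W P)
      moreover have "cip w (\<Phi> (K ** S ** K) *v w) = cip v (\<Phi>' S *v v)"
        by (simp add: w_def \<Phi>'_def cip_cadj' cadj_mpow[OF W] matrix_vector_mul_assoc matrix_mul_assoc)
      moreover have "Re (cip u v) = Re (cip v (mpow P (-1) *v v))"
        unfolding u_def by (rule Re_cip_commute)
      ultimately show ?thesis by simp
    qed
    moreover have "hermitian_mat (\<Phi>' S - mpow P (-1))"
      using pos_map_psd[OF pos posdef_imp_psd[OF S]] posdef_mpow[OF P, of "-1"]
      by (simp add: hermitian_diff psd_def posdef_iff)
    ultimately have "psd (\<Phi>' S - mpow P (-1))"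
      by (simp add: psd_def matrix_vector_mult_diff_rdistrib cip_simps)
    thus "psd (\<Phi>' (mpow B p) - mpow (\<Phi> (mpow B (- p))) (-1))"
      by (simp add: P_def S_inv) (simp add: S_def)
  qed
qed

section \<open>Inverses of sandwiches and joint concavity of both functions\<close>

lemma matrix_inv_eqI:
  fixes A B :: "complex^'n^'n"
  assumes "A ** B = mat 1"
  shows "matrix_inv A = B"
proof -
  have BA: "B ** A = mat 1" using assms matrix_left_right_inverse by blast
  hence "A ** matrix_inv A = mat 1 \<and> matrix_inv A ** A = mat 1"
    unfolding matrix_inv_def using assms by (intro someI_ex[of "\<lambda>C. A ** C = mat 1 \<and> C ** A = mat 1"]) blast
  hence "matrix_inv A = (B ** A) ** matrix_inv A" by (simp add: BA)
  also have "\<dots> = B" using \<open>_ \<and> _\<close> by (simp add: matrix_mul_assoc[symmetric])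
  finally show ?thesis .
qed

text \<open>Keeps the second function in the shape already treated: a sandwich, now of the inverses
  of the two factors.\<close>

lemma matrix_inv_sandwich:
  assumes P: "posdef P" and Q: "posdef Q"
  shows "matrix_inv (sandwich P Q) = sandwich (mpow P (-1)) (mpow Q (-1))"
proof (rule matrix_inv_eqI)
  have "sandwich P Q ** sandwich (mpow P (-1)) (mpow Q (-1)) =
      mpow P (1/2) ** Q ** (mpow P (1/2) ** mpow P (- (1/2))) ** mpow Q (-1) ** mpow P (- (1/2))"
    by (simp add: sandwich_def mpow_mpow[OF P] matrix_mul_assoc)
  also have "\<dots> = mpow P (1/2) ** (Q ** mpow Q (-1)) ** mpow P (- (1/2))"
    by (simp add: mpow_half_inverse[OF P] matrix_mul_assoc)
  also have "Q ** mpow Q (-1) = mat 1"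
    using mpow_inverse(1)[OF Q, of 1] by (simp add: mpow_1[OF Q])
  finally show "sandwich P Q ** sandwich (mpow P (-1)) (mpow Q (-1)) = mat 1"
    by (simp add: mpow_half_inverse[OF P])
qed

lemma psd_0: "psd 0"
  by (simp add: psd_def hermitian_mat_def)

lemma jointly_concaveI:
  fixes F :: "complex^'n^'n \<Rightarrow> complex^'m^'m \<Rightarrow> real"
  assumes "\<And>A\<^sub>1 A\<^sub>2 B\<^sub>1 B\<^sub>2 t. posdef A\<^sub>1 \<Longrightarrow> posdef A\<^sub>2 \<Longrightarrow> posdef B\<^sub>1 \<Longrightarrow> posdef B\<^sub>2 \<Longrightarrow> 0 < t \<Longrightarrow> t < 1 \<Longrightarrow>
    t * F A\<^sub>1 B\<^sub>1 + (1 - t) * F A\<^sub>2 B\<^sub>2 \<le> F (t *\<^sub>R A\<^sub>1 + (1 - t) *\<^sub>R A\<^sub>2) (t *\<^sub>R B\<^sub>1 + (1 - t) *\<^sub>R B\<^sub>2)"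
  shows "jointly_concave F"
  unfolding jointly_concave_def
proof (intro allI impI, elim conjE)
  fix A\<^sub>1 A\<^sub>2 :: "complex^'n^'n" and B\<^sub>1 B\<^sub>2 :: "complex^'m^'m" and t :: real
  assume "posdef A\<^sub>1" "posdef A\<^sub>2" "posdef B\<^sub>1" "posdef B\<^sub>2" "0 \<le> t" "t \<le> 1"
  then show "t * F A\<^sub>1 B\<^sub>1 + (1 - t) * F A\<^sub>2 B\<^sub>2 \<le> F (t *\<^sub>R A\<^sub>1 + (1 - t) *\<^sub>R A\<^sub>2) (t *\<^sub>R B\<^sub>1 + (1 - t) *\<^sub>R B\<^sub>2)"
    using assms[of A\<^sub>1 A\<^sub>2 B\<^sub>1 B\<^sub>2 t] by (cases "t = 0 \<or> t = 1") auto
qed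

theorem trace_functions_jointly_concave:
  fixes \<Phi> :: "complex^'n^'n \<Rightarrow> complex^'l^'l" and \<Psi> :: "complex^'m^'m \<Rightarrow> complex^'l^'l"
  assumes lin: "clinear_map \<Phi>" "clinear_map \<Psi>" and sp: "strictly_positive \<Phi>" "strictly_positive \<Psi>"
    and p: "0 \<le> p" "p \<le> 1" and q: "0 \<le> q" "q \<le> 1"
    and mono: "\<And>x y. 0 < x \<Longrightarrow> x \<le> y \<Longrightarrow> f x \<le> f y"
    and conc: "concave_on {0<..} (\<lambda>x. f (x powr (1 + p))) \<or> concave_on {0<..} (\<lambda>x. f (x powr (1 + q)))"
  shows "jointly_concave (\<lambda>A B. Re (trace (matfun f (sandwich (\<Phi> (mpow A p)) (\<Psi> (mpow B q))))))"
    and "jointly_concave (\<lambda>A B. Re (trace (matfun f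
      (matrix_inv (sandwich (\<Phi> (mpow A (- p))) (\<Psi> (mpow B (- q))))))))"
proof -
  have pm: "pos_map \<Phi>" "pos_map \<Psi>"
    using lin sp by (simp_all add: strictly_positive_imp_pos_map)
  have P: "posdef (\<Phi> (mpow A r))" if "posdef A" for A r
    using sp(1) posdef_mpow[OF that] by (simp add: strictly_positive_def)
  have Q: "posdef (\<Psi> (mpow B r))" if "posdef B" for B r
    using sp(2) posdef_mpow[OF that] by (simp add: strictly_positive_def)
  show "jointly_concave (\<lambda>A B. Re (trace (matfun f (sandwich (\<Phi> (mpow A p)) (\<Psi> (mpow B q))))))"
  proof (rule jointly_concaveI)
    fix A\<^sub>1 A\<^sub>2 :: "complex^'n^'n" and B\<^sub>1 B\<^sub>2 :: "complex^'m^'m" and t :: real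
    assume *: "posdef A\<^sub>1" "posdef A\<^sub>2" "posdef B\<^sub>1" "posdef B\<^sub>2" "0 < t" "t < 1"
    show "t * Re (trace (matfun f (sandwich (\<Phi> (mpow A\<^sub>1 p)) (\<Psi> (mpow B\<^sub>1 q))))) +
        (1 - t) * Re (trace (matfun f (sandwich (\<Phi> (mpow A\<^sub>2 p)) (\<Psi> (mpow B\<^sub>2 q))))) \<le>
        Re (trace (matfun f (sandwich (\<Phi> (mpow (t *\<^sub>R A\<^sub>1 + (1 - t) *\<^sub>R A\<^sub>2) p))
          (\<Psi> (mpow (t *\<^sub>R B\<^sub>1 + (1 - t) *\<^sub>R B\<^sub>2) q)))))"
      by (rule trace_function_concave_both[OF pm *(1-4) p q *(5,6) _ _ _ _ _ _ _ _ _ _ refl refl mono conc])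
         (simp_all add: P Q * posdef_weighted psd_0)
  qed
  show "jointly_concave (\<lambda>A B. Re (trace (matfun f
      (matrix_inv (sandwich (\<Phi> (mpow A (- p))) (\<Psi> (mpow B (- q))))))))"
  proof (rule jointly_concaveI)
    fix A\<^sub>1 A\<^sub>2 :: "complex^'n^'n" and B\<^sub>1 B\<^sub>2 :: "complex^'m^'m" and t :: real
    assume *: "posdef A\<^sub>1" "posdef A\<^sub>2" "posdef B\<^sub>1" "posdef B\<^sub>2" "0 < t" "t < 1"
    define A where "A = t *\<^sub>R A\<^sub>1 + (1 - t) *\<^sub>R A\<^sub>2"
    define B where "B = t *\<^sub>R B\<^sub>1 + (1 - t) *\<^sub>R B\<^sub>2"
    have A: "posdef A" and B: "posdef B" using * by (simp_all add: A_def B_def posdef_weighted)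
    \<comment> \<open>The minimum is taken at the convex combination A, so \<open>\<Phi>'\<close>
      agrees with the inverse there and dominates it at \<open>A\<^sub>1\<close> and
      \<open>A\<^sub>2\<close>.\<close>
    obtain \<Phi>' where \<Phi>': "pos_map \<Phi>'" "\<Phi>' (mpow A p) = mpow (\<Phi> (mpow A (- p))) (-1)"
      "\<And>B. posdef B \<Longrightarrow> psd (\<Phi>' (mpow B p) - mpow (\<Phi> (mpow B (- p))) (-1))"
      using inverse_as_minimum[OF pm(1) sp(1) A] by blast
    obtain \<Psi>' where \<Psi>': "pos_map \<Psi>'" "\<Psi>' (mpow B q) = mpow (\<Psi> (mpow B (- q))) (-1)"
      "\<And>B. posdef B \<Longrightarrow> psd (\<Psi>' (mpow B q) - mpow (\<Psi> (mpow B (- q))) (-1))"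
      using inverse_as_minimum[OF pm(2) sp(2) B] by blast
    have eqs: "\<Phi>' (mpow (t *\<^sub>R A\<^sub>1 + (1 - t) *\<^sub>R A\<^sub>2) p) = mpow (\<Phi> (mpow A (- p))) (-1)"
      "\<Psi>' (mpow (t *\<^sub>R B\<^sub>1 + (1 - t) *\<^sub>R B\<^sub>2) q) = mpow (\<Psi> (mpow B (- q))) (-1)"
      using \<Phi>'(2) \<Psi>'(2) by (simp_all add: A_def B_def)
    have "t * Re (trace (matfun f (sandwich (mpow (\<Phi> (mpow A\<^sub>1 (- p))) (-1)) (mpow (\<Psi> (mpow B\<^sub>1 (- q))) (-1))))) +
        (1 - t) * Re (trace (matfun f (sandwich (mpow (\<Phi> (mpow A\<^sub>2 (- p))) (-1)) (mpow (\<Psi> (mpow B\<^sub>2 (- q))) (-1))))) \<le>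
        Re (trace (matfun f (sandwich (mpow (\<Phi> (mpow A (- p))) (-1)) (mpow (\<Psi> (mpow B (- q))) (-1)))))"
      by (rule trace_function_concave_both[OF \<Phi>'(1) \<Psi>'(1) *(1-4) p q *(5,6) _ _ _ _ _ _ _ _ _ _
            eqs mono conc])
         (simp_all add: posdef_mpow P Q * A B \<Phi>'(3) \<Psi>'(3))
    thus "t * Re (trace (matfun f (matrix_inv (sandwich (\<Phi> (mpow A\<^sub>1 (- p))) (\<Psi> (mpow B\<^sub>1 (- q))))))) +
        (1 - t) * Re (trace (matfun f (matrix_inv (sandwich (\<Phi> (mpow A\<^sub>2 (- p))) (\<Psi> (mpow B\<^sub>2 (- q))))))) \<le>
        Re (trace (matfun f (matrix_inv (sandwich (\<Phi> (mpow (t *\<^sub>R A\<^sub>1 + (1 - t) *\<^sub>R A\<^sub>2) (- p)))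
          (\<Psi> (mpow (t *\<^sub>R B\<^sub>1 + (1 - t) *\<^sub>R B\<^sub>2) (- q)))))))"
      using A B by (simp add: matrix_inv_sandwich P Q * A_def B_def)
  qed
qed

section \<open>From concave to convex functions\<close>

lemma matfun_uminus:
  assumes "posdef T"
  shows "trace (matfun (\<lambda>x. - f x) T) = - trace (matfun f T)"
proof -
  obtain U d where "unitary_mat U" "T = rsp U d"
    using posdef_spectral[OF assms] by blast
  thus ?thesis by (simp add: matfun_rsp trace_rsp[of U] trace_sp sum_negf[symmetric])
qed

text \<open>The relation between F and F' is asked for at positive definite arguments, where
  \<open>matfun\<close> is evaluated through a spectral decomposition.\<close>

lemma jointly_convex_uminus:
  fixes F :: "complex^'n^'n \<Rightarrow> complex^'m^'m \<Rightarrow> real"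
  shows "jointly_concave F \<Longrightarrow> (\<And>A B. posdef A \<Longrightarrow> posdef B \<Longrightarrow> F A B = - F' A B) \<Longrightarrow> jointly_convex F'"
  unfolding jointly_concave_def jointly_convex_def
proof (intro allI impI, elim conjE)
  fix A\<^sub>1 A\<^sub>2 :: "complex^'n^'n" and B\<^sub>1 B\<^sub>2 :: "complex^'m^'m" and t :: real
  assume F: "\<And>A B. posdef A \<Longrightarrow> posdef B \<Longrightarrow> F A B = - F' A B"
    and conc: "\<forall>A1 A2 B1 B2 t. posdef A1 \<and> posdef A2 \<and> posdef B1 \<and> posdef B2 \<and> 0 \<le> t \<and> t \<le> 1 \<longrightarrow>
      t * F A1 B1 + (1 - t) * F A2 B2 \<le> F (t *\<^sub>R A1 + (1 - t) *\<^sub>R A2) (t *\<^sub>R B1 + (1 - t) *\<^sub>R B2)"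
    and *: "posdef A\<^sub>1" "posdef A\<^sub>2" "posdef B\<^sub>1" "posdef B\<^sub>2" "0 \<le> t" "t \<le> 1"
  show "F' (t *\<^sub>R A\<^sub>1 + (1 - t) *\<^sub>R A\<^sub>2) (t *\<^sub>R B\<^sub>1 + (1 - t) *\<^sub>R B\<^sub>2) \<le> t * F' A\<^sub>1 B\<^sub>1 + (1 - t) * F' A\<^sub>2 B\<^sub>2"
  proof (cases "t = 0 \<or> t = 1")
    case False
    hence "posdef (t *\<^sub>R A\<^sub>1 + (1 - t) *\<^sub>R A\<^sub>2)" "posdef (t *\<^sub>R B\<^sub>1 + (1 - t) *\<^sub>R B\<^sub>2)"
      using * by (auto intro!: posdef_weighted)
    thus ?thesis using conc[rule_format, of A\<^sub>1 A\<^sub>2 B\<^sub>1 B\<^sub>2 t] * by (simp add: F)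
  qed auto
qed

theorem theorem5p2:
  fixes \<Phi> :: "complex^'n^'n \<Rightarrow> complex^'l^'l"
    and \<Psi> :: "complex^'m^'m \<Rightarrow> complex^'l^'l"
    and p q :: real
    and f :: "real \<Rightarrow> real"
  assumes "clinear_map \<Phi>" and "strictly_positive \<Phi>"
    and "clinear_map \<Psi>" and "strictly_positive \<Psi>"
    and "0 \<le> p" and "p \<le> 1" and "0 \<le> q" and "q \<le> 1" and "(p, q) \<noteq> (0, 0)"
  defines "F1 \<equiv> (\<lambda>A B. Re (trace (matfun f
              (matfun (\<lambda>x. x powr (1/2)) (\<Phi> (matfun (\<lambda>x. x powr p) A))
               ** \<Psi> (matfun (\<lambda>x. x powr q) B)
               ** matfun (\<lambda>x. x powr (1/2)) (\<Phi> (matfun (\<lambda>x. x powr p) A))))))"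
    and "F2 \<equiv> (\<lambda>A B. Re (trace (matfun f (matrix_inv
              (matfun (\<lambda>x. x powr (1/2)) (\<Phi> (matfun (\<lambda>x. x powr (- p)) A))
               ** \<Psi> (matfun (\<lambda>x. x powr (- q)) B)
               ** matfun (\<lambda>x. x powr (1/2)) (\<Phi> (matfun (\<lambda>x. x powr (- p)) A)))))))"
  shows "((\<forall>x y. 0 < x \<longrightarrow> x \<le> y \<longrightarrow> f x \<le> f y) \<and>
          (concave_on {0<..} (\<lambda>x. f (x powr (1 + p))) \<or> concave_on {0<..} (\<lambda>x. f (x powr (1 + q))))
          \<longrightarrow> jointly_concave F1 \<and> jointly_concave F2)
       \<and> ((\<forall>x y. 0 < x \<longrightarrow> x \<le> y \<longrightarrow> f y \<le> f x) \<and>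
          (convex_on {0<..} (\<lambda>x. f (x powr (1 + p))) \<or> convex_on {0<..} (\<lambda>x. f (x powr (1 + q))))
          \<longrightarrow> jointly_convex F1 \<and> jointly_convex F2)"
proof -
  note maps = assms(1,3,2,4-8)
  define G1 where "G1 f A B = Re (trace (matfun f (sandwich (\<Phi> (mpow A p)) (\<Psi> (mpow B q)))))" for f A B
  define G2 where "G2 f A B =
    Re (trace (matfun f (matrix_inv (sandwich (\<Phi> (mpow A (- p))) (\<Psi> (mpow B (- q)))))))" for f A B
  have F1: "F1 = G1 f" and F2: "F2 = G2 f"
    by (simp_all add: F1_def F2_def G1_def G2_def sandwich_def mpow_def fun_eq_iff)
  have P: "posdef (\<Phi> (mpow A r))" if "posdef A" for A r
    using assms(2) posdef_mpow[OF that] by (simp add: strictly_positive_def)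
  have Q: "posdef (\<Psi> (mpow B r))" if "posdef B" for B r
    using assms(4) posdef_mpow[OF that] by (simp add: strictly_positive_def)
  have concave: "jointly_concave (G1 g)" "jointly_concave (G2 g)"
    if "\<And>x y. 0 < x \<Longrightarrow> x \<le> y \<Longrightarrow> g x \<le> g y"
      "concave_on {0<..} (\<lambda>x. g (x powr (1 + p))) \<or> concave_on {0<..} (\<lambda>x. g (x powr (1 + q)))" for g
    unfolding G1_def[abs_def] G2_def[abs_def]
    by (rule trace_functions_jointly_concave[OF maps that]; assumption)+
  have "jointly_concave F1 \<and> jointly_concave F2"
    if "\<forall>x y. 0 < x \<longrightarrow> x \<le> y \<longrightarrow> f x \<le> f y"
      "concave_on {0<..} (\<lambda>x. f (x powr (1 + p))) \<or> concave_on {0<..} (\<lambda>x. f (x powr (1 + q)))"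
    unfolding F1 F2 using concave[of f] that by blast
  moreover have "jointly_convex F1 \<and> jointly_convex F2"
    if mono: "\<forall>x y. 0 < x \<longrightarrow> x \<le> y \<longrightarrow> f y \<le> f x"
      and conv: "convex_on {0<..} (\<lambda>x. f (x powr (1 + p))) \<or> convex_on {0<..} (\<lambda>x. f (x powr (1 + q)))"
  proof -
    \<comment> \<open>The concave case is applied to -f, which is non-decreasing and has a concave
      composition with one of the two powers.\<close>
    have *: "jointly_concave (G1 (\<lambda>x. - f x))" "jointly_concave (G2 (\<lambda>x. - f x))"
      using mono conv by (intro concave; simp add: concave_on_def)+
    have "G1 (\<lambda>x. - f x) A B = - G1 f A B" "G2 (\<lambda>x. - f x) A B = - G2 f A B"
      if "posdef A" "posdef B" for A B
      using that by (simp_all add: G1_def G2_def matfun_uminus posdef_sandwich posdef_mpow matrix_inv_sandwich P Q)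
    with * show ?thesis unfolding F1 F2 by (blast intro: jointly_convex_uminus)
  qed
  ultimately show ?thesis by blast
qed

end
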